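(* Let $t_0<T$ and let $\boldsymbol{B}:[t_0,T]\to\mathbb{R}^3$ be continuously differentiable (in particular bounded). Consider the Itô SDE on $[t_0,T]$ $$\mathrm{d}\boldsymbol{v}=\Big(\boldsymbol{v}\times\boldsymbol{B}(t)-D(v)\frac{\boldsymbol{v}}{v^{2}}\Big)\mathrm{d}t+\sqrt{D(v)}\Big(\boldsymbol{I}-\frac{\boldsymbol{v}\boldsymbol{v}^{\mathsf T}}{v^{2}}\Big)\mathrm{d}\boldsymbol{W},\qquad D(v)=1/v,$$ with initial condition $\boldsymbol{v}(t_0)=\boldsymbol{v}_0\in\mathbb{R}^3\setminus\{0\}$, and let $\boldsymbol{v}(t;t_0,\boldsymbol{v}_0)$ denote its solution. For $N\in\mathbb{N}$, $h=(T-t_0)/N$, $t_k=t_0+kh$, let $\bar{\boldsymbol{v}}(t_k;t_0,\boldsymbol{v}_0,h)=\boldsymbol{v}_k$ be the numerical solution produced by the ESEC scheme (defined in the context) started from $\boldsymbol{v}_0$. Then there is a constant $K$ independent of $h$ (it may depend on $\boldsymbol{v}_0$, $T-t_0$ and $\boldsymbol{B}$) such that for all $N\in\mathbb{N}$ and all $k=0,1,\dots,N$, $$\Big[\mathbb{E}\big|\boldsymbol{v}(t_k;t_0,\boldsymbol{v}_0)-\bar{\boldsymbol{v}}(t_k;t_0,\boldsymbol{v}_0,h)\big|^2\Big]^{1/2}\le K\,(1+|\boldsymbol{v}_0|^2)^{1/2}\,h^{1/2}.$$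
   Context: $\boldsymbol{W}$ is a standard three-dimensional Wiener process, $v=|\boldsymbol{v}|$ is the Euclidean norm, $\boldsymbol{I}$ is the $3\times3$ identity and $\boldsymbol{v}\boldsymbol{v}^{\mathsf T}$ the outer product. The ESEC (explicitly solvable energy-conserving) scheme: given $\boldsymbol{v}_k\neq0$, with $D_k=1/|\boldsymbol{v}_k|$ and $\Delta\boldsymbol{W}_k=\boldsymbol{W}(t_{k+1})-\boldsymbol{W}(t_k)$, the next iterate $\boldsymbol{v}_{k+1}$ is the solution of the (linearly implicit) equation $$\boldsymbol{v}_{k+1}-\boldsymbol{v}_k=\boldsymbol{v}_{k+1/2}\times\boldsymbol{B}(t_k)\,h+\sqrt{D_k}\Big(\frac{\boldsymbol{v}_k\times\Delta\boldsymbol{W}_k}{|\boldsymbol{v}_k|^{2}}\Big)\times\boldsymbol{v}_{k+1/2},\qquad \boldsymbol{v}_{k+1/2}=\tfrac12(\boldsymbol{v}_k+\boldsymbol{v}_{k+1}).$$ Equivalently $\boldsymbol{v}_{k+1}=(\boldsymbol{I}-\hat{\boldsymbol{M}}_k)^{-1}(\boldsymbol{I}+\hat{\boldsymbol{M}}_k)\boldsymbol{v}_k$ with $\boldsymbol{M}_k=\sqrt{D_k}\,\frac{\boldsymbol{v}_k\times\Delta\boldsymbol{W}_k}{2|\boldsymbol{v}_k|^2}-\frac12\boldsymbol{B}(t_k)h$, where $\hat{\boldsymbol{X}}$ denotes the skew-symmetric matrix with $\hat{\boldsymbol{X}}\boldsymbol{Y}=\boldsymbol{X}\times\boldsymbol{Y}$.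 The scheme satisfies $|\boldsymbol{v}_{k+1}|=|\boldsymbol{v}_k|$, so all iterates are nonzero when $\boldsymbol{v}_0\neq0$. *)

theory Defs
  imports "HOL-Probability.Probability" "HOL-Analysis.Cross3"
begin

definition outer3 :: "real^3 \<Rightarrow> real^3 \<Rightarrow> real^3^3" where
  "outer3 u w = (\<chi> i j. u $ i * w $ j)"

definition Dcoef :: "real \<Rightarrow> real" where
  "Dcoef r = 1 / r"

definition drift :: "(real \<Rightarrow> real^3) \<Rightarrow> real \<Rightarrow> real^3 \<Rightarrow> real^3" where
  "drift B t v = cross3 v (B t) - (Dcoef (norm v) / (norm v)\<^sup>2) *\<^sub>R v"

definition diffusion :: "real^3 \<Rightarrow> real^3^3" where
  "diffusion v = sqrt (Dcoef (norm v)) *\<^sub>R (mat 1 - (1 / (norm v)\<^sup>2) *\<^sub>R outer3 v v)"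

text \<open>Standard three-dimensional Wiener process on [t0,T] w.r.t. filtration F
  on the probability space M (started at 0 at time t0; only increments matter).\<close>
definition wiener3 ::
  "'a measure \<Rightarrow> (real \<Rightarrow> 'a measure) \<Rightarrow> real \<Rightarrow> real \<Rightarrow> (real \<Rightarrow> 'a \<Rightarrow> real^3) \<Rightarrow> bool" where
  "wiener3 M F t0 T W \<longleftrightarrow>
     prob_space M \<and>
     (\<forall>t. subalgebra M (F t)) \<and> filtration (space M) F \<and>
     (\<forall>\<omega>\<in>space M. W t0 \<omega> = 0 \<and> continuous_on {t0..T} (\<lambda>t. W t \<omega>)) \<and>
     (\<forall>t\<in>{t0..T}. W t \<in> borel_measurable (F t)) \<and>
     (\<forall>s t. t0 \<le> s \<and> s < t \<and> t \<le> T \<longrightarrow>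
        (\<forall>i. distributed M lborel (\<lambda>\<omega>. (W t \<omega> - W s \<omega>) $ i) (normal_density 0 (sqrt (t - s)))) \<and>
        prob_space.indep_vars M (\<lambda>_. borel) (\<lambda>i \<omega>. (W t \<omega> - W s \<omega>) $ i) (UNIV :: 3 set) \<and>
        prob_space.indep_set M (sets (F s))
          (sets (vimage_algebra (space M) (\<lambda>\<omega>. W t \<omega> - W s \<omega>) (borel :: (real^3) measure))))"

definition conv_in_prob :: "'a measure \<Rightarrow> (nat \<Rightarrow> 'a \<Rightarrow> real^3) \<Rightarrow> ('a \<Rightarrow> real^3) \<Rightarrow> bool" where
  "conv_in_prob M X Y \<longleftrightarrow>
     (\<forall>e>0. (\<lambda>n. measure M {\<omega>\<in>space M. e < norm (X n \<omega> - Y \<omega>)}) \<longlonglongrightarrow> 0)"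

definition ito_sum ::
  "(real \<Rightarrow> 'a \<Rightarrow> real^3^3) \<Rightarrow> (real \<Rightarrow> 'a \<Rightarrow> real^3) \<Rightarrow> real \<Rightarrow> real \<Rightarrow> nat \<Rightarrow> 'a \<Rightarrow> real^3" where
  "ito_sum G W t0 t n \<omega> =
     (\<Sum>j<n. G (t0 + real j * (t - t0) / real n) \<omega> *v
              (W (t0 + real (Suc j) * (t - t0) / real n) \<omega> - W (t0 + real j * (t - t0) / real n) \<omega>))"

text \<open>Strong solution of the SDE on [t0,T] with v(t0) = v0: continuous adapted
  process, nonvanishing, satisfying the integral equation where the stochastic
  integral of the continuous adapted integrand is the Ito integral, i.e. the limit
  in probability of left-point Riemann sums.\<close>
definition sde_solution ::
  "'a measure \<Rightarrow> (real \<Rightarrow> 'a measure) \<Rightarrow> real \<Rightarrow> real \<Rightarrow> (real \<Rightarrow> real^3) \<Rightarrow>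
   (real \<Rightarrow> 'a \<Rightarrow> real^3) \<Rightarrow> real^3 \<Rightarrow> (real \<Rightarrow> 'a \<Rightarrow> real^3) \<Rightarrow> bool" where
  "sde_solution M F t0 T B W v0 v \<longleftrightarrow>
     (\<forall>\<omega>\<in>space M. v t0 \<omega> = v0 \<and> continuous_on {t0..T} (\<lambda>t. v t \<omega>) \<and>
                   (\<forall>t\<in>{t0..T}. v t \<omega> \<noteq> 0)) \<and>
     (\<forall>t\<in>{t0..T}. v t \<in> borel_measurable (F t)) \<and>
     (\<forall>t\<in>{t0..T}.
        conv_in_prob M (ito_sum (\<lambda>s \<omega>. diffusion (v s \<omega>)) W t0 t)
          (\<lambda>\<omega>. v t \<omega> - v0 - integral {t0..t} (\<lambda>s. drift B s (v s \<omega>))))"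

definition esec_step :: "real \<Rightarrow> real^3 \<Rightarrow> real^3 \<Rightarrow> real^3 \<Rightarrow> real^3" where
  "esec_step h Bk dW v =
     (THE w. w - v = h *\<^sub>R cross3 ((1/2) *\<^sub>R (v + w)) Bk
                   + cross3 (sqrt (Dcoef (norm v)) *\<^sub>R ((1 / (norm v)\<^sup>2) *\<^sub>R cross3 v dW))
                            ((1/2) *\<^sub>R (v + w)))"

fun esec :: "(real \<Rightarrow> real^3) \<Rightarrow> (real \<Rightarrow> 'a \<Rightarrow> real^3) \<Rightarrow> real \<Rightarrow> real \<Rightarrow> real^3 \<Rightarrow> nat \<Rightarrow> 'a \<Rightarrow> real^3" where
  "esec B W t0 h v0 0 \<omega> = v0"
| "esec B W t0 h v0 (Suc k) \<omega> =
     esec_step h (B (t0 + real k * h))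
       (W (t0 + real (Suc k) * h) \<omega> - W (t0 + real k * h) \<omega>) (esec B W t0 h v0 k \<omega>)"

end

theory Submission
  imports Defs
begin

text \<open>
  The scheme preserves the norm exactly, and its one-step map expands as an Euler step plus a
  conditionally centred term of mean square \<open>O(h\<^sup>2)\<close> plus a remainder of mean square \<open>O(h\<^sup>3)\<close>.
  The stochastic integral enters only through its definition as a limit in probability of
  left-point sums: on the grid refining the scheme by a factor \<open>n\<close>, the error is the limit in
  probability of sums of drift differences and martingale increments, whose second moments are
  bounded uniformly in \<open>n\<close>. A Fatou argument and Gronwall's inequality give the rate \<open>h\<close> for
  the mean square error.

  The coefficients are Lipschitz only away from the origin and at bounded distance, so the argument
  runs on the event that the solution has stayed in the annulus \<open>r/2 \<le> |v| \<le> 2r\<close>, where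
  \<open>r = |v\<^sub>0|\<close>. No Ito formula is needed to remove this restriction: since the scheme lives on the
  sphere of radius \<open>r\<close>, letting \<open>h\<close> tend to zero in the localized estimate shows that the solution
  is on that sphere as long as it has stayed in the annulus, hence by continuity it never leaves.
\<close>

unbundle cross3_syntax

subsection \<open>Coefficients and the one-step map\<close>

text \<open>The radial drift is absent from the scheme and comes out of its second-order term. With
  \<open>a\<close> the vector of the Cayley transform, \<open>2 (a \<times> (a \<times> v))\<close>
  is \<open>- 2 |a|^2 v\<close> up to higher order, and \<open>|v \<times> dW|^2\<close> has
  conditional mean \<open>2 r^2 h\<close>: the mean yields \<open>- h D v / v^2\<close>, the
  fluctuation is the centred term.

  The obstacle is that no moment of the solution or of its stochastic integral is known beforehand.
  Every fine increment is therefore multiplied by the indicator that the path has stayed in the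
  annulus up to the left end of that increment. The indicator is known at that time, so the noise
  increments stay centred and get bounded second moments; on the event of staying to the end all
  indicators are 1 and the cut sums are the true ones.

  Over \<open>N\<close> steps the centred terms are orthogonal and contribute \<open>N h^2\<close>,
  the remainders at most \<open>N^2 h^3\<close> by Cauchy-Schwarz: both are of order
  \<open>h\<close>. So is the effect of the movement of the solution within a step, while the scheme
  keeps its coefficients frozen.\<close>

definition dif :: "real^3 \<Rightarrow> real^3 \<Rightarrow> real^3" where
  "dif x w = sqrt (Dcoef (norm x)) *\<^sub>R (w - ((x \<bullet> w) / (norm x)\<^sup>2) *\<^sub>R x)"

lemma diffusion_vector_mult: "diffusion x *v w = dif x w"
proof -
  have "outer3 x x *v w = (x \<bullet> w) *\<^sub>R x"
    by (simp add: outer3_def matrix_vector_mult_def vec_eq_iff inner_vec_def sum_distrib_left ac_simps)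
  then show ?thesis
    by (simp add: diffusion_def dif_def scaleR_matrix_vector_assoc[symmetric]
        matrix_vector_mult_diff_rdistrib matrix_vector_mul_lid)
qed

text \<open>The diffusion matrix is symmetric. This moves it from a Wiener increment to a test
  vector \<open>V\<close>, and \<open>dif x V\<close> is then known before the increment.\<close>

lemma inner_dif_symmetric: "y \<bullet> dif x w = dif x y \<bullet> w"
  by (simp add: dif_def inner_diff_left inner_diff_right inner_commute mult.commute)

lemma norm_cross_le: "norm (x \<times> y) \<le> norm x * norm (y::real^3)"
proof -
  have "(norm (x \<times> y))\<^sup>2 \<le> (norm x * norm y)\<^sup>2"
    using norm_cross_dot[of x y] zero_le_power2[of "x \<bullet> y"] by linarith
  then show ?thesis
    by (rule power2_le_imp_le) simp
qed

text \<open>For nonzero \<open>v\<close> the right side is \<open>|v|^2\<close> times the projection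
  of \<open>w\<close> onto the plane orthogonal to \<open>v\<close>: this is how the noise of the
  scheme, written with cross products, becomes the diffusion matrix.\<close>

lemma cross_cross_left: "(v \<times> w) \<times> (v::real^3) = (norm v)\<^sup>2 *\<^sub>R w - (v \<bullet> w) *\<^sub>R v"
  unfolding power2_norm_eq_inner
  by (simp add: cross3_simps) (simp add: forall_3 algebra_simps)

lemma cross_cross_right: "a \<times> (b \<times> (c::real^3)) = (a \<bullet> c) *\<^sub>R b - (a \<bullet> b) *\<^sub>R c"
  by (simp add: cross3_simps) (simp add: forall_3 algebra_simps)

text \<open>Pythagoras: the subtracted vector is the projection on \<open>x\<close>. For
  \<open>x = 0\<close> the quotient is 0 and nothing is subtracted.\<close>

lemma norm_tangential_le: "norm (w - ((x \<bullet> w) / (norm x)\<^sup>2) *\<^sub>R x) \<le> norm (w :: 'a::real_inner)"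
proof (cases "x = 0")
  case False
  have "(norm (w - ((x \<bullet> w) / (norm x)\<^sup>2) *\<^sub>R x))\<^sup>2 = (norm w)\<^sup>2 - (x \<bullet> w)\<^sup>2 / (norm x)\<^sup>2"
    using False unfolding power2_norm_eq_inner
    by (simp add: inner_diff_left inner_diff_right inner_commute power2_eq_square field_simps)
  also have "\<dots> \<le> (norm w)\<^sup>2"
    by simp
  finally show ?thesis
    by (rule power2_le_imp_le) simp
qed simp

definition annulus :: "real \<Rightarrow> (real^3) set" where
  "annulus r = {x. r / 2 \<le> norm x \<and> norm x \<le> 2 * r}"

text \<open>One change at a time: first the vector at fixed normalisation, then the normalisation.
  Each costs at most \<open>|x - y| / c\<close>, hence the factor 2.\<close>

lemma norm_unit_diff_le:
  fixes x y :: "'a::real_inner"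
  assumes "c > 0" "c \<le> norm x" "c \<le> norm y"
  shows "norm ((1 / norm x) *\<^sub>R x - (1 / norm y) *\<^sub>R y) \<le> (2 / c) * norm (x - y)"
proof -
  have nz: "norm x > 0" "norm y > 0" using assms by auto
  have eq: "(1 / norm x) *\<^sub>R x - (1 / norm y) *\<^sub>R y
     = (1 / norm x) *\<^sub>R (x - y) + ((norm y - norm x) / norm x) *\<^sub>R ((1 / norm y) *\<^sub>R y)"
    using nz by (auto simp: algebra_simps diff_divide_distrib)
  have "norm ((1 / norm x) *\<^sub>R x - (1 / norm y) *\<^sub>R y)
     \<le> norm (x - y) / norm x + \<bar>norm y - norm x\<bar> / norm x"
    unfolding eq by (rule norm_triangle_le) (use nz in simp)
  also have "\<dots> \<le> norm (x - y) / norm x + norm (x - y) / norm x"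
    using nz norm_triangle_ineq3[of y x] by (intro add_mono divide_right_mono) (auto simp: norm_minus_commute)
  also have "\<dots> \<le> norm (x - y) / c + norm (x - y) / c"
    using assms by (intro add_mono frac_le) auto
  finally show ?thesis by simp
qed

lemma inverse_diff_le:
  fixes a b c :: real
  assumes "c > 0" "c \<le> a" "c \<le> b"
  shows "\<bar>1 / a - 1 / b\<bar> \<le> \<bar>a - b\<bar> / c\<^sup>2"
proof -
  have "\<bar>1 / a - 1 / b\<bar> = \<bar>a - b\<bar> / (a * b)"
  proof -
    have "1 / a - 1 / b = (b - a) / (a * b)" using assms by (simp add: field_simps)
    then show ?thesis using assms by (simp add: abs_mult abs_minus_commute)
  qed
  also have "\<dots> \<le> \<bar>a - b\<bar> / c\<^sup>2"
    using assms by (intro divide_left_mono) (auto simp: power2_eq_square intro!: mult_mono)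
  finally show ?thesis .
qed

text \<open>The annulus is not convex, so a derivative bound would not suffice directly; the
  difference is split algebraically instead. \<open>dif x\<close> is the scalar
  \<open>|x|^(-1/2)\<close> times a projection with unit normal \<open>n x\<close>, and both are
  Lipschitz away from the origin.\<close>

lemma dif_Lipschitz:
  assumes r: "r > 0"
  shows "\<exists>L\<ge>0. \<forall>x\<in>annulus r. \<forall>y\<in>annulus r. \<forall>w. norm (dif x w - dif y w) \<le> L * norm (x - y) * norm w"
proof -
  define c where "c = r / 2"
  have c: "c > 0" using r by (simp add: c_def)
  define s where "s = (\<lambda>x::real^3. sqrt (1 / norm x))"
  define n where "n = (\<lambda>x::real^3. (1 / norm x) *\<^sub>R x)"
  \<comment> \<open>Lipschitz constant of \<open>s\<close>: multiplying \<open>s x - s y\<close> by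
    \<open>s x + s y\<close> leaves a difference of inverse norms, with constant
    \<open>1 / c^2\<close>, and \<open>s x\<close> is at least \<open>sqrt (1 / (2 * r))\<close> on
    the annulus.\<close>
  define L1 where "L1 = 1 / c\<^sup>2 / sqrt (1 / (2 * r))"
  \<comment> \<open>\<open>sqrt (1 / c)\<close> bounds \<open>s y\<close>; \<open>4 / c\<close> is
    the constant \<open>2 / c\<close> of the unit normals, doubled because the normal occurs twice
    in the projection.\<close>
  define L where "L = L1 + sqrt (1 / c) * (4 / c)"
  have L1: "L1 \<ge> 0" using c r by (simp add: L1_def)
  have dif: "dif x w = s x *\<^sub>R (w - (n x \<bullet> w) *\<^sub>R n x)" for x w
    by (simp add: dif_def s_def n_def Dcoef_def power2_eq_square)
  have key: "norm (dif x w - dif y w) \<le> L * norm (x - y) * norm w"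
    if x: "x \<in> annulus r" and y: "y \<in> annulus r" for x y w
  proof -
    have b: "c \<le> norm x" "c \<le> norm y" "norm x \<le> 2 * r" "norm y \<le> 2 * r"
      using x y by (auto simp: annulus_def c_def)
    then have pos: "norm x > 0" "norm y > 0" using c by auto
    have nn: "norm (n x) = 1" "norm (n y) = 1" using pos by (auto simp: n_def)
    have sx: "s x \<ge> sqrt (1 / (2 * r))" "s y \<ge> 0" "s y \<le> sqrt (1 / c)"
      using b pos c r by (auto simp: s_def intro!: frac_le real_sqrt_le_mono)
    have spos: "sqrt (1 / (2*r)) > 0" using r by simp
    have s1: "\<bar>s x - s y\<bar> \<le> L1 * norm (x - y)"
    proof -
      have "\<bar>s x - s y\<bar> * (s x + s y) = \<bar>(s x)\<^sup>2 - (s y)\<^sup>2\<bar>"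
      proof -
        have "s x + s y \<ge> 0" using sx spos by linarith
        then show ?thesis by (simp add: power2_eq_square square_diff_square_factored abs_mult)
      qed
      also have "\<dots> = \<bar>1 / norm x - 1 / norm y\<bar>"
        by (simp add: s_def)
      also have "\<dots> \<le> \<bar>norm x - norm y\<bar> / c\<^sup>2"
        using c b by (intro inverse_diff_le)
      also have "\<dots> \<le> norm (x - y) / c\<^sup>2"
        by (intro divide_right_mono norm_triangle_ineq3) simp
      finally have 1: "\<bar>s x - s y\<bar> * (s x + s y) \<le> norm (x - y) / c\<^sup>2" .
      have "\<bar>s x - s y\<bar> * sqrt (1 / (2*r)) \<le> \<bar>s x - s y\<bar> * (s x + s y)"
        using sx by (intro mult_left_mono) auto
      with 1 have "\<bar>s x - s y\<bar> * sqrt (1 / (2*r)) \<le> norm (x - y) / c\<^sup>2" by linarith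
      then have "\<bar>s x - s y\<bar> \<le> norm (x - y) / c\<^sup>2 / sqrt (1 / (2*r))"
        by (subst pos_le_divide_eq[OF spos])
      then show ?thesis by (simp add: L1_def)
    qed
    have n1: "norm (n x - n y) \<le> (2 / c) * norm (x - y)"
      unfolding n_def using c b by (intro norm_unit_diff_le)
    have p: "norm (w - (n x \<bullet> w) *\<^sub>R n x) \<le> norm w"
      using norm_tangential_le[of w "n x"] nn by simp
    have q: "norm ((n y \<bullet> w) *\<^sub>R n y - (n x \<bullet> w) *\<^sub>R n x) \<le> 2 * norm (n x - n y) * norm w"
    proof -
      have "(n y \<bullet> w) *\<^sub>R n y - (n x \<bullet> w) *\<^sub>R n x
          = (n y \<bullet> w) *\<^sub>R (n y - n x) + ((n y - n x) \<bullet> w) *\<^sub>R n x"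
        by (simp add: algebra_simps inner_diff_left)
      also have "norm \<dots> \<le> \<bar>n y \<bullet> w\<bar> * norm (n y - n x) + \<bar>(n y - n x) \<bullet> w\<bar>"
        by (rule norm_triangle_le) (simp add: nn)
      also have "\<dots> \<le> norm w * norm (n y - n x) + norm (n y - n x) * norm w"
        using Cauchy_Schwarz_ineq2[of "n y" w] Cauchy_Schwarz_ineq2[of "n y - n x" w] nn
        by (intro add_mono mult_right_mono) auto
      finally show ?thesis by (simp add: norm_minus_commute ac_simps)
    qed
    have "dif x w - dif y w = (s x - s y) *\<^sub>R (w - (n x \<bullet> w) *\<^sub>R n x)
        + s y *\<^sub>R ((n y \<bullet> w) *\<^sub>R n y - (n x \<bullet> w) *\<^sub>R n x)"
      unfolding dif by (simp add: algebra_simps)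
    also have "norm \<dots> \<le> \<bar>s x - s y\<bar> * norm (w - (n x \<bullet> w) *\<^sub>R n x)
        + s y * norm ((n y \<bullet> w) *\<^sub>R n y - (n x \<bullet> w) *\<^sub>R n x)"
      by (rule norm_triangle_le) (use sx in simp)
    also have "\<dots> \<le> (L1 * norm (x - y)) * norm w + sqrt (1 / c) * (2 * ((2 / c) * norm (x - y)) * norm w)"
    proof (intro add_mono mult_mono s1 p)
      have "2 * norm (n x - n y) * norm w \<le> 2 * ((2 / c) * norm (x - y)) * norm w"
        using n1 by (intro mult_right_mono mult_left_mono) auto
      with q show "norm ((n y \<bullet> w) *\<^sub>R n y - (n x \<bullet> w) *\<^sub>R n x) \<le> 2 * ((2 / c) * norm (x - y)) * norm w"
        by linarith
    qed (use sx c L1 in auto)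
    also have "\<dots> = L * norm (x - y) * norm w"
      by (simp add: L_def algebra_simps)
    finally show ?thesis .
  qed
  have "L \<ge> 0" using L1 c by (simp add: L_def)
  then show ?thesis using key by blast
qed

lemma norm_dif_le:
  assumes "r > 0" "x \<in> annulus r"
  shows "norm (dif x w) \<le> sqrt (2 / r) * norm w"
proof -
  have "norm x > 0" "r / 2 \<le> norm x" using assms by (auto simp: annulus_def)
  then have "sqrt (Dcoef (norm x)) \<le> sqrt (2 / r)"
    using assms(1) by (auto simp: Dcoef_def field_simps)
  then show ?thesis
    unfolding dif_def using norm_tangential_le[of w x] assms
    by (auto simp: Dcoef_def intro!: mult_mono)
qed

lemma drift_eq: "drift B t x = x \<times> B t - (1 / norm x) ^ 3 *\<^sub>R x"
  by (simp add: drift_def Dcoef_def power3_eq_cube power2_eq_square)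

text \<open>With \<open>p = 1 / |x|\<close> the radial part is \<open>p^3 x\<close>, and
  \<open>p^3 - q^3\<close> factors through \<open>p - q\<close>. The constant is chosen before
  \<open>B\<close> and \<open>t\<close>, so the field enters only through its bound
  \<open>b\<close>.\<close>

lemma drift_Lipschitz:
  assumes r: "r > 0" and b: "b \<ge> 0"
  shows "\<exists>L\<ge>0. \<forall>x\<in>annulus r. \<forall>y\<in>annulus r. \<forall>B t. norm (B t) \<le> b \<longrightarrow>
    norm (drift B t x - drift B t y) \<le> L * norm (x - y)"
proof -
  define c where "c = r / 2"
  have c: "c > 0" using r by (simp add: c_def)
  define L where "L = b + ((1 / c)^3 + 3 * (1 / c)^2 * (1 / c^2) * (2 * r))"
  have "norm (drift B t x - drift B t y) \<le> L * norm (x - y)"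
    if x: "x \<in> annulus r" and y: "y \<in> annulus r" and B: "norm (B t) \<le> b" for x y B t
  proof -
    have bd: "c \<le> norm x" "c \<le> norm y" "norm x \<le> 2 * r" "norm y \<le> 2 * r"
      using x y by (auto simp: annulus_def c_def)
    define p where "p = 1 / norm x"
    define q where "q = 1 / norm y"
    have pq: "0 \<le> p" "p \<le> 1 / c" "0 \<le> q" "q \<le> 1 / c"
      using bd c by (auto simp: p_def q_def intro!: frac_le)
    have d: "\<bar>p - q\<bar> \<le> norm (x - y) / c\<^sup>2"
    proof -
      have "\<bar>p - q\<bar> \<le> \<bar>norm x - norm y\<bar> / c\<^sup>2"
        unfolding p_def q_def using c bd by (intro inverse_diff_le)
      also have "\<dots> \<le> norm (x - y) / c\<^sup>2"
        by (intro divide_right_mono norm_triangle_ineq3) simp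
      finally show ?thesis .
    qed
    have cube: "\<bar>p^3 - q^3\<bar> \<le> 3 * (1 / c)^2 * (norm (x - y) / c\<^sup>2)"
    proof -
      have "p^3 - q^3 = (p - q) * (p^2 + p * q + q^2)"
        by (simp add: power2_eq_square power3_eq_cube algebra_simps)
      then have "\<bar>p^3 - q^3\<bar> = \<bar>p - q\<bar> * (p^2 + p * q + q^2)"
        using pq by (simp add: abs_mult)
      also have "\<dots> \<le> (norm (x - y) / c\<^sup>2) * ((1/c)^2 + (1/c) * (1/c) + (1/c)^2)"
        using pq d c by (intro mult_mono add_mono power_mono) auto
      also have "\<dots> = 3 * (1 / c)^2 * (norm (x - y) / c\<^sup>2)"
        by (simp add: power2_eq_square)
      finally show ?thesis .
    qed
    have "drift B t x - drift B t y = (x - y) \<times> B t - (p^3 *\<^sub>R (x - y) + (p^3 - q^3) *\<^sub>R y)"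
      by (simp add: drift_eq p_def q_def Cross3.left_diff_distrib algebra_simps)
    also have "norm \<dots> \<le> norm (x - y) * b + ((1/c)^3 * norm (x - y) + (3 * (1 / c)^2 * (norm (x - y) / c\<^sup>2)) * (2 * r))"
    proof (rule order_trans[OF norm_triangle_ineq4], rule add_mono)
      show "norm ((x - y) \<times> B t) \<le> norm (x - y) * b"
        by (rule order_trans[OF norm_cross_le]) (intro mult_left_mono B norm_ge_zero)
      show "norm (p^3 *\<^sub>R (x - y) + (p^3 - q^3) *\<^sub>R y)
        \<le> (1/c)^3 * norm (x - y) + (3 * (1 / c)^2 * (norm (x - y) / c\<^sup>2)) * (2 * r)"
      proof (rule order_trans[OF norm_triangle_ineq], rule add_mono)
        show "norm (p^3 *\<^sub>R (x - y)) \<le> (1/c)^3 * norm (x - y)"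
          using pq by (auto intro!: mult_right_mono power_mono)
        show "norm ((p^3 - q^3) *\<^sub>R y) \<le> (3 * (1 / c)^2 * (norm (x - y) / c\<^sup>2)) * (2 * r)"
          unfolding norm_scaleR using cube bd c by (intro mult_mono) auto
      qed
    qed
    also have "\<dots> = L * norm (x - y)"
      by (simp add: L_def algebra_simps)
    finally show ?thesis .
  qed
  moreover have "L \<ge> 0" using c b r by (simp add: L_def)
  ultimately show ?thesis by blast
qed

lemma norm_drift_le:
  assumes "r > 0" "x \<in> annulus r" "norm (B t) \<le> b"
  shows "norm (drift B t x) \<le> 2 * r * b + (2 / r)^3 * (2 * r)"
proof -
  have x: "norm x \<le> 2 * r" "r / 2 \<le> norm x" using assms by (auto simp: annulus_def)
  then have i: "1 / norm x \<le> 2 / r" using assms(1) frac_le[of 1 1 "r / 2" "norm x"] by simp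
  have "norm (drift B t x) \<le> norm x * norm (B t) + (1 / norm x)^3 * norm x"
    unfolding drift_eq
    by (rule order_trans[OF norm_triangle_ineq4]) (intro add_mono norm_cross_le, simp add: power_divide)
  also have "\<dots> \<le> (2 * r) * b + (2 / r)^3 * (2 * r)"
    using x i assms by (intro add_mono mult_mono power_mono) auto
  finally show ?thesis .
qed

lemma closed_annulus: "closed (annulus r)"
  unfolding annulus_def by (intro closed_Collect_conj closed_Collect_le continuous_intros)

text \<open>The vector \<open>M\<^sub>k\<close> of the paper.\<close>

definition esec_rot :: "real \<Rightarrow> real^3 \<Rightarrow> real^3 \<Rightarrow> real^3 \<Rightarrow> real^3" where
  "esec_rot h b w v =
     (sqrt (Dcoef (norm v)) / (2 * (norm v)\<^sup>2)) *\<^sub>R (v \<times> w) - (h / 2) *\<^sub>R b"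

text \<open>The midpoint \<open>v_{k+1/2}\<close>. In terms of it the scheme reads
  \<open>u - a \<times> u = v\<close>, and the formula is the explicit inverse of the identity minus
  the skew matrix of \<open>a\<close>; its determinant is \<open>1 + |a|^2\<close>, which never
  vanishes.\<close>

definition esec_mid :: "real^3 \<Rightarrow> real^3 \<Rightarrow> real^3" where
  "esec_mid a v = (1 / (1 + (norm a)\<^sup>2)) *\<^sub>R (v + a \<times> v + (a \<bullet> v) *\<^sub>R a)"

lemma esec_mid: "esec_mid a v - a \<times> esec_mid a v = v"
proof -
  have "(1 + (norm a)\<^sup>2) \<noteq> 0" by (smt (verit) zero_le_power2)
  moreover have "(1 + (norm a)\<^sup>2) *\<^sub>R (esec_mid a v - a \<times> esec_mid a v) = (1 + (norm a)\<^sup>2) *\<^sub>R v"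
    using calculation unfolding esec_mid_def
    by (simp add: cross_mult_right cross_add_right cross_cross_right scaleR_diff_right)
      (simp add: power2_norm_eq_inner algebra_simps)
  ultimately show ?thesis by simp
qed

text \<open>The difference \<open>d\<close> of two solutions satisfies
  \<open>d = a \<times> d\<close>, which is orthogonal to \<open>d\<close>. Uniqueness is what the
  definite description in \<open>esec_step\<close> requires.\<close>

lemma esec_mid_unique:
  fixes a u v :: "real^3"
  assumes "u - a \<times> u = v" 
  shows "u = esec_mid a v"
proof -
  define d where "d = u - esec_mid a v"
  have "d = (v + a \<times> u) - (v + a \<times> esec_mid a v)"
    using assms esec_mid[of a v] by (simp add: d_def algebra_simps)
  then have "d = a \<times> d"
    by (metis add_diff_cancel_left d_def Cross3.right_diff_distrib)
  then have "d \<bullet> d = 0" by (metis dot_cross_self(2))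
  then show ?thesis by (simp add: d_def)
qed

text \<open>Substituting \<open>z = 2 u - v\<close> turns the implicit equation for the new iterate
  into the midpoint equation, whose only solution is \<open>esec_mid\<close>. From here on the
  definite description is gone.\<close>

lemma esec_step_eq: "esec_step h b w v = 2 *\<^sub>R esec_mid (esec_rot h b w v) v - v"
proof -
  let ?a = "esec_rot h b w v"
  have iff: "z - v = h *\<^sub>R (((1/2) *\<^sub>R (v + z)) \<times> b)
        + (sqrt (Dcoef (norm v)) *\<^sub>R ((1 / (norm v)\<^sup>2) *\<^sub>R (v \<times> w))) \<times> ((1/2) *\<^sub>R (v + z))
     \<longleftrightarrow> z = 2 *\<^sub>R esec_mid ?a v - v" for z
  proof -
    define u where "u = (1/2) *\<^sub>R (v + z)"
    have z: "z = 2 *\<^sub>R u - v" by (simp add: u_def)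
    have "h *\<^sub>R (u \<times> b) + (sqrt (Dcoef (norm v)) *\<^sub>R ((1 / (norm v)\<^sup>2) *\<^sub>R (v \<times> w))) \<times> u
        = 2 *\<^sub>R (?a \<times> u)"
      by (simp add: esec_rot_def Cross3.left_diff_distrib cross_mult_left scaleR_diff_right
          cross_skew[of u b])
    then have "z - v = h *\<^sub>R (u \<times> b) + (sqrt (Dcoef (norm v)) *\<^sub>R ((1 / (norm v)\<^sup>2) *\<^sub>R (v \<times> w))) \<times> u
       \<longleftrightarrow> 2 *\<^sub>R u - v - v = 2 *\<^sub>R (?a \<times> u)"
      by (simp add: z)
    also have "\<dots> \<longleftrightarrow> 2 *\<^sub>R (u - ?a \<times> u) = 2 *\<^sub>R v"
      by (auto simp: algebra_simps scaleR_2)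
    also have "\<dots> \<longleftrightarrow> u - ?a \<times> u = v" by simp
    also have "\<dots> \<longleftrightarrow> u = esec_mid ?a v"
      using esec_mid esec_mid_unique by blast
    also have "\<dots> \<longleftrightarrow> z = 2 *\<^sub>R esec_mid ?a v - v"
      by (subst z) auto
    finally show ?thesis by (simp add: u_def)
  qed
  show ?thesis unfolding esec_step_def iff by simp
qed

text \<open>Pairing the midpoint equation with \<open>u\<close> kills the cross product and gives
  \<open>u \<bullet> u = u \<bullet> v\<close>; then
  \<open>|2 u - v|^2 = 4 (u \<bullet> u) - 4 (u \<bullet> v) + |v|^2\<close> collapses to
  \<open>|v|^2\<close>.\<close>

lemma norm_esec_step: "norm (esec_step h b w v) = norm v"
proof -
  let ?u = "esec_mid (esec_rot h b w v) v"
  have "?u \<bullet> ?u = ?u \<bullet> v"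
    using arg_cong[OF esec_mid[of "esec_rot h b w v" v], of "\<lambda>x. ?u \<bullet> x"]
    by (simp add: inner_diff_right dot_cross_self)
  then have "(norm (esec_step h b w v))\<^sup>2 = (norm v)\<^sup>2"
    unfolding esec_step_eq power2_norm_eq_inner
    by (simp add: inner_diff_left inner_diff_right inner_commute)
  then show ?thesis by simp
qed

lemma norm_esec [simp]: "norm (esec B W t0 h v0 k \<omega>) = norm v0"
  by (induction k) (auto simp: norm_esec_step)

text \<open>The part of the local error of size \<open>h\<close>; it is a martingale increment, so only
  its variance accumulates.\<close>

definition esec_noise :: "real \<Rightarrow> real^3 \<Rightarrow> real^3 \<Rightarrow> real^3" where
  "esec_noise h w v = - (Dcoef (norm v) / (2 * (norm v)^4) * ((norm (v \<times> w))\<^sup>2 - 2 * (norm v)\<^sup>2 * h)) *\<^sub>R v"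

definition esec_rem :: "(real \<Rightarrow> real^3) \<Rightarrow> real \<Rightarrow> real \<Rightarrow> real^3 \<Rightarrow> real^3 \<Rightarrow> real^3" where
  "esec_rem B t h w v = esec_step h (B t) w v - v - h *\<^sub>R drift B t v - dif v w - esec_noise h w v"

text \<open>Write \<open>a = \<alpha> - \<beta>\<close> with \<open>\<alpha>\<close> linear in the
  noise and \<open>\<beta>\<close> of size \<open>h\<close>, and expand the midpoint to third order
  in \<open>a\<close>. First order gives the Euler noise and the magnetic drift; the
  \<open>|\<alpha>|^2\<close> part of second order gives the radial drift and
  \<open>esec_noise\<close>; what is left contains a factor \<open>h\<close> and another
  \<open>\<alpha>\<close> or \<open>\<beta>\<close>, or is cubic. Since \<open>|w|\<close> is
  typically of size \<open>h^(1/2)\<close>, the bound is of size \<open>h^(3/2)\<close>.\<close>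

lemma norm_esec_rem_le:
  assumes r: "r > 0" and b: "b \<ge> 0"
  shows "\<exists>C\<ge>0. \<forall>B t h w v. h \<ge> 0 \<longrightarrow> norm v = r \<longrightarrow> norm (B t) \<le> b \<longrightarrow>
     norm (esec_rem B t h w v) \<le> C * ((norm w + h) * h + (norm w + h)^3)"
proof -
  \<comment> \<open>The coefficient of \<open>v \<times> w\<close> in \<open>esec_rot\<close> on the
    sphere of radius \<open>r\<close>.\<close>
  define k where "k = sqrt (1 / r) / (2 * r\<^sup>2)"
  have k: "k \<ge> 0" using r by (simp add: k_def)
  \<comment> \<open>Common constant in \<open>|\<alpha>| \<le> C0 |w|\<close> and
    \<open>|\<beta>| \<le> C0 h\<close>.\<close>
  define C0 where "C0 = max (k * r) (b / 2)"
  have C0: "C0 \<ge> 0" "k * r \<le> C0" "b / 2 \<le> C0" using b by (auto simp: C0_def)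
  \<comment> \<open>The quadratic leftovers have coefficients 2, 4 and 2, together 8; the last
    summand is twice the triple product, bounded by \<open>|a|^3 r\<close>.\<close>
  define C where "C = 8 * C0\<^sup>2 * r + 2 * C0^3 * r"
  have "norm (esec_rem B t h w v) \<le> C * ((norm w + h) * h + (norm w + h)^3)"
    if h: "h \<ge> 0" and v: "norm v = r" and B: "norm (B t) \<le> b" for B t h w v
  proof -
    define \<alpha> where "\<alpha> = k *\<^sub>R (v \<times> w)"
    define \<beta> where "\<beta> = (h / 2) *\<^sub>R B t"
    define a where "a = \<alpha> - \<beta>"
    define u where "u = esec_mid a v"
    have a: "a = esec_rot h (B t) w v"
      by (simp add: a_def \<alpha>_def \<beta>_def esec_rot_def k_def v Dcoef_def)
    have step: "esec_step h (B t) w v = 2 *\<^sub>R u - v"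
      by (simp add: esec_step_eq a u_def)
    have u1: "u = v + a \<times> u"
      using esec_mid[of a v] by (simp add: u_def algebra_simps)
    \<comment> \<open>The equation \<open>u = v + a \<times> u\<close> inserted into itself. The
      last term keeps the exact \<open>u\<close>, whose norm is at most \<open>r\<close>, so no
      infinite series is needed.\<close>
    have u3: "u = v + a \<times> v + a \<times> (a \<times> v) + a \<times> (a \<times> (a \<times> u))"
    proof -
      have "u = v + a \<times> (v + a \<times> (v + a \<times> u))"
        using u1 by simp
      then show ?thesis by (simp add: cross_add_right add.assoc)
    qed
    have uu: "u \<bullet> u = u \<bullet> v"
      using arg_cong[OF u1, of "\<lambda>x. u \<bullet> x"] by (simp add: inner_add_right dot_cross_self)
    have un: "norm u \<le> r"
    proof -
      have "(norm u)\<^sup>2 \<le> norm u * norm v"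
        using uu norm_cauchy_schwarz[of u v] by (simp add: power2_norm_eq_inner)
      then have "norm u * norm u \<le> norm u * r" by (simp add: power2_eq_square v)
      then show ?thesis using r by (cases "norm u = 0") (auto simp: mult_le_cancel_left)
    qed
    \<comment> \<open>\<open>\<alpha>\<close> is orthogonal to \<open>v\<close>, so this inner
      product has no term of size \<open>h^(1/2)\<close>.\<close>
    have av: "a \<bullet> v = - (\<beta> \<bullet> v)"
      by (simp add: a_def \<alpha>_def inner_diff_left dot_cross_self)
    have k2: "k\<^sup>2 = 1 / (4 * r^5)"
      using r by (simp add: k_def power_divide power_mult_distrib real_sqrt_pow2 field_simps eval_nat_numeral)
    have kk: "2 * k * r\<^sup>2 = sqrt (1 / r)" using r by (simp add: k_def)
    have t1: "2 *\<^sub>R (\<alpha> \<times> v) = dif v w"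
    proof -
      have "2 *\<^sub>R (\<alpha> \<times> v) = (2 * k) *\<^sub>R (r\<^sup>2 *\<^sub>R w - (v \<bullet> w) *\<^sub>R v)"
        by (simp add: \<alpha>_def cross_mult_left cross_cross_left v)
      also have "\<dots> = (2 * k * r\<^sup>2) *\<^sub>R (w - ((v \<bullet> w) / r\<^sup>2) *\<^sub>R v)"
        using r by (simp add: algebra_simps)
      finally show ?thesis by (simp add: kk dif_def Dcoef_def v)
    qed
    have t2: "- (2 *\<^sub>R (\<beta> \<times> v)) = h *\<^sub>R (v \<times> B t)"
      by (simp add: \<beta>_def cross_mult_left cross_skew[of v "B t"])
    have a2: "(norm \<alpha>)\<^sup>2 = k\<^sup>2 * (norm (v \<times> w))\<^sup>2"
      by (simp add: \<alpha>_def power_mult_distrib)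
    \<comment> \<open>The Ito correction: \<open>2 |\<alpha>|^2\<close> is
      \<open>|v \<times> w|^2 / (2 r^5)\<close>, and splitting off the mean \<open>2 r^2 h\<close>
      of \<open>|v \<times> w|^2\<close> leaves \<open>h / r^3\<close>, the coefficient of the
      radial drift.\<close>
    have t3: "- (2 * (norm \<alpha>)\<^sup>2) *\<^sub>R v = esec_noise h w v - (h * (1 / r)^3) *\<^sub>R v"
    proof -
      have "2 * (norm \<alpha>)\<^sup>2 = (Dcoef r / (2 * r^4)) * ((norm (v \<times> w))\<^sup>2 - 2 * r\<^sup>2 * h) + h * (1 / r)^3"
        unfolding a2 k2 using r by (simp add: Dcoef_def field_simps eval_nat_numeral)
      then show ?thesis
        by (simp only: esec_noise_def v scaleR_minus_left scaleR_left_distrib minus_add_distrib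
            diff_conv_add_uminus)
    qed
    have an: "(norm a)\<^sup>2 = (norm \<alpha>)\<^sup>2 - 2 * (\<alpha> \<bullet> \<beta>) + (norm \<beta>)\<^sup>2"
      unfolding a_def power2_norm_eq_inner by (simp add: inner_diff_left inner_diff_right inner_commute)
    have "esec_step h (B t) w v - v = 2 *\<^sub>R (a \<times> v) + 2 *\<^sub>R (a \<times> (a \<times> v)) + 2 *\<^sub>R (a \<times> (a \<times> (a \<times> u)))"
      unfolding step by (subst u3) (simp add: algebra_simps scaleR_2)
    also have "2 *\<^sub>R (a \<times> v) = dif v w + h *\<^sub>R (v \<times> B t)"
      unfolding t1[symmetric] t2[symmetric] a_def by (simp add: Cross3.left_diff_distrib algebra_simps)
    also have "2 *\<^sub>R (a \<times> (a \<times> v)) = - (2 * (\<beta> \<bullet> v)) *\<^sub>R a - (2 * (norm \<alpha>)\<^sup>2) *\<^sub>R v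
        + (4 * (\<alpha> \<bullet> \<beta>) - 2 * (norm \<beta>)\<^sup>2) *\<^sub>R v"
      unfolding cross_cross_right av power2_norm_eq_inner[of a, symmetric] an
      by (simp add: algebra_simps)
    finally have rem: "esec_rem B t h w v = - (2 * (\<beta> \<bullet> v)) *\<^sub>R a + (4 * (\<alpha> \<bullet> \<beta>) - 2 * (norm \<beta>)\<^sup>2) *\<^sub>R v
        + 2 *\<^sub>R (a \<times> (a \<times> (a \<times> u)))"
      using t3 by (simp add: esec_rem_def drift_eq v algebra_simps)
    define x where "x = norm w"
    have x: "x \<ge> 0" by (simp add: x_def)
    have nal: "norm \<alpha> \<le> C0 * x"
    proof -
      have "norm \<alpha> \<le> k * (r * x)"
        using norm_cross_le[of v w] k by (auto simp: \<alpha>_def v x_def intro!: mult_left_mono)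
      also have "\<dots> \<le> C0 * x" using C0(2) x by (simp add: mult.assoc[symmetric] mult_right_mono)
      finally show ?thesis .
    qed
    have nbe: "norm \<beta> \<le> C0 * h"
    proof -
      have "norm \<beta> = h * (norm (B t) / 2)" using h by (simp add: \<beta>_def)
      also have "\<dots> \<le> h * C0" using h B C0 by (intro mult_left_mono) auto
      finally show ?thesis by (simp add: mult.commute)
    qed
    have na: "norm a \<le> C0 * (x + h)"
      using norm_triangle_ineq4[of \<alpha> \<beta>] nal nbe by (simp add: a_def algebra_simps)
    have "norm (esec_rem B t h w v) \<le> 2 * \<bar>\<beta> \<bullet> v\<bar> * norm a + \<bar>4 * (\<alpha> \<bullet> \<beta>) - 2 * (norm \<beta>)\<^sup>2\<bar> * r
        + 2 * norm (a \<times> (a \<times> (a \<times> u)))"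
      unfolding rem by (intro norm_triangle_le add_mono) (auto simp: v abs_mult)
    also have "\<dots> \<le> 2 * ((C0 * h) * r) * (C0 * (x + h))
        + (4 * ((C0 * x) * (C0 * h)) + 2 * (C0 * h)\<^sup>2) * r
        + 2 * ((C0 * (x + h)) * ((C0 * (x + h)) * ((C0 * (x + h)) * r)))"
    proof (intro add_mono mult_mono order_refl na)
      have "\<bar>\<beta> \<bullet> v\<bar> \<le> norm \<beta> * r" using Cauchy_Schwarz_ineq2[of \<beta> v] v by simp
      also have "\<dots> \<le> (C0 * h) * r" using nbe r by (intro mult_right_mono) auto
      finally show "\<bar>\<beta> \<bullet> v\<bar> \<le> (C0 * h) * r" .
      have "\<bar>\<alpha> \<bullet> \<beta>\<bar> \<le> norm \<alpha> * norm \<beta>" by (rule Cauchy_Schwarz_ineq2)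
      also have "\<dots> \<le> (C0 * x) * (C0 * h)" using nal nbe C0 x by (intro mult_mono) auto
      finally have 1: "\<bar>\<alpha> \<bullet> \<beta>\<bar> \<le> (C0 * x) * (C0 * h)" .
      have 2: "(norm \<beta>)\<^sup>2 \<le> (C0 * h)\<^sup>2" using nbe by (intro power_mono) auto
      have "\<bar>4 * (\<alpha> \<bullet> \<beta>) - 2 * (norm \<beta>)\<^sup>2\<bar> \<le> \<bar>4 * (\<alpha> \<bullet> \<beta>)\<bar> + \<bar>2 * (norm \<beta>)\<^sup>2\<bar>"
        by (rule abs_triangle_ineq4)
      also have "\<dots> = 4 * \<bar>\<alpha> \<bullet> \<beta>\<bar> + 2 * (norm \<beta>)\<^sup>2" by (simp add: abs_mult)
      finally show "\<bar>4 * (\<alpha> \<bullet> \<beta>) - 2 * (norm \<beta>)\<^sup>2\<bar> \<le> 4 * ((C0 * x) * (C0 * h)) + 2 * (C0 * h)\<^sup>2"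
        using 1 2 by linarith
      show "norm (a \<times> (a \<times> (a \<times> u))) \<le> (C0 * (x + h)) * ((C0 * (x + h)) * ((C0 * (x + h)) * r))"
        using na un C0 x h r
        by (intro order_trans[OF norm_cross_le] mult_mono) auto
    qed (use r C0 h x in auto)
    also have "\<dots> = C0\<^sup>2 * r * (2 * h * (x + h) + 4 * x * h + 2 * h\<^sup>2) + 2 * C0^3 * r * (x + h)^3"
      by (simp add: power2_eq_square power3_eq_cube algebra_simps)
    also have "\<dots> \<le> C0\<^sup>2 * r * (8 * ((x + h) * h)) + 2 * C0^3 * r * (x + h)^3"
      using r x h C0 by (intro add_mono mult_left_mono) (auto simp: power2_eq_square algebra_simps)
    also have "\<dots> \<le> C * ((x + h) * h) + C * (x + h)^3"
    proof (rule add_mono)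
      have *: "0 \<le> 2 * C0^3 * r * ((x + h) * h)" "0 \<le> 8 * C0\<^sup>2 * r * (x + h)^3"
        using C0 r x h by auto
      show "C0\<^sup>2 * r * (8 * ((x + h) * h)) \<le> C * ((x + h) * h)"
        using *(1) by (simp add: C_def algebra_simps)
      show "2 * C0^3 * r * (x + h)^3 \<le> C * (x + h)^3"
        using *(2) by (simp add: C_def ring_distribs)
    qed
    finally show ?thesis by (simp add: x_def algebra_simps)
  qed
  moreover have "C \<ge> 0" using C0 r by (simp add: C_def)
  ultimately show ?thesis by blast
qed

subsection \<open>Martingale increments and convergence in probability\<close>

lemma norm_add_power2_le: "(norm (a + b))\<^sup>2 \<le> 2 * (norm a)\<^sup>2 + 2 * (norm (b::'a::real_normed_vector))\<^sup>2"
proof -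
  have "(norm (a + b))\<^sup>2 \<le> (norm a + norm b)\<^sup>2"
    by (intro power_mono norm_triangle_ineq) simp
  also have "\<dots> \<le> 2 * (norm a)\<^sup>2 + 2 * (norm b)\<^sup>2"
    using zero_le_power2[of "norm a - norm b"] by (simp add: power2_eq_square algebra_simps)
  finally show ?thesis .
qed

lemma norm_sum_power2_le:
  fixes f :: "'b \<Rightarrow> 'a::real_normed_vector"
  shows "(norm (\<Sum>i\<in>I. f i))\<^sup>2 \<le> card I * (\<Sum>i\<in>I. (norm (f i))\<^sup>2)"
proof -
  have "(norm (\<Sum>i\<in>I. f i))\<^sup>2 \<le> (\<Sum>i\<in>I. norm (f i))\<^sup>2"
    by (intro power_mono norm_sum) simp
  also have "\<dots> \<le> (\<Sum>i\<in>I. (norm (f i))\<^sup>2) * (\<Sum>i\<in>I. 1\<^sup>2)"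
    using Cauchy_Schwarz_ineq_sum[of "\<lambda>i. norm (f i)" "\<lambda>_. 1" I] by simp
  finally show ?thesis by (simp add: mult.commute)
qed

context prob_space
begin

lemma integrable_norm_add_power2:
  fixes X Y :: "'a \<Rightarrow> 'b::{second_countable_topology, real_normed_vector}"
  assumes [measurable]: "X \<in> borel_measurable M" "Y \<in> borel_measurable M"
    and "integrable M (\<lambda>\<omega>. (norm (X \<omega>))\<^sup>2)" "integrable M (\<lambda>\<omega>. (norm (Y \<omega>))\<^sup>2)"
  shows "integrable M (\<lambda>\<omega>. (norm (X \<omega> + Y \<omega>))\<^sup>2)"
proof (rule Bochner_Integration.integrable_bound)
  show "integrable M (\<lambda>\<omega>. 2 * (norm (X \<omega>))\<^sup>2 + 2 * (norm (Y \<omega>))\<^sup>2)"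
    using assms by simp
qed (use norm_add_power2_le[of "X _" "Y _"] in auto)

lemma integrable_norm_sum_power2:
  fixes X :: "'i \<Rightarrow> 'a \<Rightarrow> 'b::{second_countable_topology, real_normed_vector}"
  assumes "finite I" "\<And>i. i \<in> I \<Longrightarrow> X i \<in> borel_measurable M"
    and "\<And>i. i \<in> I \<Longrightarrow> integrable M (\<lambda>\<omega>. (norm (X i \<omega>))\<^sup>2)"
  shows "integrable M (\<lambda>\<omega>. (norm (\<Sum>i\<in>I. X i \<omega>))\<^sup>2)"
  using assms
proof (induction I rule: finite_induct)
  case (insert i I)
  then show ?case
    by (auto intro!: integrable_norm_add_power2 borel_measurable_sum)
qed simp

lemma integrable_norm_of_power2:
  fixes X :: "'a \<Rightarrow> 'b::{second_countable_topology, real_normed_vector}"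
  assumes [measurable]: "X \<in> borel_measurable M" and "integrable M (\<lambda>\<omega>. (norm (X \<omega>))\<^sup>2)"
  shows "integrable M (\<lambda>\<omega>. norm (X \<omega>))"
proof (rule Bochner_Integration.integrable_bound)
  show "integrable M (\<lambda>\<omega>. 1 + (norm (X \<omega>))\<^sup>2)" using assms by simp
  show "AE \<omega> in M. norm (norm (X \<omega>)) \<le> norm (1 + (norm (X \<omega>))\<^sup>2)"
  proof (rule AE_I2)
    fix \<omega>
    have "2 * norm (X \<omega>) \<le> 1 + (norm (X \<omega>))\<^sup>2"
      using zero_le_power2[of "norm (X \<omega>) - 1"] by (simp add: power2_eq_square algebra_simps)
    then have "norm (X \<omega>) \<le> 1 + (norm (X \<omega>))\<^sup>2"
      using norm_ge_zero[of "X \<omega>"] by linarith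
    then show "norm (norm (X \<omega>)) \<le> norm (1 + (norm (X \<omega>))\<^sup>2)" by simp
  qed
qed simp

text \<open>A square integrable random vector that is conditionally centred given \<open>G\<close>, stated
  without conditional expectations.\<close>

definition mincr :: "'a measure \<Rightarrow> ('a \<Rightarrow> 'b::euclidean_space) \<Rightarrow> bool" where
  "mincr G Y \<longleftrightarrow> Y \<in> borel_measurable M \<and> integrable M (\<lambda>\<omega>. (norm (Y \<omega>))\<^sup>2) \<and>
     (\<forall>V\<in>borel_measurable G. integrable M (\<lambda>\<omega>. norm (V \<omega>)) \<longrightarrow>
        integrable M (\<lambda>\<omega>. V \<omega> \<bullet> Y \<omega>) \<and> (\<integral>\<omega>. V \<omega> \<bullet> Y \<omega> \<partial>M) = 0)"

text \<open>Orthogonality of martingale increments: the partial sum is known at stage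
  \<open>n\<close>, so its pairing with \<open>Y n\<close> has mean zero. This takes the place of
  the Ito isometry.\<close>

lemma expectation_mincr_sum:
  fixes Y :: "nat \<Rightarrow> 'a \<Rightarrow> 'b::euclidean_space"
  assumes "\<And>l. l < n \<Longrightarrow> mincr (G l) (Y l)"
    and "\<And>i l. i < l \<Longrightarrow> l < n \<Longrightarrow> Y i \<in> borel_measurable (G l)"
  shows "integrable M (\<lambda>\<omega>. (norm (\<Sum>l<n. Y l \<omega>))\<^sup>2) \<and>
    (\<integral>\<omega>. (norm (\<Sum>l<n. Y l \<omega>))\<^sup>2 \<partial>M) = (\<Sum>l<n. \<integral>\<omega>. (norm (Y l \<omega>))\<^sup>2 \<partial>M)"
  using assms
proof (induction n)
  case (Suc n)
  define S where "S = (\<lambda>\<omega>. \<Sum>l<n. Y l \<omega>)"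
  have IH: "integrable M (\<lambda>\<omega>. (norm (S \<omega>))\<^sup>2)"
    "(\<integral>\<omega>. (norm (S \<omega>))\<^sup>2 \<partial>M) = (\<Sum>l<n. \<integral>\<omega>. (norm (Y l \<omega>))\<^sup>2 \<partial>M)"
    using Suc by (auto simp: S_def)
  have mY: "mincr (G n) (Y n)" using Suc by auto
  have SG: "S \<in> borel_measurable (G n)"
    unfolding S_def using Suc.prems by (intro borel_measurable_sum) auto
  have SM: "S \<in> borel_measurable M"
    unfolding S_def using Suc.prems by (intro borel_measurable_sum) (auto simp: mincr_def)
  have "integrable M (\<lambda>\<omega>. norm (S \<omega>))"
    using SM IH(1) by (rule integrable_norm_of_power2)
  then have SY: "integrable M (\<lambda>\<omega>. S \<omega> \<bullet> Y n \<omega>)" "(\<integral>\<omega>. S \<omega> \<bullet> Y n \<omega> \<partial>M) = 0"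
    and Y2: "integrable M (\<lambda>\<omega>. (norm (Y n \<omega>))\<^sup>2)"
    using mY SG by (auto simp: mincr_def)
  have eq: "(\<lambda>\<omega>. (norm (\<Sum>l<Suc n. Y l \<omega>))\<^sup>2)
      = (\<lambda>\<omega>. (norm (S \<omega>))\<^sup>2 + 2 * (S \<omega> \<bullet> Y n \<omega>) + (norm (Y n \<omega>))\<^sup>2)"
    unfolding power2_norm_eq_inner S_def
    by (simp add: inner_add_left inner_add_right inner_commute algebra_simps)
  show ?case unfolding eq using IH SY Y2 by simp
qed simp

text \<open>The perturbation \<open>D n\<close> is small only in probability and need have no second
  moment. Where it exceeds \<open>e\<close>, \<open>Y\<close> is bounded by \<open>K\<close> and the
  probability vanishes as \<open>n\<close> grows; elsewhere \<open>|Y|^2\<close> is at most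
  \<open>2 |X n|^2 + 2 e^2\<close>. Let \<open>n\<close> tend to infinity, then \<open>e\<close> to
  0. The factor 2 is the price of the splitting.\<close>

lemma expectation_power2_le_of_conv_in_prob:
  fixes X D :: "nat \<Rightarrow> 'a \<Rightarrow> 'b::{second_countable_topology, real_normed_vector}"
  assumes A: "A \<in> events"
    and [measurable]: "Y \<in> borel_measurable M" "\<And>n. D n \<in> borel_measurable M"
    and D: "\<And>e. e > 0 \<Longrightarrow> (\<lambda>n. prob {\<omega>\<in>space M. e < norm (D n \<omega>)}) \<longlonglongrightarrow> 0"
    and Y: "\<And>n \<omega>. \<omega> \<in> A \<Longrightarrow> Y \<omega> = X n \<omega> + D n \<omega>" "\<And>\<omega>. \<omega> \<in> A \<Longrightarrow> norm (Y \<omega>) \<le> K"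
    and X: "\<And>n. integrable M (\<lambda>\<omega>. (norm (X n \<omega>))\<^sup>2)" "\<And>n. (\<integral>\<omega>. (norm (X n \<omega>))\<^sup>2 \<partial>M) \<le> c"
  shows "(\<integral>\<omega>. indicator A \<omega> * (norm (Y \<omega>))\<^sup>2 \<partial>M) \<le> 2 * c"
proof -
  note [measurable] = A
  have int: "integrable M (\<lambda>\<omega>. indicator A \<omega> * (norm (Y \<omega>))\<^sup>2)"
  proof (rule integrable_const_bound[where B="K\<^sup>2"])
    show "AE \<omega> in M. norm (indicator A \<omega> * (norm (Y \<omega>))\<^sup>2) \<le> K\<^sup>2"
      using Y(2) by (auto simp: indicator_def intro!: AE_I2 power_mono)
  qed measurable
  have e: "(\<integral>\<omega>. indicator A \<omega> * (norm (Y \<omega>))\<^sup>2 \<partial>M) \<le> 2 * c + 2 * e\<^sup>2" if e: "e > 0" for e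
  proof -
    define E where "E n = {\<omega>\<in>space M. e < norm (D n \<omega>)}" for n
    have [measurable]: "E n \<in> events" for n unfolding E_def by measurable
    have le: "(\<integral>\<omega>. indicator A \<omega> * (norm (Y \<omega>))\<^sup>2 \<partial>M) \<le> K\<^sup>2 * prob (E n) + (2 * c + 2 * e\<^sup>2)" for n
    proof -
      have "(\<integral>\<omega>. indicator A \<omega> * (norm (Y \<omega>))\<^sup>2 \<partial>M)
        \<le> (\<integral>\<omega>. K\<^sup>2 * indicator (E n) \<omega> + (2 * (norm (X n \<omega>))\<^sup>2 + 2 * e\<^sup>2) \<partial>M)"
      proof (rule integral_mono[OF int])
        show "integrable M (\<lambda>\<omega>. K\<^sup>2 * indicator (E n) \<omega> + (2 * (norm (X n \<omega>))\<^sup>2 + 2 * e\<^sup>2))"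
          using X by (auto intro!: integrable_real_mult_indicator)
        fix \<omega> assume \<omega>: "\<omega> \<in> space M"
        show "indicator A \<omega> * (norm (Y \<omega>))\<^sup>2 \<le> K\<^sup>2 * indicator (E n) \<omega> + (2 * (norm (X n \<omega>))\<^sup>2 + 2 * e\<^sup>2)"
        proof (cases "\<omega> \<in> A")
          case True
          show ?thesis
          proof (cases "\<omega> \<in> E n")
            case True
            then show ?thesis
              using Y(2)[of \<omega>] \<open>\<omega> \<in> A\<close> power_mono[of "norm (Y \<omega>)" K 2] by (simp add: add_increasing2)
          next
            case False
            then have "(norm (D n \<omega>))\<^sup>2 \<le> e\<^sup>2"
              using \<omega> by (intro power_mono) (auto simp: E_def)
            then show ?thesis
              using Y(1)[OF \<open>\<omega> \<in> A\<close>, of n] norm_add_power2_le[of "X n \<omega>" "D n \<omega>"] False True by simp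
          qed
        qed simp
      qed
      also have "\<dots> = K\<^sup>2 * prob (E n) + (2 * (\<integral>\<omega>. (norm (X n \<omega>))\<^sup>2 \<partial>M) + 2 * e\<^sup>2)"
      proof -
        have "integrable M (\<lambda>\<omega>. K\<^sup>2 * indicat_real (E n) \<omega>)"
          "integrable M (\<lambda>\<omega>. 2 * (norm (X n \<omega>))\<^sup>2)" "integrable M (\<lambda>\<omega>. 2 * e\<^sup>2)"
          using X(1)[of n] by (auto intro!: integrable_real_mult_indicator simp: less_top[symmetric])
        then show ?thesis by (simp add: prob_space)
      qed
      finally show ?thesis using X(2)[of n] by linarith
    qed
    have "(\<lambda>n. K\<^sup>2 * prob (E n) + (2 * c + 2 * e\<^sup>2)) \<longlonglongrightarrow> K\<^sup>2 * 0 + (2 * c + 2 * e\<^sup>2)"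
      unfolding E_def by (intro tendsto_intros D e)
    then show ?thesis
      using le by (intro LIMSEQ_le_const[where X="\<lambda>n. K\<^sup>2 * prob (E n) + (2 * c + 2 * e\<^sup>2)"]) auto
  qed
  show ?thesis
  proof (rule field_le_epsilon)
    fix d :: real assume "d > 0"
    then show "(\<integral>\<omega>. indicator A \<omega> * (norm (Y \<omega>))\<^sup>2 \<partial>M) \<le> 2 * c + d"
      using e[of "sqrt (d / 2)"] by simp
  qed
qed

text \<open>Dominated convergence for the indicators of the exceptional events. It is meant for the
  drift, whose Riemann sums converge path by path.\<close>

lemma conv_in_prob_of_pointwise:
  fixes D :: "nat \<Rightarrow> 'a \<Rightarrow> 'b::{second_countable_topology, real_normed_vector}"
  assumes [measurable]: "\<And>n. D n \<in> borel_measurable M"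
    and lim: "\<And>\<omega>. \<omega> \<in> space M \<Longrightarrow> (\<lambda>n. D n \<omega>) \<longlonglongrightarrow> 0" and e: "e > 0"
  shows "(\<lambda>n. prob {\<omega>\<in>space M. e < norm (D n \<omega>)}) \<longlonglongrightarrow> 0"
proof -
  define E where "E n = {\<omega>\<in>space M. e < norm (D n \<omega>)}" for n
  have [measurable]: "E n \<in> events" for n unfolding E_def by measurable
  have "(\<lambda>n. \<integral>\<omega>. indicator (E n) \<omega> \<partial>M) \<longlonglongrightarrow> (\<integral>\<omega>. (0::real) \<partial>M)"
  proof (rule integral_dominated_convergence[where w="\<lambda>_. 1"])
    show "AE \<omega> in M. (\<lambda>n. indicator (E n) \<omega>) \<longlonglongrightarrow> (0::real)"
    proof (rule AE_I2)
      fix \<omega> assume "\<omega> \<in> space M"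
      then have "eventually (\<lambda>n. norm (D n \<omega>) < e) sequentially"
        using lim[THEN tendsto_norm_zero] e by (auto simp: order_tendsto_iff)
      then have "eventually (\<lambda>n. indicator (E n) \<omega> = (0::real)) sequentially"
        by eventually_elim (auto simp: E_def)
      then show "(\<lambda>n. indicator (E n) \<omega>) \<longlonglongrightarrow> (0::real)" by (rule tendsto_eventually)
    qed
  qed (auto simp: indicator_def)
  then show ?thesis by (simp add: E_def)
qed

lemma conv_in_prob_add:
  fixes D E :: "nat \<Rightarrow> 'a \<Rightarrow> 'b::{second_countable_topology, real_normed_vector}"
  assumes [measurable]: "\<And>n. D n \<in> borel_measurable M" "\<And>n. E n \<in> borel_measurable M"
    and D: "\<And>e. e > 0 \<Longrightarrow> (\<lambda>n. prob {\<omega>\<in>space M. e < norm (D n \<omega>)}) \<longlonglongrightarrow> 0"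
    and E: "\<And>e. e > 0 \<Longrightarrow> (\<lambda>n. prob {\<omega>\<in>space M. e < norm (E n \<omega>)}) \<longlonglongrightarrow> 0"
    and e: "e > 0"
  shows "(\<lambda>n. prob {\<omega>\<in>space M. e < norm (D n \<omega> + E n \<omega>)}) \<longlonglongrightarrow> 0"
proof (rule tendsto_sandwich[OF _ _ tendsto_const])
  have "(\<lambda>n. prob {\<omega>\<in>space M. e / 2 < norm (D n \<omega>)} + prob {\<omega>\<in>space M. e / 2 < norm (E n \<omega>)})
      \<longlonglongrightarrow> 0 + 0"
    using e by (intro tendsto_add D E) auto
  then show "(\<lambda>n. prob {\<omega>\<in>space M. e / 2 < norm (D n \<omega>)} + prob {\<omega>\<in>space M. e / 2 < norm (E n \<omega>)})
      \<longlonglongrightarrow> 0" by simp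
  have "prob {\<omega>\<in>space M. e < norm (D n \<omega> + E n \<omega>)}
      \<le> prob ({\<omega>\<in>space M. e / 2 < norm (D n \<omega>)} \<union> {\<omega>\<in>space M. e / 2 < norm (E n \<omega>)})" for n
  proof (rule finite_measure_mono, clarify)
    fix \<omega> assume "e < norm (D n \<omega> + E n \<omega>)" "\<not> e / 2 < norm (E n \<omega>)"
    then show "e / 2 < norm (D n \<omega>)" using norm_triangle_ineq[of "D n \<omega>" "E n \<omega>"] by linarith
  qed measurable
  also have "\<dots> n \<le> prob {\<omega>\<in>space M. e / 2 < norm (D n \<omega>)} + prob {\<omega>\<in>space M. e / 2 < norm (E n \<omega>)}" for n
    by (rule measure_Un_le) measurable
  finally show "eventually (\<lambda>n. prob {\<omega>\<in>space M. e < norm (D n \<omega> + E n \<omega>)}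
      \<le> prob {\<omega>\<in>space M. e / 2 < norm (D n \<omega>)} + prob {\<omega>\<in>space M. e / 2 < norm (E n \<omega>)}) sequentially"
    by simp
qed simp

end

section \<open>Wiener increments: independence and moments\<close>

locale wiener = prob_space M for M :: "'a measure" +
  fixes F :: "real \<Rightarrow> 'a measure" and t0 T :: real and W :: "real \<Rightarrow> 'a \<Rightarrow> real^3"
  assumes W: "wiener3 M F t0 T W"
begin

lemma measurable_F_M: "f \<in> measurable (F s) N \<Longrightarrow> f \<in> measurable M N"
  using W measurable_from_subalg unfolding wiener3_def by blast

lemma measurable_F_mono: "f \<in> measurable (F s) N \<Longrightarrow> s \<le> t \<Longrightarrow> f \<in> measurable (F t) N"
proof -
  assume f: "f \<in> measurable (F s) N" and "s \<le> t"
  have "filtration (space M) F" using W by (auto simp: wiener3_def)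
  then have "subalgebra (F t) (F s)"
    using \<open>s \<le> t\<close> unfolding filtration_def subalgebra_def by auto
  then show ?thesis using f measurable_from_subalg by blast
qed

lemma space_F: "space (F s) = space M"
  using W by (auto simp: wiener3_def subalgebra_def)

lemma sets_F_M: "A \<in> sets (F s) \<Longrightarrow> A \<in> sets M"
  using W by (auto simp: wiener3_def subalgebra_def)

lemma sets_F_mono: "A \<in> sets (F s) \<Longrightarrow> s \<le> t \<Longrightarrow> A \<in> sets (F t)"
  using W unfolding wiener3_def filtration_def by blast

lemma W_measurable_F: "t0 \<le> t \<Longrightarrow> t \<le> T \<Longrightarrow> W t \<in> borel_measurable (F t)"
  using W by (auto simp: wiener3_def)

lemma W_measurable: "t0 \<le> t \<Longrightarrow> t \<le> T \<Longrightarrow> W t \<in> borel_measurable M"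
  using W_measurable_F measurable_F_M by blast

context
  fixes s t :: real
  assumes st: "t0 \<le> s" "s < t" "t \<le> T"
begin

private lemma dW_measurable [measurable]: "(\<lambda>\<omega>. W t \<omega> - W s \<omega>) \<in> borel_measurable M"
  using st by (intro borel_measurable_diff W_measurable) auto

text \<open>The sigma-algebras generated by \<open>V\<close> and by \<open>g\<close> of the
  increment lie inside the two that \<open>wiener3\<close> declares independent. The function
  \<open>g\<close> covers components, their products and powers of the norm at once.\<close>

lemma indep_increment:
  fixes V :: "'a \<Rightarrow> real" and g :: "real^3 \<Rightarrow> real"
  assumes V: "V \<in> borel_measurable (F s)" and g: "g \<in> borel_measurable borel"
  shows "indep_var borel V borel (\<lambda>\<omega>. g (W t \<omega> - W s \<omega>))"
  unfolding indep_var_eq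
proof (intro conjI)
  show "random_variable borel V" using V by (rule measurable_F_M)
  show "random_variable borel (\<lambda>\<omega>. g (W t \<omega> - W s \<omega>))"
    using measurable_compose[OF dW_measurable g] by simp
  have ind: "indep_set (sets (F s))
          (sets (vimage_algebra (space M) (\<lambda>\<omega>. W t \<omega> - W s \<omega>) (borel :: (real^3) measure)))"
    using W st by (auto simp: wiener3_def)
  have 1: "sigma_sets (space M) {V -` A \<inter> space M |A. A \<in> sets borel} \<subseteq> sets (F s)"
    unfolding space_F[of s, symmetric] using V by (intro sets.sigma_sets_subset) (auto intro: measurable_sets)
  have "(\<lambda>\<omega>. g (W t \<omega> - W s \<omega>)) \<in> borel_measurable (vimage_algebra (space M) (\<lambda>\<omega>. W t \<omega> - W s \<omega>) borel)"
    by (rule measurable_compose[OF measurable_vimage_algebra1 g]) simp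
  then have 2: "sigma_sets (space M) {(\<lambda>\<omega>. g (W t \<omega> - W s \<omega>)) -` A \<inter> space M |A. A \<in> sets borel}
     \<subseteq> sets (vimage_algebra (space M) (\<lambda>\<omega>. W t \<omega> - W s \<omega>) borel)"
    by (subst space_vimage_algebra[of "space M" "\<lambda>\<omega>. W t \<omega> - W s \<omega>" borel, symmetric],
        intro sets.sigma_sets_subset) (auto dest: measurable_sets)
  show "indep_set (sigma_sets (space M) {V -` A \<inter> space M |A. A \<in> sets borel})
     (sigma_sets (space M) {(\<lambda>\<omega>. g (W t \<omega> - W s \<omega>)) -` A \<inter> space M |A. A \<in> sets borel})"
    using ind 1 2 unfolding indep_sets2_eq by blast
qed

lemma expectation_increment_mult:
  fixes V :: "'a \<Rightarrow> real" and g :: "real^3 \<Rightarrow> real"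
  assumes V: "V \<in> borel_measurable (F s)" "integrable M V"
    and g: "g \<in> borel_measurable borel" "integrable M (\<lambda>\<omega>. g (W t \<omega> - W s \<omega>))"
  shows "integrable M (\<lambda>\<omega>. V \<omega> * g (W t \<omega> - W s \<omega>))"
    and "(\<integral>\<omega>. V \<omega> * g (W t \<omega> - W s \<omega>) \<partial>M) = (\<integral>\<omega>. V \<omega> \<partial>M) * (\<integral>\<omega>. g (W t \<omega> - W s \<omega>) \<partial>M)"
  using indep_var_integrable[OF indep_increment[OF V(1) g(1)] V(2) g(2)]
    indep_var_lebesgue_integral[OF indep_increment[OF V(1) g(1)] V(2) g(2)] by auto

lemma increment_moment:
  "integrable M (\<lambda>\<omega>. ((W t \<omega> - W s \<omega>) $ i) ^ k)"
  "(\<integral>\<omega>. ((W t \<omega> - W s \<omega>) $ i) ^ (2 * k) \<partial>M) = fact (2 * k) / (2 ^ k * fact k) * (t - s) ^ k"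
  "(\<integral>\<omega>. ((W t \<omega> - W s \<omega>) $ i) \<partial>M) = 0"
proof -
  have pos: "sqrt (t - s) > 0" using st by simp
  have d: "distributed M lborel (\<lambda>\<omega>. (W t \<omega> - W s \<omega>) $ i) (normal_density 0 (sqrt (t - s)))"
    using W st by (auto simp: wiener3_def)
  show "integrable M (\<lambda>\<omega>. ((W t \<omega> - W s \<omega>) $ i) ^ k)"
    using distributed_integrable[OF d, of "\<lambda>x. x ^ k"] integrable_normal_moment[OF pos, of 0 k] by simp
  show "(\<integral>\<omega>. ((W t \<omega> - W s \<omega>) $ i) ^ (2 * k) \<partial>M) = fact (2 * k) / (2 ^ k * fact k) * (t - s) ^ k"
    using distributed_integral[OF d, of "\<lambda>x. x ^ (2 * k)"] integral_normal_moment_even[OF pos, of 0 k] st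
    by (simp add: power_divide field_simps)
  show "(\<integral>\<omega>. ((W t \<omega> - W s \<omega>) $ i) \<partial>M) = 0"
    using distributed_integral[OF d, of "\<lambda>x. x"] integral_normal_moment_odd[OF pos, of 0 0] by simp
qed

text \<open>These are the means that centre the quadratic form of the increment in
  \<open>esec_noise\<close>; off the diagonal they vanish by independence of the components.\<close>

lemma increment_covariance:
  "integrable M (\<lambda>\<omega>. (W t \<omega> - W s \<omega>) $ i * (W t \<omega> - W s \<omega>) $ j)"
  "(\<integral>\<omega>. (W t \<omega> - W s \<omega>) $ i * (W t \<omega> - W s \<omega>) $ j \<partial>M) = (if i = j then t - s else 0)"
proof -
  have "integrable M (\<lambda>\<omega>. (W t \<omega> - W s \<omega>) $ i * (W t \<omega> - W s \<omega>) $ j) \<and>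
    (\<integral>\<omega>. (W t \<omega> - W s \<omega>) $ i * (W t \<omega> - W s \<omega>) $ j \<partial>M) = (if i = j then t - s else 0)"
  proof (cases "i = j")
    case True
    then show ?thesis
      using increment_moment(1)[of i 2] increment_moment(2)[of i 1] by (simp add: power2_eq_square)
  next
    case False
    have "indep_vars (\<lambda>_. borel) (\<lambda>i \<omega>. (W t \<omega> - W s \<omega>) $ i) (UNIV :: 3 set)"
      using W st by (auto simp: wiener3_def)
    then have "indep_vars (\<lambda>_. borel) (\<lambda>i \<omega>. (W t \<omega> - W s \<omega>) $ i) (insert i {j})"
      by (rule indep_vars_subset) simp
    \<comment> \<open>Pairwise independence is extracted from the rule for sums, applied to the
      one-element sum over \<open>{j}\<close>.\<close>
    then have ind: "indep_var borel (\<lambda>\<omega>. (W t \<omega> - W s \<omega>) $ i) borel (\<lambda>\<omega>. (W t \<omega> - W s \<omega>) $ j)"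
      using indep_vars_sum[of "{j}" i] False by simp
    have int: "integrable M (\<lambda>\<omega>. (W t \<omega> - W s \<omega>) $ i)" for i
      using increment_moment(1)[of i 1] by simp
    show ?thesis
      using indep_var_integrable[OF ind int int] indep_var_lebesgue_integral[OF ind int int]
        increment_moment(3) False by simp
  qed
  then show "integrable M (\<lambda>\<omega>. (W t \<omega> - W s \<omega>) $ i * (W t \<omega> - W s \<omega>) $ j)"
    "(\<integral>\<omega>. (W t \<omega> - W s \<omega>) $ i * (W t \<omega> - W s \<omega>) $ j \<partial>M) = (if i = j then t - s else 0)"
    by auto
qed

text \<open>\<open>|w|^2\<close> is at most 3 times the largest squared component, which gives
  \<open>3^k\<close>; bounding that component by the sum over all three gives one more 3. For
  \<open>k = 1, 2, 3\<close> the constants are 9, 81 and 1215, which reappear below.\<close>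

lemma increment_norm_moment:
  "integrable M (\<lambda>\<omega>. (norm (W t \<omega> - W s \<omega>)) ^ (2 * k))"
  "(\<integral>\<omega>. (norm (W t \<omega> - W s \<omega>)) ^ (2 * k) \<partial>M) \<le> 3 ^ Suc k * (fact (2 * k) / (2 ^ k * fact k)) * (t - s) ^ k"
proof -
  have le: "(norm (w :: real^3)) ^ (2 * k) \<le> 3 ^ k * (\<Sum>i\<in>UNIV. (w $ i) ^ (2 * k))" for w
  proof -
    define m where "m = Max (range (\<lambda>i. (w $ i)\<^sup>2))"
    have m: "(w $ i)\<^sup>2 \<le> m" for i by (auto simp: m_def)
    have "m \<in> range (\<lambda>i. (w $ i)\<^sup>2)" unfolding m_def by (intro Max_in) auto
    then obtain j where j: "m = (w $ j)\<^sup>2" by auto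
    have "(norm w)\<^sup>2 = (\<Sum>i\<in>UNIV. (w $ i)\<^sup>2)"
      unfolding power2_norm_eq_inner inner_vec_def by (simp add: power2_eq_square)
    also have "\<dots> \<le> 3 * m"
      using sum_bounded_above[of UNIV "\<lambda>i. (w $ i)\<^sup>2" m] m by simp
    finally have "((norm w)\<^sup>2) ^ k \<le> (3 * m) ^ k" by (intro power_mono) auto
    also have "\<dots> = 3 ^ k * (w $ j) ^ (2 * k)"
      by (simp add: j power_mult_distrib power_mult)
    also have "\<dots> \<le> 3 ^ k * (\<Sum>i\<in>UNIV. (w $ i) ^ (2 * k))"
      by (intro mult_left_mono member_le_sum) auto
    finally show ?thesis by (simp add: power_mult)
  qed
  have int: "integrable M (\<lambda>\<omega>. 3 ^ k * (\<Sum>i\<in>UNIV. ((W t \<omega> - W s \<omega>) $ i) ^ (2 * k)))"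
    by (intro integrable_mult_right Bochner_Integration.integrable_sum increment_moment)
  show i: "integrable M (\<lambda>\<omega>. (norm (W t \<omega> - W s \<omega>)) ^ (2 * k))"
    by (rule Bochner_Integration.integrable_bound[OF int]) (use le[of "W t _ - W s _"] dW_measurable in \<open>auto intro!: AE_I2 order_trans[OF _ abs_ge_self]\<close>)
  have "(\<integral>\<omega>. (norm (W t \<omega> - W s \<omega>)) ^ (2 * k) \<partial>M)
     \<le> (\<integral>\<omega>. 3 ^ k * (\<Sum>i\<in>UNIV. ((W t \<omega> - W s \<omega>) $ i) ^ (2 * k)) \<partial>M)"
    by (intro integral_mono i int le)
  also have "\<dots> = 3 ^ k * (\<Sum>i\<in>UNIV. \<integral>\<omega>. ((W t \<omega> - W s \<omega>) $ (i::3)) ^ (2 * k) \<partial>M)"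
    by (subst integral_mult_right_zero, subst Bochner_Integration.integral_sum) (rule increment_moment refl)+
  finally show "(\<integral>\<omega>. (norm (W t \<omega> - W s \<omega>)) ^ (2 * k) \<partial>M)
      \<le> 3 ^ Suc k * (fact (2 * k) / (2 ^ k * fact k)) * (t - s) ^ k"
    unfolding increment_moment(2) by (simp add: ac_simps)
qed

text \<open>Independence makes products of merely integrable factors integrable, which is why
  \<open>mincr\<close> can be tested with all integrable \<open>V\<close> instead of square
  integrable ones.\<close>

lemma expectation_inner_increment:
  fixes V :: "'a \<Rightarrow> real^3"
  assumes V: "V \<in> borel_measurable (F s)" "integrable M (\<lambda>\<omega>. norm (V \<omega>))"
  shows "integrable M (\<lambda>\<omega>. V \<omega> \<bullet> (W t \<omega> - W s \<omega>))" "(\<integral>\<omega>. V \<omega> \<bullet> (W t \<omega> - W s \<omega>) \<partial>M) = 0"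
proof -
  have Vi: "(\<lambda>\<omega>. V \<omega> $ i) \<in> borel_measurable (F s)" for i
    by (rule measurable_compose[OF V(1)]) (intro borel_measurable_continuous_onI continuous_intros)
  have Vint: "integrable M (\<lambda>\<omega>. V \<omega> $ i)" for i
    by (rule Bochner_Integration.integrable_bound[OF V(2)])
      (use component_le_norm_cart measurable_F_M[OF Vi] in auto)
  have W1: "integrable M (\<lambda>\<omega>. (W t \<omega> - W s \<omega>) $ i)" for i
    using increment_moment(1)[of i 1] by simp
  have int: "integrable M (\<lambda>\<omega>. V \<omega> $ i * (W t \<omega> - W s \<omega>) $ i)" for i
    by (rule expectation_increment_mult(1)[OF Vi Vint, of "\<lambda>x. x $ i"]) (use W1 in auto)
  have zero: "(\<integral>\<omega>. V \<omega> $ i * (W t \<omega> - W s \<omega>) $ i \<partial>M) = 0" for i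
    using expectation_increment_mult(2)[OF Vi Vint, of "\<lambda>x. x $ i"] W1 increment_moment(3) by auto
  show "integrable M (\<lambda>\<omega>. V \<omega> \<bullet> (W t \<omega> - W s \<omega>))"
    unfolding inner_vec_def inner_real_def by (intro Bochner_Integration.integrable_sum int)
  show "(\<integral>\<omega>. V \<omega> \<bullet> (W t \<omega> - W s \<omega>) \<partial>M) = 0"
    unfolding inner_vec_def inner_real_def by (subst Bochner_Integration.integral_sum) (use int zero in auto)
qed

end

end

section \<open>Measurability of the coefficients and of the scheme\<close>

lemma borel_measurable_cross [measurable (raw)]:
  fixes f g :: "'a \<Rightarrow> real^3"
  assumes "f \<in> borel_measurable N" "g \<in> borel_measurable N"
  shows "(\<lambda>x. f x \<times> g x) \<in> borel_measurable N"
  by (rule borel_measurable_continuous_Pair[OF assms]) (intro continuous_on_cross continuous_intros)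

lemma borel_measurable_dif [measurable (raw)]:
  assumes "f \<in> borel_measurable N" "g \<in> borel_measurable N"
  shows "(\<lambda>x. dif (f x) (g x)) \<in> borel_measurable N"
  unfolding dif_def Dcoef_def using assms by measurable

lemma borel_measurable_drift [measurable (raw)]:
  assumes "f \<in> borel_measurable N"
  shows "(\<lambda>x. drift B t (f x)) \<in> borel_measurable N"
  unfolding drift_eq using assms by measurable

text \<open>Read off from the closed form; the definite description defining the step would not show
  it.\<close>

lemma borel_measurable_esec_step [measurable (raw)]:
  assumes "f \<in> borel_measurable N" "g \<in> borel_measurable N"
  shows "(\<lambda>x. esec_step h b (f x) (g x)) \<in> borel_measurable N"
  unfolding esec_step_eq esec_mid_def esec_rot_def Dcoef_def using assms by measurable

lemma borel_measurable_esec_noise [measurable (raw)]: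
  assumes "f \<in> borel_measurable N" "g \<in> borel_measurable N"
  shows "(\<lambda>x. esec_noise h (f x) (g x)) \<in> borel_measurable N"
  unfolding esec_noise_def Dcoef_def using assms by measurable

lemma borel_measurable_esec_rem [measurable (raw)]:
  assumes "f \<in> borel_measurable N" "g \<in> borel_measurable N"
  shows "(\<lambda>x. esec_rem B t h (f x) (g x)) \<in> borel_measurable N"
  unfolding esec_rem_def using assms by measurable

section \<open>Left-point Riemann sums\<close>

lemma sum_lessThan_add:
  fixes f :: "nat \<Rightarrow> 'a::comm_monoid_add"
  shows "(\<Sum>l<a + b. f l) = (\<Sum>l<a. f l) + (\<Sum>l<b. f (a + l))"
  by (induction b) (simp_all add: add.assoc)

lemma riemann_sum_error:
  fixes \<phi> :: "real \<Rightarrow> 'a::banach"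
  assumes \<phi>: "continuous_on {a..b} \<phi>" and d: "d \<ge> 0" "a + real m * d \<le> b"
    and e: "\<And>x y. x \<in> {a..b} \<Longrightarrow> y \<in> {a..b} \<Longrightarrow> \<bar>x - y\<bar> \<le> d \<Longrightarrow> norm (\<phi> x - \<phi> y) \<le> e"
  shows "norm (integral {a..a + real m * d} \<phi> - (\<Sum>j<m. d *\<^sub>R \<phi> (a + real j * d))) \<le> real m * d * e"
  using d(2)
proof (induction m)
  case (Suc m)
  define c where "c = a + real m * d"
  have c: "a \<le> c" "c + d \<le> b" "a + real (Suc m) * d = c + d"
    using Suc.prems d by (auto simp: c_def algebra_simps)
  have i: "\<phi> integrable_on {a..c + d}" "\<phi> integrable_on {c..c + d}"
    using c d by (auto intro!: integrable_continuous_real continuous_on_subset[OF \<phi>])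
  have comb: "integral {a..c + d} \<phi> = integral {a..c} \<phi> + integral {c..c + d} \<phi>"
    using Henstock_Kurzweil_Integration.integral_combine[OF _ _ i(1), of c] c d by simp
  have "((\<lambda>x. \<phi> x - \<phi> c) has_integral integral {c..c + d} \<phi> - d *\<^sub>R \<phi> c) (cbox c (c + d))"
    using has_integral_diff[OF integrable_integral[OF i(2)] has_integral_const_real[of "\<phi> c" c "c + d"]] d
    by simp
  moreover have "0 \<le> e" using e[of a a] c d by (smt (verit) atLeastAtMost_iff norm_ge_zero)
  ultimately have "norm (integral {c..c + d} \<phi> - d *\<^sub>R \<phi> c) \<le> e * measure lborel (cbox c (c + d))"
    using c d by (intro has_integral_bound[where f="\<lambda>x. \<phi> x - \<phi> c"]) (auto intro!: e)
  then have p: "norm (integral {c..c + d} \<phi> - d *\<^sub>R \<phi> c) \<le> d * e"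
    using d by (simp add: mult.commute)
  have "norm (integral {a..c} \<phi> - (\<Sum>j<m. d *\<^sub>R \<phi> (a + real j * d))) \<le> real m * d * e"
    using Suc c d by (simp add: c_def)
  then have "norm ((integral {a..c} \<phi> - (\<Sum>j<m. d *\<^sub>R \<phi> (a + real j * d)))
      + (integral {c..c + d} \<phi> - d *\<^sub>R \<phi> c)) \<le> real m * d * e + d * e"
    using p by (intro norm_triangle_le add_mono)
  then show ?case
    unfolding c(3) comb by (simp add: c_def algebra_simps)
qed simp

text \<open>The sums run over \<open>q\<close> steps of length \<open>d\<close>, each cut into
  \<open>Suc n\<close> pieces: the same points at which the Ito sums are taken later.\<close>

lemma riemann_sum_tendsto:
  fixes \<phi> :: "real \<Rightarrow> 'a::banach"
  assumes \<phi>: "continuous_on {a..b} \<phi>" and d: "d \<ge> 0" "a + real q * d \<le> b"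
  shows "(\<lambda>n. \<Sum>l<q * Suc n. (d / real (Suc n)) *\<^sub>R \<phi> (a + real l * (d / real (Suc n))))
     \<longlonglongrightarrow> integral {a..a + real q * d} \<phi>"
proof (rule metric_LIMSEQ_I)
  fix e :: real assume e: "e > 0"
  \<comment> \<open>The \<open>+ 1\<close> keeps the denominator positive when
    \<open>q d = 0\<close> and makes the final inequality strict.\<close>
  define e' where "e' = e / (real q * d + 1)"
  have e': "e' > 0" "real q * d * e' < e"
  proof -
    have p: "real q * d + 1 > 0" using d by (smt (verit) mult_nonneg_nonneg of_nat_0_le_iff)
    then show "e' > 0" using e by (simp add: e'_def)
    have "real q * d * e' = e * (real q * d / (real q * d + 1))" by (simp add: e'_def)
    also have "\<dots> < e * 1" using e p by (intro mult_strict_left_mono) auto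
    finally show "real q * d * e' < e" by simp
  qed
  have "uniformly_continuous_on {a..b} \<phi>"
    by (intro compact_uniformly_continuous \<phi>) simp
  then obtain \<eta> where \<eta>: "\<eta> > 0"
    "\<And>x y. x \<in> {a..b} \<Longrightarrow> y \<in> {a..b} \<Longrightarrow> dist x y < \<eta> \<Longrightarrow> dist (\<phi> x) (\<phi> y) < e'"
    unfolding uniformly_continuous_on_def using e'(1) by metis
  obtain N where N: "d / \<eta> < real (Suc N)" using reals_Archimedean2 by (metis less_SucI of_nat_less_iff order_less_trans lessI)
  show "\<exists>N. \<forall>n\<ge>N. dist (\<Sum>l<q * Suc n. (d / real (Suc n)) *\<^sub>R \<phi> (a + real l * (d / real (Suc n))))
     (integral {a..a + real q * d} \<phi>) < e"
  proof (intro exI allI impI)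
    fix n assume n: "n \<ge> N"
    have "d / \<eta> < real (Suc n)" using N n by linarith
    then have small: "d / real (Suc n) < \<eta>" using \<eta>(1) by (simp add: field_simps)
    have len: "real (q * Suc n) * (d / real (Suc n)) = real q * d"
      unfolding of_nat_mult by (simp del: of_nat_Suc)
    have "norm (integral {a..a + real (q * Suc n) * (d / real (Suc n))} \<phi>
       - (\<Sum>l<q * Suc n. (d / real (Suc n)) *\<^sub>R \<phi> (a + real l * (d / real (Suc n)))))
       \<le> real (q * Suc n) * (d / real (Suc n)) * e'"
    proof (rule riemann_sum_error[OF \<phi>])
      show "norm (\<phi> x - \<phi> y) \<le> e'" if "x \<in> {a..b}" "y \<in> {a..b}" "\<bar>x - y\<bar> \<le> d / real (Suc n)" for x y
        using \<eta>(2)[OF that(1,2)] that(3) small by (simp add: dist_norm)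
    qed (use d len in auto)
    then show "dist (\<Sum>l<q * Suc n. (d / real (Suc n)) *\<^sub>R \<phi> (a + real l * (d / real (Suc n))))
     (integral {a..a + real q * d} \<phi>) < e"
      unfolding len using e'(2) by (simp add: dist_norm norm_minus_commute)
  qed
qed

text \<open>By symmetry \<open>V \<bullet> G dW = G V \<bullet> dW\<close>, where \<open>G V\<close>
  is known at time \<open>s\<close>, so the mean is zero. The bound on \<open>G\<close> is a random
  factor \<open>c\<close> known at time \<open>s\<close>, independent of the increment: the second
  moment then involves the mean of \<open>c^2\<close>, in which the current error can sit. The
  constant \<open>C\<close> only secures integrability; 9 is the second-moment constant of an
  increment.\<close>

lemma (in wiener) mincr_symmetric:
  assumes st: "t0 \<le> s" "s < t" "t \<le> T"
    and G: "\<And>V. V \<in> borel_measurable (F s) \<Longrightarrow> (\<lambda>\<omega>. G \<omega> (V \<omega>)) \<in> borel_measurable (F s)"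
    and GM: "(\<lambda>\<omega>. G \<omega> (W t \<omega> - W s \<omega>)) \<in> borel_measurable M"
    and sym: "\<And>\<omega> x y. x \<bullet> G \<omega> y = G \<omega> x \<bullet> y"
    and c: "c \<in> borel_measurable (F s)" "\<And>\<omega>. \<omega> \<in> space M \<Longrightarrow> 0 \<le> c \<omega>" "\<And>\<omega>. \<omega> \<in> space M \<Longrightarrow> c \<omega> \<le> C"
    and Gc: "\<And>\<omega> x. \<omega> \<in> space M \<Longrightarrow> norm (G \<omega> x) \<le> c \<omega> * norm x"
  shows "mincr (F s) (\<lambda>\<omega>. G \<omega> (W t \<omega> - W s \<omega>)) \<and>
    (\<integral>\<omega>. (norm (G \<omega> (W t \<omega> - W s \<omega>)))\<^sup>2 \<partial>M) \<le> 9 * (t - s) * (\<integral>\<omega>. (c \<omega>)\<^sup>2 \<partial>M)"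
proof -
  have cM: "c \<in> borel_measurable M" by (rule measurable_F_M[OF c(1)])
  have c2: "integrable M (\<lambda>\<omega>. (c \<omega>)\<^sup>2)"
  proof (rule integrable_const_bound[where B="C\<^sup>2"])
    show "AE \<omega> in M. norm ((c \<omega>)\<^sup>2) \<le> C\<^sup>2" using c by (auto intro!: AE_I2 power_mono)
  qed (use cM in measurable)
  have c2F: "(\<lambda>\<omega>. (c \<omega>)\<^sup>2) \<in> borel_measurable (F s)" using c(1) by measurable
  have w2: "integrable M (\<lambda>\<omega>. (norm (W t \<omega> - W s \<omega>))\<^sup>2)"
    "(\<integral>\<omega>. (norm (W t \<omega> - W s \<omega>))\<^sup>2 \<partial>M) \<le> 9 * (t - s)"
    using increment_norm_moment[OF st, of 1] by auto
  note prod = expectation_increment_mult[OF st c2F c2, of "\<lambda>w. (norm w)\<^sup>2", OF _ w2(1)]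
  have le: "(norm (G \<omega> (W t \<omega> - W s \<omega>)))\<^sup>2 \<le> (c \<omega>)\<^sup>2 * (norm (W t \<omega> - W s \<omega>))\<^sup>2" if "\<omega> \<in> space M" for \<omega>
    unfolding power_mult_distrib[symmetric] using Gc[OF that] by (intro power_mono) auto
  have int: "integrable M (\<lambda>\<omega>. (norm (G \<omega> (W t \<omega> - W s \<omega>)))\<^sup>2)"
    by (rule Bochner_Integration.integrable_bound[OF prod(1)]) (use GM le in \<open>auto intro!: AE_I2\<close>)
  have "mincr (F s) (\<lambda>\<omega>. G \<omega> (W t \<omega> - W s \<omega>))"
    unfolding mincr_def
  proof (intro conjI ballI impI GM int)
    fix V :: "'a \<Rightarrow> real^3" assume V: "V \<in> borel_measurable (F s)" "integrable M (\<lambda>\<omega>. norm (V \<omega>))"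
    have "integrable M (\<lambda>\<omega>. norm (G \<omega> (V \<omega>)))"
    proof (rule Bochner_Integration.integrable_bound)
      show "integrable M (\<lambda>\<omega>. C * norm (V \<omega>))" using V(2) by simp
      show "AE \<omega> in M. norm (norm (G \<omega> (V \<omega>))) \<le> norm (C * norm (V \<omega>))"
      proof (rule AE_I2)
        fix \<omega> assume \<omega>: "\<omega> \<in> space M"
        have "norm (G \<omega> (V \<omega>)) \<le> c \<omega> * norm (V \<omega>)" using Gc[OF \<omega>] .
        also have "\<dots> \<le> C * norm (V \<omega>)" using c(3)[OF \<omega>] by (intro mult_right_mono) auto
        finally show "norm (norm (G \<omega> (V \<omega>))) \<le> norm (C * norm (V \<omega>))" by simp
      qed
    qed (use measurable_F_M[OF G[OF V(1)]] in measurable)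
    from expectation_inner_increment[OF st G[OF V(1)] this]
    show "integrable M (\<lambda>\<omega>. V \<omega> \<bullet> G \<omega> (W t \<omega> - W s \<omega>))" "(\<integral>\<omega>. V \<omega> \<bullet> G \<omega> (W t \<omega> - W s \<omega>) \<partial>M) = 0"
      by (simp_all add: sym)
  qed
  moreover have "(\<integral>\<omega>. (norm (G \<omega> (W t \<omega> - W s \<omega>)))\<^sup>2 \<partial>M) \<le> 9 * (t - s) * (\<integral>\<omega>. (c \<omega>)\<^sup>2 \<partial>M)"
  proof -
    have "(\<integral>\<omega>. (norm (G \<omega> (W t \<omega> - W s \<omega>)))\<^sup>2 \<partial>M) \<le> (\<integral>\<omega>. (c \<omega>)\<^sup>2 * (norm (W t \<omega> - W s \<omega>))\<^sup>2 \<partial>M)"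
      by (intro integral_mono int prod(1) le) auto
    also have "\<dots> = (\<integral>\<omega>. (c \<omega>)\<^sup>2 \<partial>M) * (\<integral>\<omega>. (norm (W t \<omega> - W s \<omega>))\<^sup>2 \<partial>M)"
      by (rule prod(2)) simp
    also have "\<dots> \<le> (\<integral>\<omega>. (c \<omega>)\<^sup>2 \<partial>M) * (9 * (t - s))"
      by (intro mult_left_mono w2(2)) simp
    finally show ?thesis by (simp add: mult.commute)
  qed
  ultimately show ?thesis ..
qed

subsection \<open>The solution localized to an annulus\<close>

text \<open>One constant \<open>L\<close> serves all coefficient bounds. Those along the solution
  are asked on the annulus only, the local error only on the sphere of radius \<open>r\<close>,
  where all iterates lie.\<close>

locale sde = wiener M F t0 T W for M :: "'a measure" and F t0 T W +
  fixes B :: "real \<Rightarrow> real^3" and v0 :: "real^3" and v :: "real \<Rightarrow> 'a \<Rightarrow> real^3" and r L :: real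
  assumes t0_less_T: "t0 < T"
    and solution: "sde_solution M F t0 T B W v0 v"
    and r_pos: "r > 0" and norm_v0: "norm v0 = r" and L_nonneg: "L \<ge> 0"
    and B_Lipschitz: "\<And>s t. s \<in> {t0..T} \<Longrightarrow> t \<in> {t0..T} \<Longrightarrow> norm (B s - B t) \<le> L * \<bar>s - t\<bar>"
    and drift_L: "\<And>t x y. t \<in> {t0..T} \<Longrightarrow> x \<in> annulus r \<Longrightarrow> y \<in> annulus r \<Longrightarrow>
      norm (drift B t x - drift B t y) \<le> L * norm (x - y)"
    and drift_bound: "\<And>t x. t \<in> {t0..T} \<Longrightarrow> x \<in> annulus r \<Longrightarrow> norm (drift B t x) \<le> L"
    and dif_L: "\<And>x y w. x \<in> annulus r \<Longrightarrow> y \<in> annulus r \<Longrightarrow>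
      norm (dif x w - dif y w) \<le> L * norm (x - y) * norm w"
    and dif_bound: "\<And>x w. x \<in> annulus r \<Longrightarrow> norm (dif x w) \<le> L * norm w"
    and rem_bound: "\<And>t h w x. t \<in> {t0..T} \<Longrightarrow> 0 \<le> h \<Longrightarrow> norm x = r \<Longrightarrow>
      norm (esec_rem B t h w x) \<le> L * ((norm w + h) * h + (norm w + h) ^ 3)"
begin

lemma v_t0: "\<omega> \<in> space M \<Longrightarrow> v t0 \<omega> = v0"
  using solution by (auto simp: sde_solution_def)

lemma v_continuous: "\<omega> \<in> space M \<Longrightarrow> continuous_on {t0..T} (\<lambda>t. v t \<omega>)"
  using solution by (auto simp: sde_solution_def)

lemma v_nonzero: "\<omega> \<in> space M \<Longrightarrow> t \<in> {t0..T} \<Longrightarrow> v t \<omega> \<noteq> 0"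
  using solution by (auto simp: sde_solution_def)

lemma v_measurable_F: "t \<in> {t0..T} \<Longrightarrow> v t \<in> borel_measurable (F t)"
  using solution by (auto simp: sde_solution_def)

lemma v_measurable: "t \<in> {t0..T} \<Longrightarrow> v t \<in> borel_measurable M"
  using v_measurable_F measurable_F_M by blast

text \<open>Plays the role of a stopping time.\<close>

definition stay :: "real \<Rightarrow> 'a set" where
  "stay t = {\<omega>\<in>space M. \<forall>s\<in>{t0..t}. v s \<omega> \<in> annulus r}"

lemma stay_mono: "s \<le> t \<Longrightarrow> stay t \<subseteq> stay s"
  by (auto simp: stay_def)

lemma stay_annulus: "\<omega> \<in> stay t \<Longrightarrow> t0 \<le> s \<Longrightarrow> s \<le> t \<Longrightarrow> v s \<omega> \<in> annulus r"
  by (auto simp: stay_def)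

text \<open>By continuity of the paths and closedness of the annulus it suffices to test the
  countably many times that divide \<open>[t0, t]\<close> in a rational ratio; all of them are at
  most \<open>t\<close>, so the event is known at time \<open>t\<close>.\<close>

lemma stay_sets_F:
  assumes t: "t \<in> {t0..T}"
  shows "stay t \<in> sets (F t)"
proof -
  define \<tau> where "\<tau> i n = t0 + (real i / real n) * (t - t0)" for i n :: nat
  have \<tau>: "\<tau> i n \<in> {t0..t}" if "i \<le> n" for i n
  proof -
    have "real i / real n \<le> 1" using that by (cases "n = 0") auto
    then have "(real i / real n) * (t - t0) \<le> 1 * (t - t0)" using t by (intro mult_right_mono) auto
    then show ?thesis using t by (auto simp: \<tau>_def)
  qed
  have eq: "stay t = (\<Inter>n. \<Inter>i\<in>{..n}. {\<omega>\<in>space M. v (\<tau> i n) \<omega> \<in> annulus r})"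
  proof (intro equalityI subsetI)
    fix \<omega> assume "\<omega> \<in> stay t"
    then show "\<omega> \<in> (\<Inter>n. \<Inter>i\<in>{..n}. {\<omega>\<in>space M. v (\<tau> i n) \<omega> \<in> annulus r})"
      using \<tau> by (auto simp: stay_def)
  next
    fix \<omega> assume "\<omega> \<in> (\<Inter>n. \<Inter>i\<in>{..n}. {\<omega>\<in>space M. v (\<tau> i n) \<omega> \<in> annulus r})"
    then have \<omega>: "\<omega> \<in> space M" and in_ann: "\<And>i n. i \<le> n \<Longrightarrow> v (\<tau> i n) \<omega> \<in> annulus r" by auto
    have "v s \<omega> \<in> annulus r" if s: "s \<in> {t0..t}" for s
    proof -
      \<comment> \<open>If \<open>t = t0\<close> the quotient is 0, and \<open>s = t0\<close> as
        well, so the representation of \<open>s\<close> still holds.\<close>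
      define x where "x = (s - t0) / (t - t0)"
      have x: "0 \<le> x" "x \<le> 1" using s by (auto simp: x_def divide_le_eq_1)
      have sx: "s = t0 + x * (t - t0)" using s by (auto simp: x_def)
      define i where "i n = nat \<lfloor>x * real n\<rfloor>" for n
      have i: "i n \<le> n" for n
        using x mult_right_mono[of x 1 "real n"] by (simp add: i_def floor_le_iff nat_le_iff)
      have "(\<lambda>n. real (i n) / real n) \<longlonglongrightarrow> x"
      proof (rule tendsto_sandwich)
        have fl: "x * real n - 1 \<le> real (i n)" "real (i n) \<le> x * real n" for n
          using x by (auto simp: i_def)
        show "eventually (\<lambda>n. x - 1 / real n \<le> real (i n) / real n) sequentially"
          using eventually_gt_at_top[of 0]
        proof eventually_elim
          case (elim n)
          then show ?case using divide_right_mono[OF fl(1)[of n], of "real n"] by (simp add: diff_divide_distrib)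
        qed
        show "eventually (\<lambda>n. real (i n) / real n \<le> x) sequentially"
          using eventually_gt_at_top[of 0]
        proof eventually_elim
          case (elim n)
          then show ?case using fl(2)[of n] by (simp add: field_simps)
        qed
        have "(\<lambda>n. x - 1 / real n) \<longlonglongrightarrow> x - 0"
          by (rule tendsto_diff[OF tendsto_const lim_1_over_n])
        then show "(\<lambda>n. x - 1 / real n) \<longlonglongrightarrow> x" by simp
      qed simp
      then have "(\<lambda>n. \<tau> (i n) n) \<longlonglongrightarrow> s"
        unfolding \<tau>_def by (subst sx) (rule tendsto_add[OF tendsto_const tendsto_mult[OF _ tendsto_const]])
      then have "(\<lambda>n. v (\<tau> (i n) n) \<omega>) \<longlonglongrightarrow> v s \<omega>"
      proof (rule continuous_on_tendsto_compose[OF v_continuous[OF \<omega>]])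
        have "\<tau> (i n) n \<in> {t0..T}" for n using \<tau>[OF i[of n]] t by auto
        then show "eventually (\<lambda>n. \<tau> (i n) n \<in> {t0..T}) sequentially" by simp
      qed (use s t in auto)
      then show ?thesis
        using in_ann[OF i] by (rule closed_sequentially[OF closed_annulus, rotated])
    qed
    then show "\<omega> \<in> stay t" using \<omega> by (auto simp: stay_def)
  qed
  have "{\<omega>\<in>space M. v (\<tau> i n) \<omega> \<in> annulus r} \<in> sets (F t)" if "i \<le> n" for i n
  proof -
    have "v (\<tau> i n) \<in> borel_measurable (F t)"
      using \<tau>[OF that] t by (intro measurable_F_mono[OF v_measurable_F]) auto
    then have "v (\<tau> i n) -` annulus r \<inter> space (F t) \<in> sets (F t)"
      by (rule measurable_sets) (simp add: borel_closed closed_annulus)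
    moreover have "v (\<tau> i n) -` annulus r \<inter> space (F t) = {\<omega>\<in>space M. v (\<tau> i n) \<omega> \<in> annulus r}"
      by (auto simp: space_F)
    ultimately show ?thesis by simp
  qed
  then have "(\<Inter>i\<in>{..n}. {\<omega>\<in>space M. v (\<tau> i n) \<omega> \<in> annulus r}) \<in> sets (F t)" for n
    by (intro sets.finite_INT) auto
  then show ?thesis
    unfolding eq by (intro sets.countable_INT') auto
qed

lemma stay_events: "t \<in> {t0..T} \<Longrightarrow> stay t \<in> events"
  using stay_sets_F sets_F_M by blast

definition grid :: "real \<Rightarrow> nat \<Rightarrow> real" where
  "grid d l = t0 + real l * d"

lemma grid_refine: "m > 0 \<Longrightarrow> grid (d / real m) (q * m) = grid d q"
  by (simp add: grid_def)

lemma grid_mono: "d \<ge> 0 \<Longrightarrow> k \<le> l \<Longrightarrow> grid d k \<le> grid d l"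
  by (simp add: grid_def mult_right_mono)

lemma grid_in:
  assumes "d \<ge> 0" "grid d q \<le> T" "l \<le> q"
  shows "grid d l \<in> {t0..T}"
  using grid_mono[OF assms(1,3)] assms by (auto simp: grid_def)

definition dW :: "real \<Rightarrow> nat \<Rightarrow> 'a \<Rightarrow> real^3" where
  "dW d l \<omega> = W (grid d (Suc l)) \<omega> - W (grid d l) \<omega>"

text \<open>Euler-Maruyama increment with the coefficients taken along the exact solution, not along
  a numerical one.\<close>

definition euler_incr :: "real \<Rightarrow> nat \<Rightarrow> 'a \<Rightarrow> real^3" where
  "euler_incr d l \<omega> = d *\<^sub>R drift B (grid d l) (v (grid d l) \<omega>) + dif (v (grid d l) \<omega>) (dW d l \<omega>)"

lemma dW_measurable:
  assumes "d \<ge> 0" "grid d q \<le> T" "l < q"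
  shows "dW d l \<in> borel_measurable M"
  unfolding dW_def using grid_in[OF assms(1,2)] assms(3)
  by (intro borel_measurable_diff W_measurable) auto

text \<open>The only place where the integral equation of the solution is used. The residual splits
  into the Ito sum error, small in probability by definition, and the Riemann sum error of the
  drift, small on each path.\<close>

lemma euler_conv:
  assumes d: "d > 0" "grid d q \<le> T"
  shows "\<And>n. (\<lambda>\<omega>. v (grid d q) \<omega> - v0 - (\<Sum>l<q * Suc n. euler_incr (d / real (Suc n)) l \<omega>)) \<in> borel_measurable M"
    and "\<And>e. e > 0 \<Longrightarrow> (\<lambda>n. prob {\<omega>\<in>space M.
      e < norm (v (grid d q) \<omega> - v0 - (\<Sum>l<q * Suc n. euler_incr (d / real (Suc n)) l \<omega>))}) \<longlonglongrightarrow> 0"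
proof -
  define t where "t = grid d q"
  have t: "t \<in> {t0..T}" unfolding t_def using d by (intro grid_in[of d q]) auto
  define \<delta> where "\<delta> n = d / real (Suc n)" for n
  have \<delta>: "\<delta> n \<ge> 0" for n using d by (simp add: \<delta>_def)
  have gr: "grid (\<delta> n) (q * Suc n) = t" for n
    unfolding \<delta>_def t_def by (rule grid_refine) simp
  have grT: "grid (\<delta> n) (q * Suc n) \<le> T" for n using gr t by simp
  define I where "I \<omega> = integral {t0..t} (\<lambda>s. drift B s (v s \<omega>))" for \<omega>
  define R where "R n \<omega> = (\<Sum>l<q * Suc n. \<delta> n *\<^sub>R drift B (grid (\<delta> n) l) (v (grid (\<delta> n) l) \<omega>))" for n \<omega>
  define S where "S n \<omega> = (\<Sum>l<q * Suc n. dif (v (grid (\<delta> n) l) \<omega>) (dW (\<delta> n) l \<omega>))" for n \<omega>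
  have vl: "v (grid (\<delta> n) l) \<in> borel_measurable M" if "l < q * Suc n" for n l
    using grid_in[OF \<delta> grT, of l n] that by (intro v_measurable) auto
  have [measurable]: "R n \<in> borel_measurable M" for n
    unfolding R_def
    by (intro borel_measurable_sum borel_measurable_scaleR borel_measurable_const borel_measurable_drift vl) simp
  have [measurable]: "S n \<in> borel_measurable M" for n
    unfolding S_def by (intro borel_measurable_sum borel_measurable_dif vl dW_measurable[OF \<delta> grT]) simp_all
  note [measurable] = v_measurable[OF t]
  have lim: "(\<lambda>n. R n \<omega>) \<longlonglongrightarrow> I \<omega>" if \<omega>: "\<omega> \<in> space M" for \<omega>
  proof -
    have Bc: "continuous_on {t0..T} B"
    proof (rule continuous_onI)
      fix x e assume x: "x \<in> {t0..T}" and e: "(e::real) > 0"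
      show "\<exists>d>0. \<forall>x'\<in>{t0..T}. dist x' x < d \<longrightarrow> dist (B x') (B x) \<le> e"
      proof (intro exI conjI ballI impI)
        show "e / (L + 1) > 0" using e L_nonneg by simp
        fix x' assume x': "x' \<in> {t0..T}" "dist x' x < e / (L + 1)"
        then have "norm (B x' - B x) \<le> L * (e / (L + 1))"
          using B_Lipschitz[OF x'(1) x] L_nonneg by (smt (verit) dist_real_def mult_left_mono)
        also have "\<dots> \<le> e" using e L_nonneg by (simp add: field_simps)
        finally show "dist (B x') (B x) \<le> e" by (simp add: dist_norm)
      qed
    qed
    have "continuous_on {t0..T} (\<lambda>s. drift B s (v s \<omega>))"
      unfolding drift_eq using v_nonzero[OF \<omega>]
      by (intro continuous_intros continuous_on_cross v_continuous[OF \<omega>] Bc) auto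
    then show ?thesis
      using riemann_sum_tendsto[of t0 T "\<lambda>s. drift B s (v s \<omega>)" d q] d
      unfolding R_def I_def t_def \<delta>_def grid_def by simp
  qed
  \<comment> \<open>The pathwise integral is measurable as the pointwise limit of its Riemann
    sums.\<close>
  have [measurable]: "I \<in> borel_measurable M"
    by (rule borel_measurable_LIMSEQ_metric[of R]) (use lim in auto)
  have sum_eq: "(\<Sum>l<q * Suc n. euler_incr (d / real (Suc n)) l \<omega>) = R n \<omega> + S n \<omega>" for n \<omega>
    by (simp add: R_def S_def euler_incr_def sum.distrib \<delta>_def)
  show "(\<lambda>\<omega>. v (grid d q) \<omega> - v0 - (\<Sum>l<q * Suc n. euler_incr (d / real (Suc n)) l \<omega>)) \<in> borel_measurable M" for n
    unfolding sum_eq t_def[symmetric] by measurable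
  fix e :: real assume e: "e > 0"
  have c1: "(\<lambda>n. prob {\<omega>\<in>space M. e < norm (v t \<omega> - v0 - I \<omega> - S n \<omega>)}) \<longlonglongrightarrow> 0" if "e > 0" for e
  proof (cases "q = 0")
    \<comment> \<open>Here the index \<open>q * Suc n\<close> is constantly 0 and selects no
      subsequence, but at \<open>t0\<close> all terms vanish.\<close>
    case True
    then have "t = t0" by (simp add: t_def grid_def)
    then have eq: "{\<omega>\<in>space M. e < norm (v t \<omega> - v0 - I \<omega> - S n \<omega>)} = {}" for n
      using True that by (auto simp: S_def I_def v_t0)
    show ?thesis unfolding eq by simp
  next
    case False
    have "conv_in_prob M (ito_sum (\<lambda>s \<omega>. diffusion (v s \<omega>)) W t0 t) (\<lambda>\<omega>. v t \<omega> - v0 - I \<omega>)"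
      using solution t by (auto simp: sde_solution_def I_def)
    then have "(\<lambda>n. prob {\<omega>\<in>space M. e < norm (ito_sum (\<lambda>s \<omega>. diffusion (v s \<omega>)) W t0 t n \<omega> - (v t \<omega> - v0 - I \<omega>))}) \<longlonglongrightarrow> 0"
      using that by (auto simp: conv_in_prob_def)
    then have "((\<lambda>n. prob {\<omega>\<in>space M. e < norm (ito_sum (\<lambda>s \<omega>. diffusion (v s \<omega>)) W t0 t n \<omega> - (v t \<omega> - v0 - I \<omega>))}) \<circ> (\<lambda>n. q * Suc n)) \<longlonglongrightarrow> 0"
      by (rule LIMSEQ_subseq_LIMSEQ) (use False in \<open>auto simp: strict_mono_def\<close>)
    \<comment> \<open>\<open>[t0, t]\<close> has length \<open>q d\<close>, so
      \<open>q * Suc n\<close> equal pieces have mesh \<open>d / Suc n\<close>: the fine-grid sums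
      are a subsequence of the Ito sums.\<close>
    moreover have "ito_sum (\<lambda>s \<omega>. diffusion (v s \<omega>)) W t0 t (q * Suc n) \<omega> = S n \<omega>" for n \<omega>
    proof -
      have gj: "t0 + real j * (t - t0) / real (q * Suc n) = grid (\<delta> n) j" for j
        unfolding of_nat_mult using False by (simp add: t_def grid_def \<delta>_def del: of_nat_Suc)
      show ?thesis
        unfolding ito_sum_def S_def diffusion_vector_mult dW_def gj ..
    qed
    ultimately show ?thesis by (simp add: o_def norm_minus_commute)
  qed
  have c2: "(\<lambda>n. prob {\<omega>\<in>space M. e < norm (I \<omega> - R n \<omega>)}) \<longlonglongrightarrow> 0" if "e > 0" for e
  proof (rule conv_in_prob_of_pointwise[OF _ _ that])
    show "(\<lambda>n. I \<omega> - R n \<omega>) \<longlonglongrightarrow> 0" if "\<omega> \<in> space M" for \<omega>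
      using tendsto_diff[OF tendsto_const lim[OF that], of "I \<omega>"] by simp
  qed measurable
  have "(\<lambda>n. prob {\<omega>\<in>space M. e < norm ((v t \<omega> - v0 - I \<omega> - S n \<omega>) + (I \<omega> - R n \<omega>))}) \<longlonglongrightarrow> 0"
    by (rule conv_in_prob_add[OF _ _ c1 c2 e]) measurable
  then show "(\<lambda>n. prob {\<omega>\<in>space M.
      e < norm (v (grid d q) \<omega> - v0 - (\<Sum>l<q * Suc n. euler_incr (d / real (Suc n)) l \<omega>))}) \<longlonglongrightarrow> 0"
    unfolding sum_eq t_def[symmetric] by (simp add: algebra_simps)
qed

end

context sde
begin

text \<open>The indicator is known at the left end of the increment, so cutting with it keeps the
  mean zero, and it makes the diffusion matrix bounded by \<open>L\<close>.\<close>

lemma mincr_stay_dif: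
  assumes d: "d > 0" "grid d q \<le> T" "l < q"
  shows "mincr (F (grid d l)) (\<lambda>\<omega>. indicator (stay (grid d l)) \<omega> *\<^sub>R dif (v (grid d l) \<omega>) (dW d l \<omega>))"
    and "(\<integral>\<omega>. (norm (indicator (stay (grid d l)) \<omega> *\<^sub>R dif (v (grid d l) \<omega>) (dW d l \<omega>)))\<^sup>2 \<partial>M)
      \<le> 9 * d * L\<^sup>2"
proof -
  let ?s = "grid d l" and ?t = "grid d (Suc l)"
  have st: "t0 \<le> ?s" "?s < ?t" "?t \<le> T" "?t - ?s = d" "?s \<in> {t0..T}"
    using grid_in[of d q "Suc l"] grid_in[of d q l] d by (auto simp: grid_def algebra_simps)
  note [measurable] = v_measurable_F[OF st(5)] v_measurable[OF st(5)] stay_sets_F[OF st(5)] stay_events[OF st(5)]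
    dW_measurable[OF less_imp_le[OF d(1)] d(2,3)]
  define G where "G = (\<lambda>\<omega> w. indicator (stay ?s) \<omega> *\<^sub>R dif (v ?s \<omega>) w)"
  have G_dW: "G \<omega> (W ?t \<omega> - W ?s \<omega>) = indicator (stay ?s) \<omega> *\<^sub>R dif (v ?s \<omega>) (dW d l \<omega>)" for \<omega>
    by (simp add: G_def dW_def)
  have "mincr (F ?s) (\<lambda>\<omega>. G \<omega> (W ?t \<omega> - W ?s \<omega>)) \<and>
    (\<integral>\<omega>. (norm (G \<omega> (W ?t \<omega> - W ?s \<omega>)))\<^sup>2 \<partial>M) \<le> 9 * (?t - ?s) * (\<integral>\<omega>. L\<^sup>2 \<partial>M)"
  proof (rule mincr_symmetric[OF st(1-3), where C=L])
    show "(\<lambda>\<omega>. G \<omega> (V \<omega>)) \<in> borel_measurable (F ?s)" if [measurable]: "V \<in> borel_measurable (F ?s)" for V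
      unfolding G_def by measurable
    show "(\<lambda>\<omega>. G \<omega> (W ?t \<omega> - W ?s \<omega>)) \<in> borel_measurable M"
      unfolding G_dW by measurable
    show "x \<bullet> G \<omega> y = G \<omega> x \<bullet> y" for \<omega> x y
      by (simp add: G_def inner_dif_symmetric)
    show "norm (G \<omega> x) \<le> L * norm x" for \<omega> x
      using dif_bound[of "v ?s \<omega>" x] stay_annulus[of \<omega> ?s ?s] st(1) L_nonneg
      by (auto simp: G_def indicator_def)
  qed (use L_nonneg in auto)
  then show "mincr (F ?s) (\<lambda>\<omega>. indicator (stay ?s) \<omega> *\<^sub>R dif (v ?s \<omega>) (dW d l \<omega>))"
    "(\<integral>\<omega>. (norm (indicator (stay ?s) \<omega> *\<^sub>R dif (v ?s \<omega>) (dW d l \<omega>)))\<^sup>2 \<partial>M) \<le> 9 * d * L\<^sup>2"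
    unfolding G_dW by (auto simp: prob_space st(4))
qed

text \<open>Here the random factor is \<open>L |v - X|\<close> on the event, so the mean square
  error itself appears on the right, as Gronwall's inequality requires. It is at most
  \<open>3 r L\<close> because there \<open>|v| \<le> 2 r\<close> and
  \<open>|X| = r\<close>.\<close>

lemma mincr_stay_dif_diff:
  assumes d: "d > 0" "grid d q \<le> T" "l < q"
    and X: "X \<in> borel_measurable (F (grid d l))" "\<And>\<omega>. \<omega> \<in> space M \<Longrightarrow> norm (X \<omega>) = r"
  shows "mincr (F (grid d l)) (\<lambda>\<omega>. indicator (stay (grid d l)) \<omega> *\<^sub>R
        (dif (v (grid d l) \<omega>) (dW d l \<omega>) - dif (X \<omega>) (dW d l \<omega>)))"
    and "(\<integral>\<omega>. (norm (indicator (stay (grid d l)) \<omega> *\<^sub>R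
        (dif (v (grid d l) \<omega>) (dW d l \<omega>) - dif (X \<omega>) (dW d l \<omega>))))\<^sup>2 \<partial>M)
      \<le> 9 * d * (L\<^sup>2 * (\<integral>\<omega>. indicator (stay (grid d l)) \<omega> * (norm (v (grid d l) \<omega> - X \<omega>))\<^sup>2 \<partial>M))"
proof -
  let ?s = "grid d l" and ?t = "grid d (Suc l)"
  have st: "t0 \<le> ?s" "?s < ?t" "?t \<le> T" "?t - ?s = d" "?s \<in> {t0..T}"
    using grid_in[of d q "Suc l"] grid_in[of d q l] d by (auto simp: grid_def algebra_simps)
  note [measurable] = v_measurable_F[OF st(5)] v_measurable[OF st(5)] stay_sets_F[OF st(5)] stay_events[OF st(5)]
    dW_measurable[OF less_imp_le[OF d(1)] d(2,3)] X(1) measurable_F_M[OF X(1)]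
  define G where "G = (\<lambda>\<omega> w. indicator (stay ?s) \<omega> *\<^sub>R (dif (v ?s \<omega>) w - dif (X \<omega>) w))"
  define c where "c = (\<lambda>\<omega>. indicator (stay ?s) \<omega> * (L * norm (v ?s \<omega> - X \<omega>)))"
  have G_dW: "G \<omega> (W ?t \<omega> - W ?s \<omega>) = indicator (stay ?s) \<omega> *\<^sub>R
        (dif (v ?s \<omega>) (dW d l \<omega>) - dif (X \<omega>) (dW d l \<omega>))" for \<omega>
    by (simp add: G_def dW_def)
  have Xa: "X \<omega> \<in> annulus r" if "\<omega> \<in> space M" for \<omega>
    using X(2)[OF that] r_pos by (simp add: annulus_def)
  have "mincr (F ?s) (\<lambda>\<omega>. G \<omega> (W ?t \<omega> - W ?s \<omega>)) \<and>
    (\<integral>\<omega>. (norm (G \<omega> (W ?t \<omega> - W ?s \<omega>)))\<^sup>2 \<partial>M) \<le> 9 * (?t - ?s) * (\<integral>\<omega>. (c \<omega>)\<^sup>2 \<partial>M)"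
  proof (rule mincr_symmetric[OF st(1-3), where C="L * (3 * r)"])
    show "(\<lambda>\<omega>. G \<omega> (V \<omega>)) \<in> borel_measurable (F ?s)" if [measurable]: "V \<in> borel_measurable (F ?s)" for V
      unfolding G_def by measurable
    show "(\<lambda>\<omega>. G \<omega> (W ?t \<omega> - W ?s \<omega>)) \<in> borel_measurable M"
      unfolding G_dW by measurable
    show "x \<bullet> G \<omega> y = G \<omega> x \<bullet> y" for \<omega> x y
      by (simp add: G_def inner_dif_symmetric inner_diff_left inner_diff_right)
    show "c \<in> borel_measurable (F ?s)" unfolding c_def by measurable
    show "0 \<le> c \<omega>" for \<omega> using L_nonneg by (simp add: c_def)
    fix \<omega> assume \<omega>: "\<omega> \<in> space M"
    show "c \<omega> \<le> L * (3 * r)"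
    proof (cases "\<omega> \<in> stay ?s")
      case True
      then have "norm (v ?s \<omega>) \<le> 2 * r" using stay_annulus[of \<omega> ?s ?s] st(1) by (auto simp: annulus_def)
      then have "norm (v ?s \<omega> - X \<omega>) \<le> 3 * r"
        using norm_triangle_ineq4[of "v ?s \<omega>" "X \<omega>"] X(2)[OF \<omega>] by linarith
      then show ?thesis using True L_nonneg by (simp add: c_def mult_left_mono)
    next
      case False
      then show ?thesis using L_nonneg r_pos by (simp add: c_def)
    qed
    show "norm (G \<omega> x) \<le> c \<omega> * norm x" for x
      using dif_L[of "v ?s \<omega>" "X \<omega>" x] stay_annulus[of \<omega> ?s ?s] st(1) Xa[OF \<omega>]
      by (auto simp: G_def c_def indicator_def)
  qed
  moreover have "(\<integral>\<omega>. (c \<omega>)\<^sup>2 \<partial>M) = L\<^sup>2 * (\<integral>\<omega>. indicator (stay ?s) \<omega> * (norm (v ?s \<omega> - X \<omega>))\<^sup>2 \<partial>M)"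
  proof -
    have "(\<lambda>\<omega>. (c \<omega>)\<^sup>2) = (\<lambda>\<omega>. L\<^sup>2 * (indicator (stay ?s) \<omega> * (norm (v ?s \<omega> - X \<omega>))\<^sup>2))"
      by (auto simp: c_def indicator_def power_mult_distrib)
    then show ?thesis by simp
  qed
  ultimately show "mincr (F ?s) (\<lambda>\<omega>. indicator (stay ?s) \<omega> *\<^sub>R (dif (v ?s \<omega>) (dW d l \<omega>) - dif (X \<omega>) (dW d l \<omega>)))"
    "(\<integral>\<omega>. (norm (indicator (stay ?s) \<omega> *\<^sub>R (dif (v ?s \<omega>) (dW d l \<omega>) - dif (X \<omega>) (dW d l \<omega>))))\<^sup>2 \<partial>M)
      \<le> 9 * d * (L\<^sup>2 * (\<integral>\<omega>. indicator (stay ?s) \<omega> * (norm (v ?s \<omega> - X \<omega>))\<^sup>2 \<partial>M))"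
    unfolding G_dW by (auto simp: st(4))
qed

lemma dW_measurable_F:
  assumes "d \<ge> 0" "grid d q \<le> T" "l < k" "k \<le> q"
  shows "dW d l \<in> borel_measurable (F (grid d k))"
proof -
  have "grid d l \<in> {t0..T}" "grid d (Suc l) \<in> {t0..T}" "grid d l \<le> grid d k" "grid d (Suc l) \<le> grid d k"
    using assms grid_in[OF assms(1,2), of l] grid_in[OF assms(1,2), of "Suc l"] by (auto intro!: grid_mono)
  then show ?thesis unfolding dW_def
    by (intro borel_measurable_diff measurable_F_mono[OF W_measurable_F]) auto
qed

lemma v_grid_measurable_F:
  assumes "d \<ge> 0" "grid d q \<le> T" "l \<le> k" "k \<le> q"
  shows "v (grid d l) \<in> borel_measurable (F (grid d k))"
  using grid_in[OF assms(1,2), of l] assms grid_mono[of d l k]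
  by (intro measurable_F_mono[OF v_measurable_F]) auto

lemma stay_grid_F:
  assumes "d \<ge> 0" "grid d q \<le> T" "l \<le> k" "k \<le> q"
  shows "stay (grid d l) \<in> sets (F (grid d k))"
  using grid_in[OF assms(1,2), of l] assms grid_mono[of d l k]
  by (intro sets_F_mono[OF stay_sets_F]) auto

text \<open>Over a time \<open>\<tau>\<close> the drift moves the solution by at most
  \<open>\<tau> L\<close>, while the noise is a sum of orthogonal increments of total mean square at
  most \<open>9 L^2 \<tau>\<close>. The inner factors 2 come from squaring this sum, the outer one
  from the passage to the limit in probability.\<close>

lemma solution_increment:
  assumes d: "d > 0" "grid d q \<le> T" and p: "p \<le> q"
  defines "\<tau> \<equiv> real (q - p) * d"
  shows "(\<integral>\<omega>. indicator (stay (grid d q)) \<omega> * (norm (v (grid d q) \<omega> - v (grid d p) \<omega>))\<^sup>2 \<partial>M)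
    \<le> 2 * (2 * (\<tau> * L)\<^sup>2 + 2 * (\<tau> * (9 * L\<^sup>2)))"
proof -
  define \<delta> where "\<delta> n = d / real (Suc n)" for n
  have \<delta>: "\<delta> n > 0" for n using d by (simp add: \<delta>_def)
  have gT: "grid (\<delta> n) (q * Suc n) \<le> T" for n
    unfolding \<delta>_def using d by (subst grid_refine) auto
  \<comment> \<open>Each increment is cut at its own left end; a cut by the final event would look
    into the future and destroy the centring.\<close>
  define c where "c n l \<omega> = (indicator (stay (grid (\<delta> n) l)) \<omega> :: real)" for n l \<omega>
  define Y where "Y n l \<omega> = c n l \<omega> *\<^sub>R (\<delta> n *\<^sub>R drift B (grid (\<delta> n) l) (v (grid (\<delta> n) l) \<omega>))" for n l \<omega>
  define Z where "Z n l \<omega> = c n l \<omega> *\<^sub>R dif (v (grid (\<delta> n) l) \<omega>) (dW (\<delta> n) l \<omega>)" for n l \<omega>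
  define N where "N n = (q - p) * Suc n" for n
  define a where "a n = p * Suc n" for n
  have aN: "a n + N n = q * Suc n" for n
    using p by (simp only: a_def N_def distrib_right[symmetric]) simp
  have N\<delta>: "real (N n) * \<delta> n = \<tau>" for n
    unfolding N_def of_nat_mult \<tau>_def \<delta>_def by (simp del: of_nat_Suc)
  define X where "X n \<omega> = (\<Sum>l<N n. Y n (a n + l) \<omega>) + (\<Sum>l<N n. Z n (a n + l) \<omega>)" for n \<omega>
  \<comment> \<open>Difference of the Euler residuals at the two times on the same fine mesh,
    written as a sum to fit \<open>conv_in_prob_add\<close>.\<close>
  define D where "D n \<omega> = (v (grid d q) \<omega> - v0 - (\<Sum>l<q * Suc n. euler_incr (\<delta> n) l \<omega>))
     + (- (v (grid d p) \<omega> - v0 - (\<Sum>l<p * Suc n. euler_incr (\<delta> n) l \<omega>)))" for n \<omega>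
  have gp: "grid d p \<le> T" "grid d p \<in> {t0..T}" "grid d q \<in> {t0..T}" "grid d p \<le> grid d q"
    using grid_in[of d q p] grid_in[of d q q] grid_mono[of d p q] d p by auto
  have meas: "v (grid (\<delta> n) l) \<in> borel_measurable (F (grid (\<delta> n) k))" "stay (grid (\<delta> n) l) \<in> sets (F (grid (\<delta> n) k))"
    if "l \<le> k" "k \<le> q * Suc n" for n k l
    using v_grid_measurable_F[OF less_imp_le[OF \<delta>] gT that] stay_grid_F[OF less_imp_le[OF \<delta>] gT that] by auto
  have measW: "dW (\<delta> n) l \<in> borel_measurable (F (grid (\<delta> n) k))" if "l < k" "k \<le> q * Suc n" for n k l
    using dW_measurable_F[OF less_imp_le[OF \<delta>] gT that] .
  have Zm: "Z n l \<in> borel_measurable (F (grid (\<delta> n) k))" if "l < k" "k \<le> q * Suc n" for n k l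
  proof -
    have [measurable]: "dW (\<delta> n) l \<in> borel_measurable (F (grid (\<delta> n) k))"
      "v (grid (\<delta> n) l) \<in> borel_measurable (F (grid (\<delta> n) k))" "stay (grid (\<delta> n) l) \<in> sets (F (grid (\<delta> n) k))"
      using measW[OF that] meas[of l k n] that by auto
    show ?thesis unfolding Z_def c_def by measurable
  qed
  have Yb: "(norm (Y n l \<omega>))\<^sup>2 \<le> (\<delta> n * L)\<^sup>2" if "l < q * Suc n" for n l \<omega>
  proof (rule power_mono)
    have "grid (\<delta> n) l \<in> {t0..T}"
      using grid_in[OF less_imp_le[OF \<delta>] gT, of l n] that by auto
    then show "norm (Y n l \<omega>) \<le> \<delta> n * L"
      using drift_bound[of "grid (\<delta> n) l" "v (grid (\<delta> n) l) \<omega>"] stay_annulus[of \<omega> "grid (\<delta> n) l" "grid (\<delta> n) l"] \<delta>[of n] L_nonneg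
      by (auto simp: Y_def c_def indicator_def mult_left_mono)
  qed simp
  have YM: "Y n l \<in> borel_measurable M" if "l < q * Suc n" for n l
  proof -
    have [measurable]: "v (grid (\<delta> n) l) \<in> borel_measurable M" "stay (grid (\<delta> n) l) \<in> events"
      using meas[of l l n] that measurable_F_M sets_F_M by (metis less_imp_le order_refl)+
    show ?thesis unfolding Y_def c_def by measurable
  qed
  have l_less: "a n + l < q * Suc n" if "l < N n" for n l
    using that aN[of n] by linarith
  have mZ: "mincr (F (grid (\<delta> n) (a n + l))) (Z n (a n + l))"
    "(\<integral>\<omega>. (norm (Z n (a n + l) \<omega>))\<^sup>2 \<partial>M) \<le> 9 * \<delta> n * L\<^sup>2" if "l < N n" for n l
    using mincr_stay_dif[OF \<delta> gT l_less[OF that]] unfolding Z_def c_def by auto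
  have Zsum: "integrable M (\<lambda>\<omega>. (norm (\<Sum>l<N n. Z n (a n + l) \<omega>))\<^sup>2)"
    "(\<integral>\<omega>. (norm (\<Sum>l<N n. Z n (a n + l) \<omega>))\<^sup>2 \<partial>M) = (\<Sum>l<N n. \<integral>\<omega>. (norm (Z n (a n + l) \<omega>))\<^sup>2 \<partial>M)" for n
  proof -
    have "integrable M (\<lambda>\<omega>. (norm (\<Sum>l<N n. Z n (a n + l) \<omega>))\<^sup>2) \<and>
      (\<integral>\<omega>. (norm (\<Sum>l<N n. Z n (a n + l) \<omega>))\<^sup>2 \<partial>M) = (\<Sum>l<N n. \<integral>\<omega>. (norm (Z n (a n + l) \<omega>))\<^sup>2 \<partial>M)"
    proof (rule expectation_mincr_sum[of _ "\<lambda>l. F (grid (\<delta> n) (a n + l))"])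
      show "Z n (a n + i) \<in> borel_measurable (F (grid (\<delta> n) (a n + l)))" if "i < l" "l < N n" for i l
        using that l_less[of l n] by (intro Zm) auto
    qed (rule mZ)
    then show "integrable M (\<lambda>\<omega>. (norm (\<Sum>l<N n. Z n (a n + l) \<omega>))\<^sup>2)"
    "(\<integral>\<omega>. (norm (\<Sum>l<N n. Z n (a n + l) \<omega>))\<^sup>2 \<partial>M) = (\<Sum>l<N n. \<integral>\<omega>. (norm (Z n (a n + l) \<omega>))\<^sup>2 \<partial>M)"
      by auto
  qed
  have Ysum: "(norm (\<Sum>l<N n. Y n (a n + l) \<omega>))\<^sup>2 \<le> (\<tau> * L)\<^sup>2" for n \<omega>
  proof -
    have "(norm (\<Sum>l<N n. Y n (a n + l) \<omega>))\<^sup>2 \<le> real (N n) * (\<Sum>l<N n. (norm (Y n (a n + l) \<omega>))\<^sup>2)"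
      using norm_sum_power2_le[of "\<lambda>l. Y n (a n + l) \<omega>" "{..<N n}"] by simp
    also have "\<dots> \<le> real (N n) * (real (N n) * (\<delta> n * L)\<^sup>2)"
      using sum_bounded_above[of "{..<N n}" "\<lambda>l. (norm (Y n (a n + l) \<omega>))\<^sup>2" "(\<delta> n * L)\<^sup>2"] Yb[OF l_less]
      by (intro mult_left_mono) auto
    also have "\<dots> = ((real (N n) * \<delta> n) * L)\<^sup>2"
      by (simp add: power2_eq_square)
    finally show ?thesis by (simp add: N\<delta>)
  qed
  have YsM: "(\<lambda>\<omega>. \<Sum>l<N n. Y n (a n + l) \<omega>) \<in> borel_measurable M" for n
    by (intro borel_measurable_sum YM l_less) auto
  have Yint: "integrable M (\<lambda>\<omega>. (norm (\<Sum>l<N n. Y n (a n + l) \<omega>))\<^sup>2)" for n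
    by (rule integrable_const_bound[where B="(\<tau> * L)\<^sup>2"]) (use Ysum YsM in auto)
  have ZsM: "(\<lambda>\<omega>. \<Sum>l<N n. Z n (a n + l) \<omega>) \<in> borel_measurable M" for n
    using mZ by (intro borel_measurable_sum) (auto simp: mincr_def)
  show ?thesis
  proof (rule expectation_power2_le_of_conv_in_prob[where X=X and D=D and K="4 * r"])
    show "stay (grid d q) \<in> events" by (rule stay_events) (rule gp)
    show "(\<lambda>\<omega>. v (grid d q) \<omega> - v (grid d p) \<omega>) \<in> borel_measurable M"
      using gp by (intro borel_measurable_diff v_measurable)
    show "D n \<in> borel_measurable M" for n
      unfolding D_def \<delta>_def
      by (intro borel_measurable_add borel_measurable_uminus euler_conv(1) d gp)
    show "(\<lambda>n. prob {\<omega>\<in>space M. e < norm (D n \<omega>)}) \<longlonglongrightarrow> 0" if "e > 0" for e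
      unfolding D_def \<delta>_def
    proof (rule conv_in_prob_add[OF _ _ _ _ that])
      show "(\<lambda>\<omega>. v (grid d q) \<omega> - v0 - (\<Sum>l<q * Suc n. euler_incr (d / real (Suc n)) l \<omega>)) \<in> borel_measurable M"
        "(\<lambda>\<omega>. - (v (grid d p) \<omega> - v0 - (\<Sum>l<p * Suc n. euler_incr (d / real (Suc n)) l \<omega>))) \<in> borel_measurable M" for n
        by (intro borel_measurable_uminus euler_conv(1) d gp)+
    qed (unfold norm_minus_cancel, (rule euler_conv(2)[OF d] euler_conv(2)[OF d(1) gp(1)], assumption)+)
    show "integrable M (\<lambda>\<omega>. (norm (X n \<omega>))\<^sup>2)" for n
      unfolding X_def by (intro integrable_norm_add_power2 YsM ZsM Yint Zsum)
    show "(\<integral>\<omega>. (norm (X n \<omega>))\<^sup>2 \<partial>M) \<le> 2 * (\<tau> * L)\<^sup>2 + 2 * (\<tau> * (9 * L\<^sup>2))" for n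
    proof -
      have "(\<integral>\<omega>. (norm (X n \<omega>))\<^sup>2 \<partial>M) \<le> (\<integral>\<omega>. 2 * (\<tau> * L)\<^sup>2 + 2 * (norm (\<Sum>l<N n. Z n (a n + l) \<omega>))\<^sup>2 \<partial>M)"
      proof (rule integral_mono)
        show "integrable M (\<lambda>\<omega>. (norm (X n \<omega>))\<^sup>2)"
          unfolding X_def by (intro integrable_norm_add_power2 YsM ZsM Yint Zsum)
        show "integrable M (\<lambda>\<omega>. 2 * (\<tau> * L)\<^sup>2 + 2 * (norm (\<Sum>l<N n. Z n (a n + l) \<omega>))\<^sup>2)"
          using Zsum(1) by simp
        show "(norm (X n \<omega>))\<^sup>2 \<le> 2 * (\<tau> * L)\<^sup>2 + 2 * (norm (\<Sum>l<N n. Z n (a n + l) \<omega>))\<^sup>2" for \<omega>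
          unfolding X_def
          using norm_add_power2_le[of "\<Sum>l<N n. Y n (a n + l) \<omega>" "\<Sum>l<N n. Z n (a n + l) \<omega>"] Ysum[of n \<omega>]
          by linarith
      qed
      also have "\<dots> = 2 * (\<tau> * L)\<^sup>2 + 2 * (\<Sum>l<N n. \<integral>\<omega>. (norm (Z n (a n + l) \<omega>))\<^sup>2 \<partial>M)"
        using Zsum by (simp add: prob_space)
      also have "\<dots> \<le> 2 * (\<tau> * L)\<^sup>2 + 2 * (\<Sum>l<N n. 9 * \<delta> n * L\<^sup>2)"
        by (intro add_left_mono mult_left_mono sum_mono mZ) auto
      also have "\<dots> = 2 * (\<tau> * L)\<^sup>2 + 2 * ((real (N n) * \<delta> n) * (9 * L\<^sup>2))"
        by simp
      finally show ?thesis by (simp only: N\<delta>)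
    qed
    fix \<omega> assume \<omega>: "\<omega> \<in> stay (grid d q)"
    have "norm (v (grid d q) \<omega>) \<le> 2 * r" "norm (v (grid d p) \<omega>) \<le> 2 * r"
      using stay_annulus[OF \<omega>, of "grid d q"] stay_annulus[OF \<omega>, of "grid d p"] gp by (auto simp: annulus_def)
    then show "norm (v (grid d q) \<omega> - v (grid d p) \<omega>) \<le> 4 * r"
      using norm_triangle_ineq4[of "v (grid d q) \<omega>" "v (grid d p) \<omega>"] by linarith
    show "v (grid d q) \<omega> - v (grid d p) \<omega> = X n \<omega> + D n \<omega>" for n
    proof -
      have "c n l \<omega> = 1" if "l < q * Suc n" for l
      proof -
        have "grid (\<delta> n) l \<le> grid (\<delta> n) (q * Suc n)" using \<delta>[of n] that by (intro grid_mono) auto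
        also have "\<dots> = grid d q" unfolding \<delta>_def by (rule grid_refine) simp
        finally show ?thesis using \<omega> stay_mono[of "grid (\<delta> n) l" "grid d q"] by (auto simp: c_def)
      qed
      then have "X n \<omega> = (\<Sum>l<N n. euler_incr (\<delta> n) (a n + l) \<omega>)"
        unfolding X_def sum.distrib[symmetric] using l_less
        by (intro sum.cong) (auto simp: Y_def Z_def euler_incr_def)
      then have "(\<Sum>l<q * Suc n. euler_incr (\<delta> n) l \<omega>) = (\<Sum>l<p * Suc n. euler_incr (\<delta> n) l \<omega>) + X n \<omega>"
        using sum_lessThan_add[of "\<lambda>l. euler_incr (\<delta> n) l \<omega>" "a n" "N n"] unfolding aN by (simp add: a_def)
      then show ?thesis by (simp add: D_def)
    qed
  qed
qed

end

section \<open>Mean square of the local error\<close>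

lemma power6_add_le:
  fixes x h :: real
  assumes "0 \<le> x" "0 \<le> h"
  shows "(x + h) ^ 6 \<le> 64 * (x ^ 6 + h ^ 6)"
proof -
  have "(x + h) ^ 6 \<le> (2 * max x h) ^ 6"
    using assms by (intro power_mono) auto
  also have "\<dots> = 64 * (max x h) ^ 6" by (simp add: power_mult_distrib)
  also have "\<dots> \<le> 64 * (x ^ 6 + h ^ 6)"
    using assms by (auto simp: max_def)
  finally show ?thesis .
qed

text \<open>Lagrange's identity, expanded into the centred products
  \<open>w $ i * w $ j - (if i = j then h else 0)\<close> with coefficients that depend on
  \<open>x\<close> alone. The means add up to
  \<open>3 |x|^2 h - |x|^2 h = 2 |x|^2 h\<close>.\<close>

lemma norm_cross_centered:
  fixes x w :: "real^3"
  shows "(norm (x \<times> w))\<^sup>2 - 2 * (norm x)\<^sup>2 * h =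
    (\<Sum>i\<in>UNIV. (norm x)\<^sup>2 * (w $ i * w $ i - h))
    - (\<Sum>i\<in>UNIV. \<Sum>j\<in>UNIV. x $ i * x $ j * (w $ i * w $ j - (if i = j then h else 0)))"
proof -
  have nx: "(norm x)\<^sup>2 = (\<Sum>i\<in>UNIV. x $ i * x $ i)" and nw: "(norm w)\<^sup>2 = (\<Sum>i\<in>UNIV. w $ i * w $ i)"
    unfolding power2_norm_eq_inner inner_vec_def by simp_all
  have 1: "(\<Sum>i\<in>UNIV. (norm x)\<^sup>2 * (w $ i * w $ i - h)) = (norm x)\<^sup>2 * (norm w)\<^sup>2 - 3 * (norm x)\<^sup>2 * h"
    unfolding nw by (simp add: right_diff_distrib sum_subtractf sum_distrib_left)
  have "(x \<bullet> w)\<^sup>2 = (\<Sum>i\<in>UNIV. \<Sum>j\<in>UNIV. x $ i * x $ j * (w $ i * w $ j))"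
    unfolding inner_vec_def power2_eq_square sum_product by (simp add: ac_simps)
  moreover have "(norm x)\<^sup>2 * h = (\<Sum>i\<in>UNIV. \<Sum>j\<in>UNIV. x $ i * x $ j * (if i = j then h else 0))"
    unfolding nx sum_distrib_right by (intro sum.cong refl) (simp add: if_distrib cong: if_cong)
  ultimately have 2: "(\<Sum>i\<in>UNIV. \<Sum>j\<in>UNIV. x $ i * x $ j * (w $ i * w $ j - (if i = j then h else 0)))
      = (x \<bullet> w)\<^sup>2 - (norm x)\<^sup>2 * h"
    by (simp only: right_diff_distrib sum_subtractf)
  show ?thesis
    unfolding 1 2 using norm_cross_dot[of x w] by (simp add: power_mult_distrib)
qed

text \<open>Paired with a test vector the noise is a finite sum of terms \<open>Q * E i j\<close>,
  with \<open>Q\<close> known at time \<open>s\<close> and \<open>E i j\<close> a centred function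
  of the increment. The constant 85 is 81 from the fourth moment of the increment plus 4 from the
  square of the subtracted mean.\<close>

lemma (in wiener) mincr_esec_noise:
  assumes st: "t0 \<le> s" "s < t" "t \<le> T" and r: "r > 0"
    and X: "X \<in> borel_measurable (F s)" "\<And>\<omega>. \<omega> \<in> space M \<Longrightarrow> norm (X \<omega>) = r"
  shows "mincr (F s) (\<lambda>\<omega>. esec_noise (t - s) (W t \<omega> - W s \<omega>) (X \<omega>)) \<and>
    (\<integral>\<omega>. (norm (esec_noise (t - s) (W t \<omega> - W s \<omega>) (X \<omega>)))\<^sup>2 \<partial>M)
      \<le> (Dcoef r / (2 * r ^ 4))\<^sup>2 * r\<^sup>2 * (85 * r ^ 4) * (t - s)\<^sup>2"
proof -
  define w where "w \<omega> = W t \<omega> - W s \<omega>" for \<omega>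
  define h where "h = t - s"
  define \<kappa> where "\<kappa> = Dcoef r / (2 * r ^ 4)"
  define E where "E i j \<omega> = w \<omega> $ i * w \<omega> $ j - (if i = j then h else 0)" for i j :: 3 and \<omega>
  have h: "h > 0" using st by (simp add: h_def)
  have wm [measurable]: "w \<in> borel_measurable M"
    unfolding w_def using st by (intro borel_measurable_diff W_measurable) auto
  note XM [measurable] = measurable_F_M[OF X(1)]
  have Xi: "(\<lambda>\<omega>. X \<omega> $ i) \<in> borel_measurable (F s)" for i
    by (rule measurable_compose[OF X(1)]) (intro borel_measurable_continuous_onI continuous_intros)
  have Xb: "\<bar>X \<omega> $ i\<bar> \<le> r" if "\<omega> \<in> space M" for \<omega> i
    using component_le_norm_cart[of "X \<omega>" i] X(2)[OF that] by simp
  have noise: "esec_noise h (w \<omega>) (X \<omega>) = - (\<kappa> * ((norm (X \<omega> \<times> w \<omega>))\<^sup>2 - 2 * r\<^sup>2 * h)) *\<^sub>R X \<omega>"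
    if "\<omega> \<in> space M" for \<omega>
    by (simp add: esec_noise_def \<kappa>_def X(2)[OF that])
  have nM [measurable]: "(\<lambda>\<omega>. esec_noise h (w \<omega>) (X \<omega>)) \<in> borel_measurable M"
    by measurable
  have le: "(norm (esec_noise h (w \<omega>) (X \<omega>)))\<^sup>2 \<le> \<kappa>\<^sup>2 * r\<^sup>2 * (r ^ 4 * (norm (w \<omega>)) ^ 4 + 4 * r ^ 4 * h\<^sup>2)"
    if \<omega>: "\<omega> \<in> space M" for \<omega>
  proof -
    have "norm (X \<omega> \<times> w \<omega>) \<le> r * norm (w \<omega>)" using norm_cross_le[of "X \<omega>" "w \<omega>"] X(2)[OF \<omega>] by simp
    then have "(norm (X \<omega> \<times> w \<omega>)) ^ 4 \<le> (r * norm (w \<omega>)) ^ 4" by (intro power_mono) auto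
    \<comment> \<open>The mixed term has a favourable sign and is dropped.\<close>
    moreover have "((norm (X \<omega> \<times> w \<omega>))\<^sup>2 - 2 * r\<^sup>2 * h)\<^sup>2
        = (norm (X \<omega> \<times> w \<omega>)) ^ 4 - 4 * (r\<^sup>2 * h * (norm (X \<omega> \<times> w \<omega>))\<^sup>2) + 4 * r ^ 4 * h\<^sup>2"
      by (simp add: power2_eq_square power4_eq_xxxx algebra_simps)
    moreover have "r\<^sup>2 * h * (norm (X \<omega> \<times> w \<omega>))\<^sup>2 \<ge> 0" using h by simp
    ultimately have "((norm (X \<omega> \<times> w \<omega>))\<^sup>2 - 2 * r\<^sup>2 * h)\<^sup>2 \<le> r ^ 4 * (norm (w \<omega>)) ^ 4 + 4 * r ^ 4 * h\<^sup>2"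
      by (simp add: power_mult_distrib)
    then have "\<kappa>\<^sup>2 * r\<^sup>2 * ((norm (X \<omega> \<times> w \<omega>))\<^sup>2 - 2 * r\<^sup>2 * h)\<^sup>2
        \<le> \<kappa>\<^sup>2 * r\<^sup>2 * (r ^ 4 * (norm (w \<omega>)) ^ 4 + 4 * r ^ 4 * h\<^sup>2)"
      by (intro mult_left_mono) auto
    then show ?thesis
      unfolding noise[OF \<omega>] by (simp add: X(2)[OF \<omega>] power_mult_distrib ac_simps)
  qed
  have w4: "integrable M (\<lambda>\<omega>. (norm (w \<omega>)) ^ 4)" "(\<integral>\<omega>. (norm (w \<omega>)) ^ 4 \<partial>M) \<le> 81 * h\<^sup>2"
    using increment_norm_moment[OF st, of 2] by (auto simp: w_def h_def fact_numeral)
  have int: "integrable M (\<lambda>\<omega>. (norm (esec_noise h (w \<omega>) (X \<omega>)))\<^sup>2)"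
  proof (rule Bochner_Integration.integrable_bound)
    show "integrable M (\<lambda>\<omega>. \<kappa>\<^sup>2 * r\<^sup>2 * (r ^ 4 * (norm (w \<omega>)) ^ 4 + 4 * r ^ 4 * h\<^sup>2))"
      using w4(1) by simp
  qed (use le in \<open>auto intro!: AE_I2 order_trans[OF _ abs_ge_self]\<close>)
  have E0: "integrable M (\<lambda>\<omega>. Q \<omega> * E i j \<omega>) \<and> (\<integral>\<omega>. Q \<omega> * E i j \<omega> \<partial>M) = 0"
    if Q: "Q \<in> borel_measurable (F s)" "integrable M Q" for Q i j
  proof -
    let ?g = "\<lambda>x::real^3. x $ i * x $ j - (if i = j then h else 0)"
    have g: "?g \<in> borel_measurable borel"
      by (intro borel_measurable_continuous_onI continuous_intros)
    have gi: "integrable M (\<lambda>\<omega>. ?g (W t \<omega> - W s \<omega>))"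
      by (intro Bochner_Integration.integrable_diff increment_covariance[OF st]) simp
    have "(\<integral>\<omega>. ?g (W t \<omega> - W s \<omega>) \<partial>M) = 0"
      by (subst Bochner_Integration.integral_diff)
        (use increment_covariance[OF st, of i j] in \<open>auto simp: h_def prob_space\<close>)
    then show ?thesis
      using expectation_increment_mult[OF st Q g gi] by (simp add: E_def w_def)
  qed
  have "mincr (F s) (\<lambda>\<omega>. esec_noise h (w \<omega>) (X \<omega>))"
    unfolding mincr_def
  proof (intro conjI ballI impI nM int)
    fix V :: "'a \<Rightarrow> real^3" assume V: "V \<in> borel_measurable (F s)" "integrable M (\<lambda>\<omega>. norm (V \<omega>))"
    note [measurable] = V(1) X(1) Xi
    \<comment> \<open>Scalar factor of the pairing with \<open>V\<close>; integrable because
      \<open>X\<close> has constant norm \<open>r\<close> and \<open>V\<close> is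
      integrable.\<close>
    define P where "P \<omega> = - \<kappa> * (V \<omega> \<bullet> X \<omega>)" for \<omega>
    have PM [measurable]: "P \<in> borel_measurable (F s)" unfolding P_def by measurable
    have Pi: "integrable M P"
    proof (rule Bochner_Integration.integrable_bound)
      show "integrable M (\<lambda>\<omega>. \<bar>\<kappa>\<bar> * (norm (V \<omega>) * r))" using V(2) by simp
      show "AE \<omega> in M. norm (P \<omega>) \<le> norm (\<bar>\<kappa>\<bar> * (norm (V \<omega>) * r))"
      proof (rule AE_I2)
        fix \<omega> assume "\<omega> \<in> space M"
        then show "norm (P \<omega>) \<le> norm (\<bar>\<kappa>\<bar> * (norm (V \<omega>) * r))"
          using Cauchy_Schwarz_ineq2[of "V \<omega>" "X \<omega>"] X(2)[of \<omega>] r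
          by (auto simp: P_def abs_mult intro!: mult_left_mono)
      qed
    qed (rule measurable_F_M[OF PM])
    have Q1: "(\<lambda>\<omega>. P \<omega> * r\<^sup>2) \<in> borel_measurable (F s)" "integrable M (\<lambda>\<omega>. P \<omega> * r\<^sup>2)"
      using Pi by (measurable, simp)
    have Q2: "(\<lambda>\<omega>. P \<omega> * (X \<omega> $ i * X \<omega> $ j)) \<in> borel_measurable (F s)"
      "integrable M (\<lambda>\<omega>. P \<omega> * (X \<omega> $ i * X \<omega> $ j))" for i j
    proof -
      show m: "(\<lambda>\<omega>. P \<omega> * (X \<omega> $ i * X \<omega> $ j)) \<in> borel_measurable (F s)" by measurable
      show "integrable M (\<lambda>\<omega>. P \<omega> * (X \<omega> $ i * X \<omega> $ j))"
      proof (rule Bochner_Integration.integrable_bound[where f="\<lambda>\<omega>. \<bar>P \<omega>\<bar> * (r * r)"])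
        show "AE \<omega> in M. norm (P \<omega> * (X \<omega> $ i * X \<omega> $ j)) \<le> norm (\<bar>P \<omega>\<bar> * (r * r))"
          using Xb r by (auto simp: abs_mult intro!: AE_I2 mult_left_mono mult_mono)
      qed (use Pi measurable_F_M[OF m] in auto)
    qed
    have eq: "V \<omega> \<bullet> esec_noise h (w \<omega>) (X \<omega>) = (\<Sum>i\<in>UNIV. (P \<omega> * r\<^sup>2) * E i i \<omega>)
        - (\<Sum>i\<in>UNIV. \<Sum>j\<in>UNIV. (P \<omega> * (X \<omega> $ i * X \<omega> $ j)) * E i j \<omega>)" if \<omega>: "\<omega> \<in> space M" for \<omega>
    proof -
      have "V \<omega> \<bullet> esec_noise h (w \<omega>) (X \<omega>) = P \<omega> * ((norm (X \<omega> \<times> w \<omega>))\<^sup>2 - 2 * (norm (X \<omega>))\<^sup>2 * h)"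
        unfolding noise[OF \<omega>] by (simp add: P_def X(2)[OF \<omega>])
      also have "\<dots> = (\<Sum>i\<in>UNIV. (P \<omega> * r\<^sup>2) * E i i \<omega>)
        - (\<Sum>i\<in>UNIV. \<Sum>j\<in>UNIV. (P \<omega> * (X \<omega> $ i * X \<omega> $ j)) * E i j \<omega>)"
        by (subst norm_cross_centered) (simp add: X(2)[OF \<omega>] right_diff_distrib sum_distrib_left E_def mult.assoc)
      finally show ?thesis .
    qed
    have i1: "integrable M (\<lambda>\<omega>. \<Sum>i\<in>UNIV. (P \<omega> * r\<^sup>2) * E i i \<omega>)"
      and i2: "integrable M (\<lambda>\<omega>. \<Sum>i\<in>UNIV. \<Sum>j\<in>UNIV. (P \<omega> * (X \<omega> $ i * X \<omega> $ j)) * E i j \<omega>)"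
      using E0[OF Q1] E0[OF Q2] by (auto intro!: Bochner_Integration.integrable_sum)
    show "integrable M (\<lambda>\<omega>. V \<omega> \<bullet> esec_noise h (w \<omega>) (X \<omega>))"
      using Bochner_Integration.integrable_diff[OF i1 i2] by (subst Bochner_Integration.integrable_cong[OF refl eq])
    have "(\<integral>\<omega>. V \<omega> \<bullet> esec_noise h (w \<omega>) (X \<omega>) \<partial>M) =
       (\<integral>\<omega>. (\<Sum>i\<in>UNIV. (P \<omega> * r\<^sup>2) * E i i \<omega>)
        - (\<Sum>i\<in>UNIV. \<Sum>j\<in>UNIV. (P \<omega> * (X \<omega> $ i * X \<omega> $ j)) * E i j \<omega>) \<partial>M)"
      by (intro Bochner_Integration.integral_cong refl eq)
    also have "\<dots> = 0"
      using E0[OF Q1] E0[OF Q2]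
      by (subst Bochner_Integration.integral_diff[OF i1 i2])
        (simp add: Bochner_Integration.integral_sum Bochner_Integration.integrable_sum)
    finally show "(\<integral>\<omega>. V \<omega> \<bullet> esec_noise h (w \<omega>) (X \<omega>) \<partial>M) = 0" .
  qed
  moreover have "(\<integral>\<omega>. (norm (esec_noise h (w \<omega>) (X \<omega>)))\<^sup>2 \<partial>M)
      \<le> \<kappa>\<^sup>2 * r\<^sup>2 * (85 * r ^ 4) * h\<^sup>2"
  proof -
    have "(\<integral>\<omega>. (norm (esec_noise h (w \<omega>) (X \<omega>)))\<^sup>2 \<partial>M)
      \<le> (\<integral>\<omega>. \<kappa>\<^sup>2 * r\<^sup>2 * (r ^ 4 * (norm (w \<omega>)) ^ 4 + 4 * r ^ 4 * h\<^sup>2) \<partial>M)"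
      by (intro integral_mono int le) (use w4(1) in auto)
    also have "\<dots> = \<kappa>\<^sup>2 * r\<^sup>2 * (r ^ 4 * (\<integral>\<omega>. (norm (w \<omega>)) ^ 4 \<partial>M) + 4 * r ^ 4 * h\<^sup>2)"
      using w4(1) by (simp add: prob_space)
    also have "\<dots> \<le> \<kappa>\<^sup>2 * r\<^sup>2 * (r ^ 4 * (81 * h\<^sup>2) + 4 * r ^ 4 * h\<^sup>2)"
      using r by (intro mult_left_mono add_right_mono w4(2)) auto
    also have "\<dots> = \<kappa>\<^sup>2 * r\<^sup>2 * (85 * r ^ 4) * h\<^sup>2" by (simp add: algebra_simps)
    finally show ?thesis .
  qed
  ultimately show ?thesis by (simp add: w_def h_def \<kappa>_def)
qed

context sde
begin

text \<open>The squared pointwise bound is a polynomial in \<open>|w|\<close> and \<open>h\<close>.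
  After taking moments, with constants 9 and 1215, each term contains \<open>h^3\<close>, and
  surplus powers of \<open>h\<close> are replaced by powers of \<open>T - t0\<close>.\<close>

lemma esec_rem_moment:
  assumes st: "t0 \<le> s" "s < t" "t \<le> T"
    and X: "X \<in> borel_measurable M" "\<And>\<omega>. \<omega> \<in> space M \<Longrightarrow> norm (X \<omega>) = r"
  shows "integrable M (\<lambda>\<omega>. (norm (esec_rem B s (t - s) (W t \<omega> - W s \<omega>) (X \<omega>)))\<^sup>2) \<and>
    (\<integral>\<omega>. (norm (esec_rem B s (t - s) (W t \<omega> - W s \<omega>) (X \<omega>)))\<^sup>2 \<partial>M)
      \<le> L\<^sup>2 * (4 * (9 + (T - t0)) + 128 * (1215 + (T - t0) ^ 3)) * (t - s) ^ 3"
proof -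
  define w where "w \<omega> = W t \<omega> - W s \<omega>" for \<omega>
  define h where "h = t - s"
  have h: "h > 0" "h \<le> T - t0" using st by (auto simp: h_def)
  have wm [measurable]: "w \<in> borel_measurable M"
    unfolding w_def using st by (intro borel_measurable_diff W_measurable) auto
  note [measurable] = X(1)
  define b where "b x = L\<^sup>2 * (4 * (x\<^sup>2 + h\<^sup>2) * h\<^sup>2 + 128 * (x ^ 6 + h ^ 6))" for x :: real
  have le: "(norm (esec_rem B s h (w \<omega>) (X \<omega>)))\<^sup>2 \<le> b (norm (w \<omega>))" if \<omega>: "\<omega> \<in> space M" for \<omega>
  proof -
    define x where "x = norm (w \<omega>)"
    have x: "x \<ge> 0" by (simp add: x_def)
    have sq: "(p + q)\<^sup>2 \<le> 2 * p\<^sup>2 + 2 * q\<^sup>2" for p q :: real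
      using norm_add_power2_le[of p q] by simp
    have "norm (esec_rem B s h (w \<omega>) (X \<omega>)) \<le> L * ((x + h) * h + (x + h) ^ 3)"
      unfolding x_def using st h by (intro rem_bound X(2) \<omega>) auto
    then have "(norm (esec_rem B s h (w \<omega>) (X \<omega>)))\<^sup>2 \<le> (L * ((x + h) * h + (x + h) ^ 3))\<^sup>2"
      by (intro power_mono) auto
    also have "\<dots> = L\<^sup>2 * ((x + h) * h + (x + h) ^ 3)\<^sup>2" by (simp add: power_mult_distrib)
    also have "\<dots> \<le> L\<^sup>2 * (2 * ((x + h) * h)\<^sup>2 + 2 * ((x + h) ^ 3)\<^sup>2)"
      by (intro mult_left_mono sq) auto
    also have "\<dots> = L\<^sup>2 * (2 * ((x + h)\<^sup>2 * h\<^sup>2) + 2 * (x + h) ^ 6)"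
      by (simp add: power_mult_distrib flip: power_mult)
    also have "\<dots> \<le> L\<^sup>2 * (2 * ((2 * x\<^sup>2 + 2 * h\<^sup>2) * h\<^sup>2) + 2 * (64 * (x ^ 6 + h ^ 6)))"
      using x h by (intro mult_left_mono add_mono mult_right_mono sq power6_add_le) auto
    also have "\<dots> = b x" by (simp add: b_def algebra_simps)
    finally show ?thesis by (simp add: x_def)
  qed
  have w2: "integrable M (\<lambda>\<omega>. (norm (w \<omega>))\<^sup>2)" "(\<integral>\<omega>. (norm (w \<omega>))\<^sup>2 \<partial>M) \<le> 9 * h"
    using increment_norm_moment[OF st, of 1] by (auto simp: w_def h_def)
  have w6: "integrable M (\<lambda>\<omega>. (norm (w \<omega>)) ^ 6)" "(\<integral>\<omega>. (norm (w \<omega>)) ^ 6 \<partial>M) \<le> 1215 * h ^ 3"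
    using increment_norm_moment[OF st, of 3] by (auto simp: w_def h_def fact_numeral)
  have bi: "integrable M (\<lambda>\<omega>. b (norm (w \<omega>)))"
    unfolding b_def using w2(1) w6(1) by simp
  have int: "integrable M (\<lambda>\<omega>. (norm (esec_rem B s h (w \<omega>) (X \<omega>)))\<^sup>2)"
    by (rule Bochner_Integration.integrable_bound[OF bi])
      (use le in \<open>auto intro!: AE_I2 order_trans[OF _ abs_ge_self]\<close>)
  have "(\<integral>\<omega>. (norm (esec_rem B s h (w \<omega>) (X \<omega>)))\<^sup>2 \<partial>M) \<le> (\<integral>\<omega>. b (norm (w \<omega>)) \<partial>M)"
    by (intro integral_mono int bi le)
  also have "\<dots> = L\<^sup>2 * (4 * ((\<integral>\<omega>. (norm (w \<omega>))\<^sup>2 \<partial>M) + h\<^sup>2) * h\<^sup>2 + 128 * ((\<integral>\<omega>. (norm (w \<omega>)) ^ 6 \<partial>M) + h ^ 6))"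
    unfolding b_def using w2(1) w6(1) by (simp add: prob_space)
  also have "\<dots> \<le> L\<^sup>2 * (4 * (9 * h + h\<^sup>2) * h\<^sup>2 + 128 * (1215 * h ^ 3 + h ^ 6))"
    by (intro mult_left_mono add_mono mult_right_mono w2(2) w6(2)) auto
  also have "\<dots> = L\<^sup>2 * (4 * (9 + h) + 128 * (1215 + h ^ 3)) * h ^ 3"
    by (simp add: algebra_simps eval_nat_numeral)
  also have "\<dots> \<le> L\<^sup>2 * (4 * (9 + (T - t0)) + 128 * (1215 + (T - t0) ^ 3)) * h ^ 3"
    using h by (intro mult_right_mono mult_left_mono add_mono power_mono) auto
  finally show ?thesis using int by (simp add: w_def h_def)
qed

lemma esec_measurable_F:
  assumes "h \<ge> 0" "grid h q \<le> T" "k \<le> q"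
  shows "esec B W t0 h v0 k \<in> borel_measurable (F (grid h k))"
  using assms(3)
proof (induction k)
  case (Suc k)
  have "grid h k \<le> grid h (Suc k)" using assms by (intro grid_mono) auto
  then have [measurable]: "esec B W t0 h v0 k \<in> borel_measurable (F (grid h (Suc k)))"
    using Suc by (intro measurable_F_mono[OF Suc.IH]) auto
  have [measurable]: "dW h k \<in> borel_measurable (F (grid h (Suc k)))"
    using Suc.prems by (intro dW_measurable_F[OF assms(1,2)]) auto
  have "esec B W t0 h v0 (Suc k) = (\<lambda>\<omega>. esec_step h (B (grid h k)) (dW h k \<omega>) (esec B W t0 h v0 k \<omega>))"
    by (simp add: fun_eq_iff dW_def grid_def)
  then show ?case by simp
next
  case 0
  have "esec B W t0 h v0 0 = (\<lambda>_. v0)" by (simp add: fun_eq_iff)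
  then show ?case by simp
qed

end

subsection \<open>Mean square error\<close>

text \<open>With \<open>m\<close> fine steps per coarse step, \<open>l div m\<close> is the coarse
  step that contains the fine step \<open>l\<close>.\<close>

lemma sum_div_blocks:
  fixes g :: "nat \<Rightarrow> 'a::real_vector"
  assumes "m > 0"
  shows "(\<Sum>l<k * m. g (l div m)) = real m *\<^sub>R (\<Sum>i<k. g i)"
proof -
  have "(\<Sum>l<k * m. g (l div m)) = (\<Sum>i<k. \<Sum>l\<in>{i * m..<i * m + m}. g (l div m))"
    by (rule sum.nat_group[symmetric])
  also have "\<dots> = (\<Sum>i<k. \<Sum>l\<in>{i * m..<i * m + m}. g i)"
  proof (intro sum.cong refl)
    fix i l assume "l \<in> {i * m..<i * m + m}"
    then have "l div m = i"
      by (intro div_nat_eqI) (auto simp: algebra_simps)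
    then show "g (l div m) = g i" by simp
  qed
  also have "\<dots> = real m *\<^sub>R (\<Sum>i<k. g i)"
    by (simp add: scaleR_sum_right sum_constant_scaleR)
  finally show ?thesis .
qed

text \<open>Linearity in the noise spreads the noise term of one coarse step over the fine
  increments inside it.\<close>

lemma dif_sum_right: "dif x (\<Sum>i\<in>I. f i) = (\<Sum>i\<in>I. dif x (f i))"
  using linear_sum[OF matrix_vector_mul_linear, of "diffusion x" f I] by (simp add: diffusion_vector_mult)

lemma (in prob_space) integrable_indicator_norm_power2:
  fixes f :: "'a \<Rightarrow> 'b::{second_countable_topology, real_normed_vector}"
  assumes [measurable]: "A \<in> events" "f \<in> borel_measurable M" and "\<And>\<omega>. \<omega> \<in> A \<Longrightarrow> norm (f \<omega>) \<le> K"
  shows "integrable M (\<lambda>\<omega>. indicator A \<omega> * (norm (f \<omega>))\<^sup>2)"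
proof (rule integrable_const_bound[where B="K\<^sup>2"])
  show "AE \<omega> in M. norm (indicator A \<omega> * (norm (f \<omega>))\<^sup>2) \<le> K\<^sup>2"
    using assms(3) by (auto simp: indicator_def intro!: AE_I2 power_mono)
qed measurable

lemma norm_add4_power2_le:
  fixes a b c d :: "'a::real_normed_vector"
  shows "(norm ((a + b) + (- c + - d)))\<^sup>2
    \<le> 4 * ((norm a)\<^sup>2 + (norm b)\<^sup>2 + (norm c)\<^sup>2 + (norm d)\<^sup>2)"
  using norm_add_power2_le[of "a + b" "- c + - d"] norm_add_power2_le[of a b]
    norm_add_power2_le[of "- c" "- d"] unfolding norm_minus_cancel by argo

section \<open>Recursion for the localized error\<close>

context sde
begin

definition err :: "real \<Rightarrow> nat \<Rightarrow> real" where
  "err h k = (\<integral>\<omega>. indicator (stay (grid h k)) \<omega> * (norm (v (grid h k) \<omega> - esec B W t0 h v0 k \<omega>))\<^sup>2 \<partial>M)"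

lemma err_nonneg: "err h k \<ge> 0"
  unfolding err_def by (intro integral_nonneg_AE) auto

text \<open>\<open>c_incr\<close> bounds the mean square movement of the solution per unit time;
  \<open>c_noise\<close> and \<open>c_rem\<close> are the factors of \<open>h^2\<close> and
  \<open>h^3\<close> in the one-step bounds. \<open>c_lip\<close> adds the Lipschitz cost of the
  drift, with the factor \<open>T - t0\<close> of Cauchy-Schwarz, to that of the noise.
  \<open>c_main\<close> collects all sources of order \<open>h\<close>: movement within a step,
  freezing of \<open>B\<close>, noise and remainder.\<close>

definition c_incr :: real where "c_incr = 2 * (2 * (T - t0) * L\<^sup>2 + 18 * L\<^sup>2)"
definition c_noise :: real where "c_noise = (Dcoef r / (2 * r ^ 4))\<^sup>2 * r\<^sup>2 * (85 * r ^ 4)"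
definition c_rem :: real where "c_rem = L\<^sup>2 * (4 * (9 + (T - t0)) + 128 * (1215 + (T - t0) ^ 3))"
definition c_lip :: real where "c_lip = 2 * (T - t0) * L\<^sup>2 + 9 * L\<^sup>2"
definition c_main :: real where
  "c_main = c_lip * (2 * c_incr * (T - t0)) + 2 * (T - t0) ^ 3 * r\<^sup>2 * L\<^sup>2 + (T - t0) * c_noise + (T - t0)\<^sup>2 * c_rem"

lemma const_nonneg: "c_incr \<ge> 0" "c_noise \<ge> 0" "c_rem \<ge> 0" "c_lip \<ge> 0" "c_main \<ge> 0"
proof -
  have pos: "T - t0 \<ge> 0" using t0_less_T by simp
  show "c_rem \<ge> 0"
    unfolding c_rem_def using pos L_nonneg
    by (intro mult_nonneg_nonneg add_nonneg_nonneg zero_le_power) auto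
  moreover show "c_incr \<ge> 0" "c_noise \<ge> 0" "c_lip \<ge> 0"
    using t0_less_T by (auto simp: c_incr_def c_noise_def c_lip_def)
  ultimately show "c_main \<ge> 0"
    using t0_less_T by (auto simp: c_main_def)
qed

lemma solution_increment':
  assumes d: "d > 0" "grid d q \<le> T" and p: "p \<le> q"
  shows "(\<integral>\<omega>. indicator (stay (grid d q)) \<omega> * (norm (v (grid d q) \<omega> - v (grid d p) \<omega>))\<^sup>2 \<partial>M)
    \<le> c_incr * (real (q - p) * d)"
proof -
  define \<tau> where "\<tau> = real (q - p) * d"
  have "real (q - p) * d \<le> real q * d" using d by (intro mult_right_mono) auto
  then have "\<tau> \<le> T - t0" using d(2) unfolding \<tau>_def grid_def by linarith
  moreover have "0 \<le> \<tau>" using d by (simp add: \<tau>_def)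
  ultimately have \<tau>: "0 \<le> \<tau>" "\<tau> \<le> T - t0" by auto
  have "2 * (2 * (\<tau> * L)\<^sup>2 + 2 * (\<tau> * (9 * L\<^sup>2))) = (2 * (2 * \<tau> * L\<^sup>2 + 18 * L\<^sup>2)) * \<tau>"
    by (simp add: power2_eq_square algebra_simps)
  also have "\<dots> \<le> c_incr * \<tau>"
    unfolding c_incr_def using \<tau> by (intro mult_right_mono mult_left_mono add_mono) auto
  finally show ?thesis
    using solution_increment[OF d p] by (simp add: \<tau>_def)
qed

context
  fixes h :: real and k m :: nat
  assumes h: "h > 0" "h \<le> T - t0" and gk: "grid h k \<le> T" and m: "m > 0"
begin

private abbreviation (input) "\<delta> \<equiv> h / real m"
private abbreviation (input) "e i \<equiv> esec B W t0 h v0 i"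

text \<open>Within the coarse step \<open>l div m\<close> the scheme keeps both its iterate and the
  field \<open>B\<close> frozen, whereas the solution is followed on the fine grid.\<close>

definition drift_part :: "nat \<Rightarrow> 'a \<Rightarrow> real^3" where
  "drift_part l \<omega> = indicator (stay (grid \<delta> l)) \<omega> *\<^sub>R
     (\<delta> *\<^sub>R (drift B (grid \<delta> l) (v (grid \<delta> l) \<omega>) - drift B (grid h (l div m)) (e (l div m) \<omega>)))"

definition dif_part :: "nat \<Rightarrow> 'a \<Rightarrow> real^3" where
  "dif_part l \<omega> = indicator (stay (grid \<delta> l)) \<omega> *\<^sub>R
     (dif (v (grid \<delta> l) \<omega>) (dW \<delta> l \<omega>) - dif (e (l div m) \<omega>) (dW \<delta> l \<omega>))"

definition noise_part :: "nat \<Rightarrow> 'a \<Rightarrow> real^3" where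
  "noise_part i \<omega> = esec_noise h (dW h i \<omega>) (e i \<omega>)"

definition rem_part :: "nat \<Rightarrow> 'a \<Rightarrow> real^3" where
  "rem_part i \<omega> = esec_rem B (grid h i) h (dW h i \<omega>) (e i \<omega>)"

text \<open>Defined on the whole space with a cut in each fine term, so that its second moment can
  be computed; it represents the error only where the path stays in the annulus. Noise and remainder
  belong to the scheme, hence the minus signs.\<close>

definition stopped_error :: "'a \<Rightarrow> real^3" where
  "stopped_error \<omega> = ((\<Sum>l<k * m. drift_part l \<omega>) + (\<Sum>l<k * m. dif_part l \<omega>))
     + (- (\<Sum>i<k. noise_part i \<omega>) + - (\<Sum>i<k. rem_part i \<omega>))"

private lemma \<delta>: "\<delta> > 0" using h m by simp

private lemma g\<delta>: "grid \<delta> (i * m) = grid h i" using m by (rule grid_refine)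

private lemma gT: "grid \<delta> (k * m) \<le> T" using gk g\<delta> by simp

private lemma kh: "real k * h \<le> T - t0" using gk by (simp add: grid_def)

private lemma block:
  assumes "l < k * m"
  shows "l div m < k" "grid h (l div m) \<le> grid \<delta> l" "grid \<delta> l - grid h (l div m) \<le> h"
    "real (l - (l div m) * m) * \<delta> \<le> h" "(l div m) * m \<le> l" "grid \<delta> l \<in> {t0..T}" "grid h (l div m) \<in> {t0..T}"
proof -
  show 1: "l div m < k" using assms by (simp add: less_mult_imp_div_less)
  show 5: "(l div m) * m \<le> l" by simp
  show "grid h (l div m) \<le> grid \<delta> l"
    using grid_mono[of \<delta> "(l div m) * m" l] \<delta> 5 g\<delta> by simp
  have "real (l - (l div m) * m) \<le> real m"
    using m by (simp add: minus_div_mult_eq_mod less_imp_le)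
  then have "real (l - (l div m) * m) * \<delta> \<le> real m * \<delta>"
    using \<delta> by (intro mult_right_mono) auto
  then show 4: "real (l - (l div m) * m) * \<delta> \<le> h" using m by simp
  have "grid \<delta> l - grid \<delta> ((l div m) * m) = real (l - (l div m) * m) * \<delta>"
    using 5 by (simp only: grid_def of_nat_diff[OF 5] left_diff_distrib)
  then show "grid \<delta> l - grid h (l div m) \<le> h" using 4 g\<delta> by simp
  show "grid \<delta> l \<in> {t0..T}" using grid_in[OF less_imp_le[OF \<delta>] gT, of l] assms by simp
  show "grid h (l div m) \<in> {t0..T}" using grid_in[OF less_imp_le[OF h(1)] gk, of "l div m"] 1 by simp
qed

private lemma eM_F: "i \<le> k \<Longrightarrow> grid h i \<le> t \<Longrightarrow> e i \<in> borel_measurable (F t)"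
  using esec_measurable_F[OF less_imp_le[OF h(1)] gk, of i] measurable_F_mono by blast

private lemma eM: "i \<le> k \<Longrightarrow> e i \<in> borel_measurable M"
  using eM_F measurable_F_M by blast

private lemma norm_e: "norm (e i \<omega>) = r"
  by (simp add: norm_v0)

text \<open>Insert the solution at the start of the coarse step. Its movement since then takes at
  most time \<open>h\<close>; the rest is \<open>err\<close>, because staying up to the fine time
  implies staying up to the coarse one.\<close>

private lemma block_error:
  assumes l: "l < k * m"
  shows "integrable M (\<lambda>\<omega>. indicator (stay (grid \<delta> l)) \<omega> * (norm (v (grid \<delta> l) \<omega> - e (l div m) \<omega>))\<^sup>2)"
    and "(\<integral>\<omega>. indicator (stay (grid \<delta> l)) \<omega> * (norm (v (grid \<delta> l) \<omega> - e (l div m) \<omega>))\<^sup>2 \<partial>M)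
    \<le> 2 * (c_incr * h) + 2 * err h (l div m)"
proof -
  define i where "i = l div m"
  note b = block[OF l, folded i_def]
  define s where "s = grid \<delta> l"
  define t where "t = grid h i"
  have st: "t \<le> s" "s \<in> {t0..T}" "t \<in> {t0..T}" using b by (auto simp: s_def t_def)
  note [measurable] = v_measurable[OF st(2)] v_measurable[OF st(3)] stay_events[OF st(2)] stay_events[OF st(3)]
    eM[OF less_imp_le[OF b(1)]]
  have bd: "norm (v s \<omega>) \<le> 2 * r" "norm (v t \<omega>) \<le> 2 * r" if "\<omega> \<in> stay s" for \<omega>
    using stay_annulus[OF that, of s] stay_annulus[OF that, of t] st by (auto simp: annulus_def)
  have bd': "norm (v t \<omega>) \<le> 2 * r" if "\<omega> \<in> stay t" for \<omega>
    using stay_annulus[OF that, of t] st by (auto simp: annulus_def)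
  have i1: "integrable M (\<lambda>\<omega>. indicator (stay s) \<omega> * (norm (v s \<omega> - e i \<omega>))\<^sup>2)"
    by (rule integrable_indicator_norm_power2[where K="2 * r + r"])
      (use bd norm_e in \<open>auto intro!: order_trans[OF norm_triangle_ineq4] add_mono simp: norm_v0\<close>)
  have i2: "integrable M (\<lambda>\<omega>. indicator (stay s) \<omega> * (norm (v s \<omega> - v t \<omega>))\<^sup>2)"
  proof (rule integrable_indicator_norm_power2)
    show "norm (v s \<omega> - v t \<omega>) \<le> 2 * r + 2 * r" if "\<omega> \<in> stay s" for \<omega>
      using bd[OF that] by (intro order_trans[OF norm_triangle_ineq4] add_mono)
  qed measurable
  have i3: "integrable M (\<lambda>\<omega>. indicator (stay t) \<omega> * (norm (v t \<omega> - e i \<omega>))\<^sup>2)"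
    by (rule integrable_indicator_norm_power2[where K="2 * r + r"])
      (use bd' norm_e in \<open>auto intro!: order_trans[OF norm_triangle_ineq4] add_mono simp: norm_v0\<close>)
  have "(\<integral>\<omega>. indicator (stay s) \<omega> * (norm (v s \<omega> - e i \<omega>))\<^sup>2 \<partial>M)
    \<le> (\<integral>\<omega>. 2 * (indicator (stay s) \<omega> * (norm (v s \<omega> - v t \<omega>))\<^sup>2)
        + 2 * (indicator (stay t) \<omega> * (norm (v t \<omega> - e i \<omega>))\<^sup>2) \<partial>M)"
  proof (rule integral_mono[OF i1])
    show "integrable M (\<lambda>\<omega>. 2 * (indicator (stay s) \<omega> * (norm (v s \<omega> - v t \<omega>))\<^sup>2)
        + 2 * (indicator (stay t) \<omega> * (norm (v t \<omega> - e i \<omega>))\<^sup>2))"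
      using i2 i3 by simp
    show "indicator (stay s) \<omega> * (norm (v s \<omega> - e i \<omega>))\<^sup>2
      \<le> 2 * (indicator (stay s) \<omega> * (norm (v s \<omega> - v t \<omega>))\<^sup>2)
        + 2 * (indicator (stay t) \<omega> * (norm (v t \<omega> - e i \<omega>))\<^sup>2)" for \<omega>
      using norm_add_power2_le[of "v s \<omega> - v t \<omega>" "v t \<omega> - e i \<omega>"] stay_mono[OF st(1)]
      by (auto simp: indicator_def)
  qed
  also have "\<dots> = 2 * (\<integral>\<omega>. indicator (stay s) \<omega> * (norm (v s \<omega> - v t \<omega>))\<^sup>2 \<partial>M) + 2 * err h i"
    using i2 i3 by (simp add: err_def t_def)
  also have "(\<integral>\<omega>. indicator (stay s) \<omega> * (norm (v s \<omega> - v t \<omega>))\<^sup>2 \<partial>M) \<le> c_incr * h"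
  proof -
    have "(\<integral>\<omega>. indicator (stay s) \<omega> * (norm (v s \<omega> - v t \<omega>))\<^sup>2 \<partial>M) \<le> c_incr * (real (l - i * m) * \<delta>)"
      using solution_increment'[OF \<delta> _ b(5)] b(6) g\<delta>[of i] by (simp add: s_def t_def)
    also have "\<dots> \<le> c_incr * h" using b(4) const_nonneg(1) by (intro mult_left_mono)
    finally show ?thesis .
  qed
  finally show "(\<integral>\<omega>. indicator (stay (grid \<delta> l)) \<omega> * (norm (v (grid \<delta> l) \<omega> - e (l div m) \<omega>))\<^sup>2 \<partial>M)
    \<le> 2 * (c_incr * h) + 2 * err h (l div m)"
    by (simp add: s_def i_def)
  show "integrable M (\<lambda>\<omega>. indicator (stay (grid \<delta> l)) \<omega> * (norm (v (grid \<delta> l) \<omega> - e (l div m) \<omega>))\<^sup>2)"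
    using i1 by (simp add: s_def i_def)
qed

private definition "\<beta> i = 2 * (c_incr * h) + 2 * err h i"

private lemma sum_\<beta>: "h * (\<Sum>i<k. \<beta> i) \<le> h * (2 * c_incr * (T - t0) + 2 * (\<Sum>i<k. err h i))"
proof -
  have "(\<Sum>i<k. \<beta> i) = 2 * c_incr * (real k * h) + 2 * (\<Sum>i<k. err h i)"
    by (simp add: \<beta>_def sum.distrib sum_distrib_left)
  also have "\<dots> \<le> 2 * c_incr * (T - t0) + 2 * (\<Sum>i<k. err h i)"
    using kh const_nonneg(1) by (intro add_right_mono mult_left_mono) auto
  finally show ?thesis using h by (intro mult_left_mono) auto
qed

private lemma drift_part_measurable: "l < k * m \<Longrightarrow> drift_part l \<in> borel_measurable M"
proof -
  assume l: "l < k * m"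
  note b = block[OF l]
  note [measurable] = v_measurable[OF b(6)] stay_events[OF b(6)] eM[OF less_imp_le[OF b(1)]]
  show ?thesis unfolding drift_part_def by measurable
qed

private lemma drift_part_le:
  assumes l: "l < k * m" and \<omega>: "\<omega> \<in> space M"
  shows "(norm (drift_part l \<omega>))\<^sup>2 \<le> \<delta>\<^sup>2 * (2 * L\<^sup>2 * (indicator (stay (grid \<delta> l)) \<omega> *
    (norm (v (grid \<delta> l) \<omega> - e (l div m) \<omega>))\<^sup>2) + 2 * r\<^sup>2 * L\<^sup>2 * h\<^sup>2)"
proof (cases "\<omega> \<in> stay (grid \<delta> l)")
  case True
  define i where "i = l div m"
  note b = block[OF l, folded i_def]
  let ?x = "v (grid \<delta> l) \<omega>" and ?s = "grid \<delta> l" and ?t = "grid h i"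
  have ea: "e i \<omega> \<in> annulus r" using r_pos norm_e by (auto simp: annulus_def norm_v0)
  have xa: "?x \<in> annulus r" using stay_annulus[OF True, of ?s] b(6) by auto
  \<comment> \<open>First change the state at fixed time, then the time at fixed state; only the
    magnetic term depends on time, and the iterate has norm \<open>r\<close>.\<close>
  have "drift B ?s ?x - drift B ?t (e i \<omega>)
    = (drift B ?s ?x - drift B ?s (e i \<omega>)) + e i \<omega> \<times> (B ?s - B ?t)"
    by (simp add: drift_eq Cross3.right_diff_distrib)
  then have "(norm (drift B ?s ?x - drift B ?t (e i \<omega>)))\<^sup>2
     \<le> 2 * (norm (drift B ?s ?x - drift B ?s (e i \<omega>)))\<^sup>2 + 2 * (norm (e i \<omega> \<times> (B ?s - B ?t)))\<^sup>2"
    by (simp only: norm_add_power2_le)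
  also have "\<dots> \<le> 2 * (L * norm (?x - e i \<omega>))\<^sup>2 + 2 * (r * (L * h))\<^sup>2"
  proof (intro add_mono mult_left_mono power_mono)
    show "norm (drift B ?s ?x - drift B ?s (e i \<omega>)) \<le> L * norm (?x - e i \<omega>)"
      using drift_L[OF b(6) xa ea] .
    have "norm (B ?s - B ?t) \<le> L * \<bar>?s - ?t\<bar>" by (rule B_Lipschitz[OF b(6,7)])
    also have "\<dots> \<le> L * h" using b(2,3) L_nonneg by (intro mult_left_mono) auto
    finally have "norm (B ?s - B ?t) \<le> L * h" .
    then have "norm (e i \<omega>) * norm (B ?s - B ?t) \<le> r * (L * h)"
      using r_pos by (simp add: norm_v0)
    then show "norm (e i \<omega> \<times> (B ?s - B ?t)) \<le> r * (L * h)"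
      using norm_cross_le order_trans by blast
  qed auto
  finally have "\<delta>\<^sup>2 * (norm (drift B ?s ?x - drift B ?t (e i \<omega>)))\<^sup>2
    \<le> \<delta>\<^sup>2 * (2 * (L * norm (?x - e i \<omega>))\<^sup>2 + 2 * (r * (L * h))\<^sup>2)"
    by (rule mult_left_mono) simp
  moreover have "(norm (drift_part l \<omega>))\<^sup>2 = \<delta>\<^sup>2 * (norm (drift B ?s ?x - drift B ?t (e i \<omega>)))\<^sup>2"
    using True \<delta> by (simp add: drift_part_def i_def power_mult_distrib power_divide)
  ultimately show ?thesis
    using True by (simp add: i_def power_mult_distrib ac_simps)
next
  case False
  then show ?thesis by (simp add: drift_part_def)
qed

text \<open>These terms are not centred, so Cauchy-Schwarz costs the number \<open>k m\<close> of
  terms. With \<open>m\<close> terms per block and \<open>\<delta>^2\<close> in each, the product is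
  \<open>(k h) h\<close>, free of \<open>m\<close>.\<close>

private lemma drift_part_sum:
  "integrable M (\<lambda>\<omega>. (norm (\<Sum>l<k * m. drift_part l \<omega>))\<^sup>2)"
  "(\<integral>\<omega>. (norm (\<Sum>l<k * m. drift_part l \<omega>))\<^sup>2 \<partial>M) \<le>
     2 * (T - t0) * L\<^sup>2 * (h * (\<Sum>i<k. \<beta> i)) + 2 * (T - t0) ^ 3 * r\<^sup>2 * L\<^sup>2 * h"
proof -
  let ?b = "\<lambda>l \<omega>. \<delta>\<^sup>2 * (2 * L\<^sup>2 * (indicator (stay (grid \<delta> l)) \<omega> *
    (norm (v (grid \<delta> l) \<omega> - e (l div m) \<omega>))\<^sup>2) + 2 * r\<^sup>2 * L\<^sup>2 * h\<^sup>2)"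
  have B0: "0 \<le> (\<Sum>i<k. \<beta> i)"
    using h const_nonneg err_nonneg by (intro sum_nonneg) (auto simp: \<beta>_def)
  have bi: "integrable M (?b l)" if "l < k * m" for l
    using block_error(1)[OF that]
    by (intro integrable_mult_right Bochner_Integration.integrable_add integrable_const)
  have int: "integrable M (\<lambda>\<omega>. (norm (drift_part l \<omega>))\<^sup>2)" if l: "l < k * m" for l
    by (rule Bochner_Integration.integrable_bound[OF bi[OF l]])
      (use drift_part_le[OF l] drift_part_measurable[OF l] in \<open>auto intro!: AE_I2 order_trans[OF _ abs_ge_self]\<close>)
  show sint: "integrable M (\<lambda>\<omega>. (norm (\<Sum>l<k * m. drift_part l \<omega>))\<^sup>2)"
    using int drift_part_measurable by (intro integrable_norm_sum_power2) auto
  have each: "(\<integral>\<omega>. (norm (drift_part l \<omega>))\<^sup>2 \<partial>M) \<le> \<delta>\<^sup>2 * (2 * L\<^sup>2 * \<beta> (l div m) + 2 * r\<^sup>2 * L\<^sup>2 * h\<^sup>2)"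
    if l: "l < k * m" for l
  proof -
    have "(\<integral>\<omega>. (norm (drift_part l \<omega>))\<^sup>2 \<partial>M) \<le> (\<integral>\<omega>. ?b l \<omega> \<partial>M)"
      by (intro integral_mono int bi l drift_part_le)
    also have "\<dots> = \<delta>\<^sup>2 * (2 * L\<^sup>2 * (\<integral>\<omega>. indicator (stay (grid \<delta> l)) \<omega> *
      (norm (v (grid \<delta> l) \<omega> - e (l div m) \<omega>))\<^sup>2 \<partial>M) + 2 * r\<^sup>2 * L\<^sup>2 * h\<^sup>2)"
      using block_error(1)[OF l] by (simp add: prob_space)
    also have "\<dots> \<le> \<delta>\<^sup>2 * (2 * L\<^sup>2 * \<beta> (l div m) + 2 * r\<^sup>2 * L\<^sup>2 * h\<^sup>2)"
      unfolding \<beta>_def by (intro mult_left_mono add_right_mono block_error(2)[OF l]) auto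
    finally show ?thesis .
  qed
  have "(\<integral>\<omega>. (norm (\<Sum>l<k * m. drift_part l \<omega>))\<^sup>2 \<partial>M)
     \<le> (\<integral>\<omega>. real (k * m) * (\<Sum>l<k * m. (norm (drift_part l \<omega>))\<^sup>2) \<partial>M)"
  proof (rule integral_mono[OF sint])
    show "integrable M (\<lambda>\<omega>. real (k * m) * (\<Sum>l<k * m. (norm (drift_part l \<omega>))\<^sup>2))"
      using int by (intro integrable_mult_right Bochner_Integration.integrable_sum) auto
    show "(norm (\<Sum>l<k * m. drift_part l \<omega>))\<^sup>2 \<le> real (k * m) * (\<Sum>l<k * m. (norm (drift_part l \<omega>))\<^sup>2)" for \<omega>
      using norm_sum_power2_le[of "\<lambda>l. drift_part l \<omega>" "{..<k * m}"] by simp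
  qed
  also have "\<dots> = real (k * m) * (\<Sum>l<k * m. \<integral>\<omega>. (norm (drift_part l \<omega>))\<^sup>2 \<partial>M)"
    using int by (subst integral_mult_right_zero, subst Bochner_Integration.integral_sum) auto
  also have "\<dots> \<le> real (k * m) * (\<Sum>l<k * m. \<delta>\<^sup>2 * (2 * L\<^sup>2 * \<beta> (l div m) + 2 * r\<^sup>2 * L\<^sup>2 * h\<^sup>2))"
    by (intro mult_left_mono sum_mono each) auto
  also have "\<dots> = real (k * m) * (real m * (\<Sum>i<k. \<delta>\<^sup>2 * (2 * L\<^sup>2 * \<beta> i + 2 * r\<^sup>2 * L\<^sup>2 * h\<^sup>2)))"
    using sum_div_blocks[OF m, of "\<lambda>i. \<delta>\<^sup>2 * (2 * L\<^sup>2 * \<beta> i + 2 * r\<^sup>2 * L\<^sup>2 * h\<^sup>2)" k] by simp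
  also have "\<dots> = (real k * h) * (h * (\<Sum>i<k. 2 * L\<^sup>2 * \<beta> i + 2 * r\<^sup>2 * L\<^sup>2 * h\<^sup>2))"
    unfolding sum_distrib_left[symmetric] using m by (simp add: power2_eq_square)
  also have "\<dots> = (real k * h) * (2 * L\<^sup>2 * (h * (\<Sum>i<k. \<beta> i))) + (real k * h) * ((real k * h) * (2 * r\<^sup>2 * L\<^sup>2 * h\<^sup>2))"
    by (simp add: sum.distrib sum_distrib_left[symmetric] algebra_simps)
  also have "\<dots> \<le> (T - t0) * (2 * L\<^sup>2 * (h * (\<Sum>i<k. \<beta> i)))
      + (T - t0) * ((T - t0) * (2 * r\<^sup>2 * L\<^sup>2 * ((T - t0) * h)))"
  proof (intro add_mono mult_mono kh mult_left_mono)
    show "0 \<le> 2 * L\<^sup>2 * (h * (\<Sum>i<k. \<beta> i))"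
      using h B0 by simp
    show "h\<^sup>2 \<le> (T - t0) * h" using h by (simp add: power2_eq_square)
  qed (use h t0_less_T B0 in auto)
  also have "\<dots> = 2 * (T - t0) * L\<^sup>2 * (h * (\<Sum>i<k. \<beta> i)) + 2 * (T - t0) ^ 3 * r\<^sup>2 * L\<^sup>2 * h"
    by (simp add: power3_eq_cube algebra_simps)
  finally show "(\<integral>\<omega>. (norm (\<Sum>l<k * m. drift_part l \<omega>))\<^sup>2 \<partial>M) \<le>
     2 * (T - t0) * L\<^sup>2 * (h * (\<Sum>i<k. \<beta> i)) + 2 * (T - t0) ^ 3 * r\<^sup>2 * L\<^sup>2 * h" .
qed

text \<open>Orthogonality adds the second moments without a counting factor: \<open>m\<close> terms
  with factor \<open>9 \<delta>\<close> make \<open>9 h\<close> per coarse step, again free of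
  \<open>m\<close>.\<close>

private lemma dif_part_sum:
  "integrable M (\<lambda>\<omega>. (norm (\<Sum>l<k * m. dif_part l \<omega>))\<^sup>2)"
  "(\<integral>\<omega>. (norm (\<Sum>l<k * m. dif_part l \<omega>))\<^sup>2 \<partial>M) \<le> 9 * L\<^sup>2 * (h * (\<Sum>i<k. \<beta> i))"
  "l < k * m \<Longrightarrow> dif_part l \<in> borel_measurable M"
proof -
  have eF: "e (l div m) \<in> borel_measurable (F (grid \<delta> l'))" if "l \<le> l'" "l < k * m" for l l'
  proof -
    have "grid \<delta> l \<le> grid \<delta> l'" using that \<delta> by (intro grid_mono) auto
    then show ?thesis using block[OF that(2)] by (intro eM_F) auto
  qed
  have mi: "mincr (F (grid \<delta> l)) (dif_part l)"
    and each: "(\<integral>\<omega>. (norm (dif_part l \<omega>))\<^sup>2 \<partial>M) \<le> 9 * \<delta> * (L\<^sup>2 * \<beta> (l div m))" if l: "l < k * m" for l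
  proof -
    note * = mincr_stay_dif_diff[OF \<delta> gT l eF[OF order_refl l] norm_e]
    show "mincr (F (grid \<delta> l)) (dif_part l)" using *(1) unfolding dif_part_def .
    have "(\<integral>\<omega>. (norm (dif_part l \<omega>))\<^sup>2 \<partial>M) \<le> 9 * \<delta> * (L\<^sup>2 * (\<integral>\<omega>. indicator (stay (grid \<delta> l)) \<omega> * (norm (v (grid \<delta> l) \<omega> - e (l div m) \<omega>))\<^sup>2 \<partial>M))"
      using *(2) unfolding dif_part_def .
    also have "\<dots> \<le> 9 * \<delta> * (L\<^sup>2 * \<beta> (l div m))"
      unfolding \<beta>_def using \<delta> by (intro mult_left_mono block_error(2)[OF l]) auto
    finally show "(\<integral>\<omega>. (norm (dif_part l \<omega>))\<^sup>2 \<partial>M) \<le> 9 * \<delta> * (L\<^sup>2 * \<beta> (l div m))" .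
  qed
  then show "l < k * m \<Longrightarrow> dif_part l \<in> borel_measurable M" by (auto simp: mincr_def)
  have *: "integrable M (\<lambda>\<omega>. (norm (\<Sum>l<k * m. dif_part l \<omega>))\<^sup>2) \<and>
    (\<integral>\<omega>. (norm (\<Sum>l<k * m. dif_part l \<omega>))\<^sup>2 \<partial>M) = (\<Sum>l<k * m. \<integral>\<omega>. (norm (dif_part l \<omega>))\<^sup>2 \<partial>M)"
  proof (rule expectation_mincr_sum[of _ "\<lambda>l. F (grid \<delta> l)"])
    fix l l' assume l: "l < l'" "l' < k * m"
    have [measurable]: "v (grid \<delta> l) \<in> borel_measurable (F (grid \<delta> l'))" "stay (grid \<delta> l) \<in> sets (F (grid \<delta> l'))"
      "dW \<delta> l \<in> borel_measurable (F (grid \<delta> l'))" "e (l div m) \<in> borel_measurable (F (grid \<delta> l'))"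
      using v_grid_measurable_F[OF less_imp_le[OF \<delta>] gT, of l l'] stay_grid_F[OF less_imp_le[OF \<delta>] gT, of l l']
        dW_measurable_F[OF less_imp_le[OF \<delta>] gT, of l l'] eF[of l l'] l by auto
    show "dif_part l \<in> borel_measurable (F (grid \<delta> l'))" unfolding dif_part_def by measurable
  qed (rule mi)
  then show "integrable M (\<lambda>\<omega>. (norm (\<Sum>l<k * m. dif_part l \<omega>))\<^sup>2)" by simp
  have "(\<integral>\<omega>. (norm (\<Sum>l<k * m. dif_part l \<omega>))\<^sup>2 \<partial>M) \<le> (\<Sum>l<k * m. 9 * \<delta> * (L\<^sup>2 * \<beta> (l div m)))"
    unfolding conjunct2[OF *] by (intro sum_mono each) auto
  also have "\<dots> = real m * (\<Sum>i<k. 9 * \<delta> * (L\<^sup>2 * \<beta> i))"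
    using sum_div_blocks[OF m, of "\<lambda>i. 9 * \<delta> * (L\<^sup>2 * \<beta> i)" k] by simp
  also have "\<dots> = 9 * L\<^sup>2 * (h * (\<Sum>i<k. \<beta> i))"
    using m by (simp add: sum_distrib_left ac_simps)
  finally show "(\<integral>\<omega>. (norm (\<Sum>l<k * m. dif_part l \<omega>))\<^sup>2 \<partial>M) \<le> 9 * L\<^sup>2 * (h * (\<Sum>i<k. \<beta> i))" .
qed

private lemma coarse:
  assumes "i < k"
  shows "t0 \<le> grid h i" "grid h i < grid h (Suc i)" "grid h (Suc i) \<le> T" "grid h (Suc i) - grid h i = h"
  using grid_in[OF less_imp_le[OF h(1)] gk, of i] grid_in[OF less_imp_le[OF h(1)] gk, of "Suc i"] assms h
  by (auto simp: grid_def algebra_simps)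

text \<open>Centring is essential: \<open>k\<close> orthogonal terms of mean square
  \<open>h^2\<close> add up to order \<open>h\<close>, while Cauchy-Schwarz would give
  \<open>k^2 h^2\<close>, of order 1.\<close>

private lemma noise_part_sum:
  "integrable M (\<lambda>\<omega>. (norm (\<Sum>i<k. noise_part i \<omega>))\<^sup>2)"
  "(\<integral>\<omega>. (norm (\<Sum>i<k. noise_part i \<omega>))\<^sup>2 \<partial>M) \<le> (T - t0) * c_noise * h"
  "i < k \<Longrightarrow> noise_part i \<in> borel_measurable M"
proof -
  have mi: "mincr (F (grid h i)) (noise_part i)"
    and each: "(\<integral>\<omega>. (norm (noise_part i \<omega>))\<^sup>2 \<partial>M) \<le> c_noise * h\<^sup>2" if i: "i < k" for i
    using mincr_esec_noise[OF coarse(1-3)[OF i] r_pos eM_F[OF less_imp_le[OF i] order_refl] norm_e]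
    unfolding coarse(4)[OF i] by (auto simp: noise_part_def[abs_def] dW_def c_noise_def)
  then show "i < k \<Longrightarrow> noise_part i \<in> borel_measurable M" by (auto simp: mincr_def)
  have *: "integrable M (\<lambda>\<omega>. (norm (\<Sum>i<k. noise_part i \<omega>))\<^sup>2) \<and>
    (\<integral>\<omega>. (norm (\<Sum>i<k. noise_part i \<omega>))\<^sup>2 \<partial>M) = (\<Sum>i<k. \<integral>\<omega>. (norm (noise_part i \<omega>))\<^sup>2 \<partial>M)"
  proof (rule expectation_mincr_sum[of _ "\<lambda>i. F (grid h i)"])
    fix i j assume ij: "i < j" "j < k"
    have "grid h i \<le> grid h j" using ij h by (intro grid_mono) auto
    then have [measurable]: "dW h i \<in> borel_measurable (F (grid h j))" "e i \<in> borel_measurable (F (grid h j))"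
      using dW_measurable_F[OF less_imp_le[OF h(1)] gk, of i j] eM_F[of i "grid h j"] ij by auto
    show "noise_part i \<in> borel_measurable (F (grid h j))" unfolding noise_part_def by measurable
  qed (rule mi)
  then show "integrable M (\<lambda>\<omega>. (norm (\<Sum>i<k. noise_part i \<omega>))\<^sup>2)" by simp
  have "(\<integral>\<omega>. (norm (\<Sum>i<k. noise_part i \<omega>))\<^sup>2 \<partial>M) \<le> (\<Sum>i<k. c_noise * h\<^sup>2)"
    unfolding conjunct2[OF *] by (intro sum_mono each) auto
  also have "\<dots> = (real k * h) * (c_noise * h)" by (simp add: power2_eq_square)
  also have "\<dots> \<le> (T - t0) * (c_noise * h)"
    using h const_nonneg by (intro mult_right_mono kh) auto
  finally show "(\<integral>\<omega>. (norm (\<Sum>i<k. noise_part i \<omega>))\<^sup>2 \<partial>M) \<le> (T - t0) * c_noise * h" by simp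
qed

text \<open>No centring is available, but Cauchy-Schwarz suffices at this order:
  \<open>k^2 h^3 = (k h)^2 h\<close>.\<close>

private lemma rem_part_sum:
  "integrable M (\<lambda>\<omega>. (norm (\<Sum>i<k. rem_part i \<omega>))\<^sup>2)"
  "(\<integral>\<omega>. (norm (\<Sum>i<k. rem_part i \<omega>))\<^sup>2 \<partial>M) \<le> (T - t0)\<^sup>2 * c_rem * h"
  "i < k \<Longrightarrow> rem_part i \<in> borel_measurable M"
proof -
  have int: "integrable M (\<lambda>\<omega>. (norm (rem_part i \<omega>))\<^sup>2)"
    and each: "(\<integral>\<omega>. (norm (rem_part i \<omega>))\<^sup>2 \<partial>M) \<le> c_rem * h ^ 3" if i: "i < k" for i
    using esec_rem_moment[OF coarse(1-3)[OF i] eM[OF less_imp_le[OF i]] norm_e]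
    unfolding coarse(4)[OF i] by (auto simp: rem_part_def[abs_def] dW_def c_rem_def)
  show meas: "i < k \<Longrightarrow> rem_part i \<in> borel_measurable M" for i
  proof -
    assume i: "i < k"
    have [measurable]: "dW h i \<in> borel_measurable M" "e i \<in> borel_measurable M"
      using dW_measurable[OF less_imp_le[OF h(1)] gk i] eM[of i] i by auto
    show ?thesis unfolding rem_part_def by measurable
  qed
  show sint: "integrable M (\<lambda>\<omega>. (norm (\<Sum>i<k. rem_part i \<omega>))\<^sup>2)"
    using int meas by (intro integrable_norm_sum_power2) auto
  have "(\<integral>\<omega>. (norm (\<Sum>i<k. rem_part i \<omega>))\<^sup>2 \<partial>M) \<le> (\<integral>\<omega>. real k * (\<Sum>i<k. (norm (rem_part i \<omega>))\<^sup>2) \<partial>M)"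
  proof (rule integral_mono[OF sint])
    show "integrable M (\<lambda>\<omega>. real k * (\<Sum>i<k. (norm (rem_part i \<omega>))\<^sup>2))"
      using int by (intro integrable_mult_right Bochner_Integration.integrable_sum) auto
    show "(norm (\<Sum>i<k. rem_part i \<omega>))\<^sup>2 \<le> real k * (\<Sum>i<k. (norm (rem_part i \<omega>))\<^sup>2)" for \<omega>
      using norm_sum_power2_le[of "\<lambda>i. rem_part i \<omega>" "{..<k}"] by simp
  qed
  also have "\<dots> = real k * (\<Sum>i<k. \<integral>\<omega>. (norm (rem_part i \<omega>))\<^sup>2 \<partial>M)"
    using int by (subst integral_mult_right_zero, subst Bochner_Integration.integral_sum) auto
  also have "\<dots> \<le> real k * (\<Sum>i<k. c_rem * h ^ 3)"
    by (intro mult_left_mono sum_mono each) auto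
  also have "\<dots> = (real k * h)\<^sup>2 * (c_rem * h)"
    by (simp add: power2_eq_square power3_eq_cube)
  also have "\<dots> \<le> (T - t0)\<^sup>2 * (c_rem * h)"
    using h const_nonneg kh by (intro mult_right_mono power_mono) auto
  finally show "(\<integral>\<omega>. (norm (\<Sum>i<k. rem_part i \<omega>))\<^sup>2 \<partial>M) \<le> (T - t0)\<^sup>2 * c_rem * h" by simp
qed

text \<open>The bound does not involve the refinement factor \<open>m\<close>, which is what permits
  the limit of infinitely fine grids at fixed \<open>h\<close>.\<close>

lemma stopped_error_power2:
  "integrable M (\<lambda>\<omega>. (norm (stopped_error \<omega>))\<^sup>2)"
  "(\<integral>\<omega>. (norm (stopped_error \<omega>))\<^sup>2 \<partial>M) \<le> 4 * (h * (c_main + 2 * c_lip * (\<Sum>i<k. err h i)))"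
proof -
  let ?Y = "\<lambda>\<omega>. \<Sum>l<k * m. drift_part l \<omega>" and ?Z = "\<lambda>\<omega>. \<Sum>l<k * m. dif_part l \<omega>"
    and ?N = "\<lambda>\<omega>. \<Sum>i<k. noise_part i \<omega>" and ?R = "\<lambda>\<omega>. \<Sum>i<k. rem_part i \<omega>"
  have meas: "?Y \<in> borel_measurable M" "?Z \<in> borel_measurable M" "?N \<in> borel_measurable M" "?R \<in> borel_measurable M"
    using drift_part_measurable dif_part_sum(3) noise_part_sum(3) rem_part_sum(3)
    by (auto intro!: borel_measurable_sum)
  have int: "integrable M (\<lambda>\<omega>. (norm (- ?N \<omega>))\<^sup>2)" "integrable M (\<lambda>\<omega>. (norm (- ?R \<omega>))\<^sup>2)"
    using noise_part_sum(1) rem_part_sum(1) by auto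
  show i: "integrable M (\<lambda>\<omega>. (norm (stopped_error \<omega>))\<^sup>2)"
    unfolding stopped_error_def
    by (intro integrable_norm_add_power2 borel_measurable_add borel_measurable_uminus meas
        drift_part_sum dif_part_sum int)
  have "(\<integral>\<omega>. (norm (stopped_error \<omega>))\<^sup>2 \<partial>M) \<le>
     (\<integral>\<omega>. 4 * ((norm (?Y \<omega>))\<^sup>2 + (norm (?Z \<omega>))\<^sup>2 + (norm (?N \<omega>))\<^sup>2 + (norm (?R \<omega>))\<^sup>2) \<partial>M)"
  proof (rule integral_mono[OF i])
    show "integrable M (\<lambda>\<omega>. 4 * ((norm (?Y \<omega>))\<^sup>2 + (norm (?Z \<omega>))\<^sup>2 + (norm (?N \<omega>))\<^sup>2 + (norm (?R \<omega>))\<^sup>2))"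
      using drift_part_sum(1) dif_part_sum(1) noise_part_sum(1) rem_part_sum(1) by simp
    fix \<omega>
    show "(norm (stopped_error \<omega>))\<^sup>2
      \<le> 4 * ((norm (?Y \<omega>))\<^sup>2 + (norm (?Z \<omega>))\<^sup>2 + (norm (?N \<omega>))\<^sup>2 + (norm (?R \<omega>))\<^sup>2)"
      unfolding stopped_error_def by (rule norm_add4_power2_le)
  qed
  also have "\<dots> = 4 * ((\<integral>\<omega>. (norm (?Y \<omega>))\<^sup>2 \<partial>M) + (\<integral>\<omega>. (norm (?Z \<omega>))\<^sup>2 \<partial>M)
       + (\<integral>\<omega>. (norm (?N \<omega>))\<^sup>2 \<partial>M) + (\<integral>\<omega>. (norm (?R \<omega>))\<^sup>2 \<partial>M))"
    using drift_part_sum(1) dif_part_sum(1) noise_part_sum(1) rem_part_sum(1) by simp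
  also have "\<dots> \<le> 4 * ((2 * (T - t0) * L\<^sup>2 * (h * (\<Sum>i<k. \<beta> i)) + 2 * (T - t0) ^ 3 * r\<^sup>2 * L\<^sup>2 * h)
      + 9 * L\<^sup>2 * (h * (\<Sum>i<k. \<beta> i)) + (T - t0) * c_noise * h + (T - t0)\<^sup>2 * c_rem * h)"
    by (intro mult_left_mono add_mono drift_part_sum dif_part_sum noise_part_sum rem_part_sum) auto
  also have "\<dots> = 4 * (c_lip * (h * (\<Sum>i<k. \<beta> i))
      + (2 * (T - t0) ^ 3 * r\<^sup>2 * L\<^sup>2 + (T - t0) * c_noise + (T - t0)\<^sup>2 * c_rem) * h)"
    by (simp add: c_lip_def algebra_simps)
  also have "\<dots> \<le> 4 * (c_lip * (h * (2 * c_incr * (T - t0) + 2 * (\<Sum>i<k. err h i)))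
      + (2 * (T - t0) ^ 3 * r\<^sup>2 * L\<^sup>2 + (T - t0) * c_noise + (T - t0)\<^sup>2 * c_rem) * h)"
    using const_nonneg by (intro mult_left_mono add_right_mono sum_\<beta>) auto
  also have "\<dots> = 4 * (h * (c_main + 2 * c_lip * (\<Sum>i<k. err h i)))"
    by (simp add: c_main_def algebra_simps)
  finally show "(\<integral>\<omega>. (norm (stopped_error \<omega>))\<^sup>2 \<partial>M) \<le> 4 * (h * (c_main + 2 * c_lip * (\<Sum>i<k. err h i)))" .
qed

text \<open>On this event every cut equals 1. The coefficients of the scheme are constant on blocks,
  so their fine sums collapse to one Euler step per block; the noise and remainder parts then
  complete these steps to the iterates.\<close>

lemma stopped_error_eq:
  assumes \<omega>: "\<omega> \<in> stay (grid h k)"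
  shows "stopped_error \<omega> = v0 + (\<Sum>l<k * m. euler_incr \<delta> l \<omega>) - e k \<omega>"
proof -
  let ?f = "\<lambda>i. drift B (grid h i) (e i \<omega>)"
  have "indicator (stay (grid \<delta> l)) \<omega> = (1::real)" if "l < k * m" for l
  proof -
    have "grid \<delta> l \<le> grid \<delta> (k * m)" using \<delta> that by (intro grid_mono) auto
    then show ?thesis using \<omega> stay_mono[of "grid \<delta> l" "grid h k"] g\<delta> by auto
  qed
  then have "(\<Sum>l<k * m. drift_part l \<omega>) + (\<Sum>l<k * m. dif_part l \<omega>)
     = (\<Sum>l<k * m. euler_incr \<delta> l \<omega> - (\<delta> *\<^sub>R ?f (l div m) + dif (e (l div m) \<omega>) (dW \<delta> l \<omega>)))"
    unfolding sum.distrib[symmetric]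
    by (intro sum.cong refl) (simp add: drift_part_def dif_part_def euler_incr_def algebra_simps)
  also have "\<dots> = (\<Sum>l<k * m. euler_incr \<delta> l \<omega>)
     - (\<Sum>l<k * m. \<delta> *\<^sub>R ?f (l div m)) - (\<Sum>l<k * m. dif (e (l div m) \<omega>) (dW \<delta> l \<omega>))"
    by (simp add: sum_subtractf sum.distrib)
  also have "(\<Sum>l<k * m. \<delta> *\<^sub>R ?f (l div m)) = (\<Sum>i<k. h *\<^sub>R ?f i)"
    using sum_div_blocks[OF m, of "\<lambda>i. \<delta> *\<^sub>R ?f i" k] m by (simp add: scaleR_sum_right)
  also have "(\<Sum>l<k * m. dif (e (l div m) \<omega>) (dW \<delta> l \<omega>)) = (\<Sum>i<k. dif (e i \<omega>) (dW h i \<omega>))"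
  proof -
    \<comment> \<open>The fine Wiener increments in a block telescope to the coarse
      increment.\<close>
    have tele: "(\<Sum>l\<in>{i * m..<i * m + m}. dW \<delta> l \<omega>) = dW h i \<omega>" for i
    proof -
      have "(\<Sum>l\<in>{i * m..<i * m + m}. dW \<delta> l \<omega>) = W (grid \<delta> (i * m + m)) \<omega> - W (grid \<delta> (i * m)) \<omega>"
        unfolding dW_def by (rule sum_Suc_diff') simp
      moreover have "grid \<delta> (i * m + m) = grid h (Suc i)" using g\<delta>[of "Suc i"] by (simp add: add.commute)
      ultimately show ?thesis by (simp add: g\<delta> dW_def)
    qed
    have "(\<Sum>l<k * m. dif (e (l div m) \<omega>) (dW \<delta> l \<omega>))
      = (\<Sum>i<k. \<Sum>l\<in>{i * m..<i * m + m}. dif (e (l div m) \<omega>) (dW \<delta> l \<omega>))"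
      by (rule sum.nat_group[symmetric])
    also have "\<dots> = (\<Sum>i<k. dif (e i \<omega>) (\<Sum>l\<in>{i * m..<i * m + m}. dW \<delta> l \<omega>))"
      unfolding dif_sum_right
    proof (intro sum.cong refl)
      fix i l assume "l \<in> {i * m..<i * m + m}"
      then have "l div m = i" by (intro div_nat_eqI) (auto simp: algebra_simps)
      then show "dif (e (l div m) \<omega>) (dW \<delta> l \<omega>) = dif (e i \<omega>) (dW \<delta> l \<omega>)" by simp
    qed
    also have "\<dots> = (\<Sum>i<k. dif (e i \<omega>) (dW h i \<omega>))" by (simp only: tele)
    finally show ?thesis .
  qed
  finally have 1: "(\<Sum>l<k * m. drift_part l \<omega>) + (\<Sum>l<k * m. dif_part l \<omega>)
    = (\<Sum>l<k * m. euler_incr \<delta> l \<omega>) - (\<Sum>i<k. h *\<^sub>R ?f i) - (\<Sum>i<k. dif (e i \<omega>) (dW h i \<omega>))" .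
  \<comment> \<open>Summation of the local expansion that defines \<open>esec_rem\<close>.\<close>
  have "e n \<omega> = v0 + (\<Sum>i<n. h *\<^sub>R ?f i) + (\<Sum>i<n. dif (e i \<omega>) (dW h i \<omega>))
      + (\<Sum>i<n. noise_part i \<omega>) + (\<Sum>i<n. rem_part i \<omega>)" for n
  proof (induction n)
    case (Suc n)
    have "e (Suc n) \<omega> = e n \<omega> + h *\<^sub>R ?f n + dif (e n \<omega>) (dW h n \<omega>) + noise_part n \<omega> + rem_part n \<omega>"
      by (simp add: noise_part_def rem_part_def esec_rem_def dW_def grid_def)
    then show ?case unfolding sum.lessThan_Suc by (simp only: Suc.IH) (simp add: ac_simps)
  qed simp
  from this[of k] show ?thesis
    unfolding stopped_error_def 1 by (simp add: algebra_simps)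
qed

end

text \<open>With \<open>m = Suc n\<close>, the error on the event is the stopped error plus the
  Euler residual, and the latter tends to 0 in probability. The limit doubles the second-moment
  bound: 8 is \<open>2 * 4\<close>, and 16 is \<open>2 * 4 * 2\<close>.\<close>

lemma err_recursion:
  assumes h: "h > 0" "h \<le> T - t0" and gk: "grid h k \<le> T"
  shows "err h k \<le> h * (8 * c_main + 16 * c_lip * (\<Sum>i<k. err h i))"
proof -
  let ?c = "4 * (h * (c_main + 2 * c_lip * (\<Sum>i<k. err h i)))"
  have gin: "grid h k \<in> {t0..T}" using grid_in[OF less_imp_le[OF h(1)] gk] by simp
  have eM: "esec B W t0 h v0 k \<in> borel_measurable M"
    using esec_measurable_F[OF less_imp_le[OF h(1)] gk order_refl] measurable_F_M by blast
  have "(\<integral>\<omega>. indicator (stay (grid h k)) \<omega> * (norm (v (grid h k) \<omega> - esec B W t0 h v0 k \<omega>))\<^sup>2 \<partial>M) \<le> 2 * ?c"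
  proof (rule expectation_power2_le_of_conv_in_prob[where K="2 * r + r"
        and X="\<lambda>n. stopped_error h k (Suc n)"
        and D="\<lambda>n \<omega>. v (grid h k) \<omega> - v0 - (\<Sum>l<k * Suc n. euler_incr (h / real (Suc n)) l \<omega>)"])
    show "stay (grid h k) \<in> events" by (rule stay_events[OF gin])
    show "(\<lambda>\<omega>. v (grid h k) \<omega> - esec B W t0 h v0 k \<omega>) \<in> borel_measurable M"
      by (intro borel_measurable_diff v_measurable gin eM)
    show "v (grid h k) \<omega> - esec B W t0 h v0 k \<omega> = stopped_error h k (Suc n) \<omega> +
        (v (grid h k) \<omega> - v0 - (\<Sum>l<k * Suc n. euler_incr (h / real (Suc n)) l \<omega>))"
      if "\<omega> \<in> stay (grid h k)" for n \<omega>
      unfolding stopped_error_eq[OF h gk zero_less_Suc that] by simp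
    show "norm (v (grid h k) \<omega> - esec B W t0 h v0 k \<omega>) \<le> 2 * r + r" if "\<omega> \<in> stay (grid h k)" for \<omega>
      using stay_annulus[OF that, of "grid h k"] gin
      by (intro order_trans[OF norm_triangle_ineq4] add_mono) (auto simp: annulus_def norm_v0)
    show "integrable M (\<lambda>\<omega>. (norm (stopped_error h k (Suc n) \<omega>))\<^sup>2)"
      "(\<integral>\<omega>. (norm (stopped_error h k (Suc n) \<omega>))\<^sup>2 \<partial>M) \<le> ?c" for n
      by (rule stopped_error_power2[OF h gk zero_less_Suc])+
  qed (rule euler_conv[OF h(1) gk]; assumption)+
  then have "err h k \<le> 2 * ?c" by (simp only: err_def[of h k])
  then show ?thesis by (simp add: algebra_simps)
qed

end

section \<open>Gronwall's inequality and removal of the localization\<close>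

lemma discrete_gronwall:
  fixes a :: "nat \<Rightarrow> real"
  assumes "0 \<le> c" "0 \<le> d" and a: "\<And>i. i \<le> k \<Longrightarrow> a i \<le> c + d * (\<Sum>j<i. a j)"
  shows "a k \<le> c * (1 + d) ^ k"
proof -
  \<comment> \<open>The induction runs on the majorant, which grows by at most the factor
    \<open>1 + d\<close> in each step.\<close>
  have "c + d * (\<Sum>j<i. a j) \<le> c * (1 + d) ^ i" if "i \<le> k" for i
    using that
  proof (induction i)
    case (Suc i)
    have "c + d * (\<Sum>j<Suc i. a j) = (c + d * (\<Sum>j<i. a j)) + d * a i" by (simp add: algebra_simps)
    also have "\<dots> \<le> (c + d * (\<Sum>j<i. a j)) + d * (c + d * (\<Sum>j<i. a j))"
      using a[of i] Suc.prems assms by (intro add_left_mono mult_left_mono) auto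
    also have "\<dots> = (1 + d) * (c + d * (\<Sum>j<i. a j))" by (simp add: algebra_simps)
    also have "\<dots> \<le> (1 + d) * (c * (1 + d) ^ i)"
      using Suc assms by (intro mult_left_mono) auto
    finally show ?case by (simp add: ac_simps)
  qed simp
  then show ?thesis using a[of k] by force
qed

text \<open>The path could leave the band only from level \<open>r\<close>.\<close>

lemma band_confinement:
  fixes \<phi> :: "real \<Rightarrow> real"
  assumes cont: "continuous_on {a..b} \<phi>" and ab: "a \<le> b" and r: "r > 0" "\<phi> a = r"
    and rat: "\<And>c. c \<in> \<rat> \<Longrightarrow> c \<in> {a..b} \<Longrightarrow> \<forall>s\<in>{a..c}. \<phi> s \<in> {r/2..2*r} \<Longrightarrow> \<phi> c = r"
  shows "\<forall>s\<in>{a..b}. \<phi> s \<in> {r/2..2*r}"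
proof -
  define S where "S = {t \<in> {a..b}. \<forall>s\<in>{a..t}. \<phi> s \<in> {r/2..2*r}}"
  have aS: "a \<in> S" using ab r by (auto simp: S_def)
  have bdd: "bdd_above S" by (auto simp: S_def)
  define \<sigma> where "\<sigma> = Sup S"
  have "a \<le> \<sigma>" unfolding \<sigma>_def by (rule cSup_upper[OF aS bdd])
  have "\<sigma> \<le> b" unfolding \<sigma>_def by (rule cSup_least) (use aS in \<open>auto simp: S_def\<close>)
  have below: "\<phi> s \<in> {r/2..2*r}" if "a \<le> s" "s < \<sigma>" for s
  proof -
    obtain t where "t \<in> S" "s < t"
      using \<open>s < \<sigma>\<close> less_cSup_iff[OF _ bdd, of s] aS unfolding \<sigma>_def by auto
    then show ?thesis using that by (auto simp: S_def)
  qed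
  have near: "\<exists>d>0. \<forall>s\<in>{a..b}. \<bar>s - \<sigma>\<bar> < d \<longrightarrow> \<bar>\<phi> s - \<phi> \<sigma>\<bar> < e" if "e > 0" for e
    using cont \<open>a \<le> \<sigma>\<close> \<open>\<sigma> \<le> b\<close> that unfolding continuous_on_iff dist_real_def by auto
  have \<sigma>r: "\<phi> \<sigma> = r"
  \<comment> \<open>Before \<open>\<sigma>\<close> the path is in the band, so at rational times
    just to the left of \<open>\<sigma>\<close> it has the value \<open>r\<close>; by continuity so
    has \<open>\<phi> \<sigma>\<close>. If \<open>\<sigma> = a\<close> this is the initial
    value.\<close>
  proof (rule ccontr)
    assume ne: "\<phi> \<sigma> \<noteq> r"
    then have "a < \<sigma>" using r(2) \<open>a \<le> \<sigma>\<close> by (cases "a = \<sigma>") auto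
    obtain d where d: "d > 0" "\<And>s. s \<in> {a..b} \<Longrightarrow> \<bar>s - \<sigma>\<bar> < d \<Longrightarrow> \<bar>\<phi> s - \<phi> \<sigma>\<bar> < \<bar>\<phi> \<sigma> - r\<bar>"
      using near[of "\<bar>\<phi> \<sigma> - r\<bar>"] ne by auto
    have "max a (\<sigma> - d) < \<sigma>" using \<open>a < \<sigma>\<close> d by simp
    then obtain c where c: "c \<in> \<rat>" "max a (\<sigma> - d) < c" "c < \<sigma>"
      using Rats_dense_in_real by blast
    then have "\<phi> c = r" using below \<open>\<sigma> \<le> b\<close> by (intro rat) auto
    then show False using d(2)[of c] c \<open>\<sigma> \<le> b\<close> by auto
  qed
  have "\<sigma> = b"
  \<comment> \<open>From the value \<open>r\<close>, which is interior to the band, the path stays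
    within \<open>r / 2\<close> of \<open>r\<close> for some further time, so
    \<open>\<sigma>\<close> would not be the supremum.\<close>
  proof (rule ccontr)
    assume "\<sigma> \<noteq> b"
    obtain d where d: "d > 0" "\<And>s. s \<in> {a..b} \<Longrightarrow> \<bar>s - \<sigma>\<bar> < d \<Longrightarrow> \<bar>\<phi> s - r\<bar> < r / 2"
      using near[of "r / 2"] r(1) \<sigma>r by auto
    define t where "t = min b (\<sigma> + d / 2)"
    have t: "\<sigma> < t" "t \<le> b" "t < \<sigma> + d" using \<open>\<sigma> \<noteq> b\<close> \<open>\<sigma> \<le> b\<close> d by (auto simp: t_def)
    have "\<phi> s \<in> {r/2..2*r}" if s: "s \<in> {a..t}" for s
    proof (cases "s < \<sigma>")
      case True
      then show ?thesis using below s by auto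
    next
      case False
      then have "\<bar>\<phi> s - r\<bar> < r / 2" using s t by (intro d(2)) auto
      then show ?thesis using r(1) by (auto simp: abs_if split: if_splits)
    qed
    then have "t \<in> S" using t \<open>a \<le> \<sigma>\<close> by (auto simp: S_def)
    then have "t \<le> \<sigma>" unfolding \<sigma>_def by (rule cSup_upper[OF _ bdd])
    then show False using t by simp
  qed
  then show ?thesis
    using below \<sigma>r r(1) by (force simp: le_less)
qed

context sde
begin

definition c_total :: real where "c_total = 8 * c_main * exp (16 * c_lip * (T - t0))"

lemma c_total_nonneg: "c_total \<ge> 0"
  using const_nonneg by (simp add: c_total_def)

lemma err_le:
  assumes h: "h > 0" "h \<le> T - t0" and gk: "grid h k \<le> T"
  shows "err h k \<le> c_total * h"
proof -
  have "err h k \<le> (h * (8 * c_main)) * (1 + h * (16 * c_lip)) ^ k"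
  proof (rule discrete_gronwall)
    fix i assume "i \<le> k"
    then have "grid h i \<le> T" using grid_mono[of h i k] h gk by auto
    from err_recursion[OF h this]
    show "err h i \<le> h * (8 * c_main) + h * (16 * c_lip) * (\<Sum>j<i. err h j)"
      by (simp add: algebra_simps)
  qed (use h const_nonneg in auto)
  \<comment> \<open>Since \<open>k h \<le> T - t0\<close>, the exponential bound makes the growth
    factor independent of the number of steps.\<close>
  also have "\<dots> \<le> (h * (8 * c_main)) * exp (h * (16 * c_lip)) ^ k"
    using h const_nonneg by (intro mult_left_mono power_mono exp_ge_add_one_self) auto
  also have "\<dots> = (h * (8 * c_main)) * exp (16 * c_lip * (real k * h))"
    by (simp add: exp_of_nat_mult[symmetric] ac_simps)
  also have "\<dots> \<le> (h * (8 * c_main)) * exp (16 * c_lip * (T - t0))"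
    using h const_nonneg gk by (intro mult_left_mono) (auto simp: grid_def intro!: mult_left_mono)
  finally show ?thesis by (simp add: c_total_def ac_simps)
qed

text \<open>The iterates have norm \<open>r\<close>, so by the reverse triangle inequality the
  deviation of \<open>|v|\<close> from \<open>r\<close> is at most the distance to the scheme, whose
  localized mean square is at most \<open>c_total h\<close> for arbitrarily small
  \<open>h\<close>.\<close>

lemma norm_conserved_while_staying:
  assumes t: "t \<in> {t0..T}"
  shows "AE \<omega> in M. \<omega> \<in> stay t \<longrightarrow> norm (v t \<omega>) = r"
proof (cases "t = t0")
  case True
  then show ?thesis by (intro AE_I2) (simp add: v_t0 norm_v0)
next
  case False
  then have tt: "t0 < t" "t \<le> T" using t by auto
  note [measurable] = v_measurable[OF t] stay_events[OF t]
  define f where "f \<omega> = indicator (stay t) \<omega> * (norm (norm (v t \<omega>) - r))\<^sup>2" for \<omega>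
  have bd: "norm (v t \<omega>) \<le> 2 * r" if "\<omega> \<in> stay t" for \<omega>
    using stay_annulus[OF that, of t] t by (auto simp: annulus_def)
  have fi: "integrable M f"
    unfolding f_def
  proof (rule integrable_indicator_norm_power2)
    show "norm (norm (v t \<omega>) - r) \<le> 2 * r" if "\<omega> \<in> stay t" for \<omega>
      unfolding real_norm_def
      by (rule abs_leI) (use bd[OF that] r_pos norm_ge_zero[of "v t \<omega>"] in linarith)+
  qed measurable
  have "(\<integral>\<omega>. f \<omega> \<partial>M) \<le> c_total * ((t - t0) / real (Suc N))" for N
  proof -
    \<comment> \<open>The mesh divides \<open>[t0, t]\<close> and not \<open>[t0, T]\<close>, so
      that the given time is the grid point of index \<open>Suc N\<close>; the localized estimate
      holds for any mesh whose grid point lies in the interval.\<close>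
    define h where "h = (t - t0) / real (Suc N)"
    have h: "h > 0" using tt by (simp add: h_def)
    have g: "grid h (Suc N) = t" by (simp add: grid_def h_def del: of_nat_Suc)
    have "h \<le> (t - t0) / 1" unfolding h_def using tt by (intro divide_left_mono) auto
    then have hT: "h \<le> T - t0" using tt by simp
    have eM [measurable]: "esec B W t0 h v0 (Suc N) \<in> borel_measurable M"
      using measurable_F_M[OF esec_measurable_F[OF less_imp_le[OF h], of "Suc N" "Suc N"]] g tt by auto
    have "(\<integral>\<omega>. f \<omega> \<partial>M) \<le> err h (Suc N)"
      unfolding err_def g
    proof (rule integral_mono[OF fi])
      show "integrable M (\<lambda>\<omega>. indicator (stay t) \<omega> * (norm (v t \<omega> - esec B W t0 h v0 (Suc N) \<omega>))\<^sup>2)"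
      proof (rule integrable_indicator_norm_power2)
        show "norm (v t \<omega> - esec B W t0 h v0 (Suc N) \<omega>) \<le> 2 * r + r" if "\<omega> \<in> stay t" for \<omega>
          using bd[OF that]
          by (intro order_trans[OF norm_triangle_ineq4] add_mono) (simp_all add: norm_v0 del: esec.simps)
      qed measurable
      show "f \<omega> \<le> indicator (stay t) \<omega> * (norm (v t \<omega> - esec B W t0 h v0 (Suc N) \<omega>))\<^sup>2" for \<omega>
        unfolding f_def using norm_triangle_ineq3[of "v t \<omega>" "esec B W t0 h v0 (Suc N) \<omega>"]
        by (intro mult_left_mono power_mono) (simp_all add: norm_v0 del: esec.simps)
    qed
    also have "\<dots> \<le> c_total * h" using g tt by (intro err_le h hT) auto
    finally show ?thesis by (simp add: h_def)
  qed
  moreover have "(\<lambda>N. c_total * ((t - t0) / real (Suc N))) \<longlonglongrightarrow> c_total * 0"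
    by (intro tendsto_mult tendsto_const LIMSEQ_Suc[OF lim_const_over_n])
  ultimately have "(\<integral>\<omega>. f \<omega> \<partial>M) \<le> 0"
    by (intro LIMSEQ_le_const[where X="\<lambda>N. c_total * ((t - t0) / real (Suc N))"]) auto
  moreover have nonneg: "AE \<omega> in M. 0 \<le> f \<omega>" by (simp add: f_def)
  ultimately have "AE \<omega> in M. f \<omega> = 0"
    using integral_nonneg_AE[OF nonneg] integral_nonneg_eq_0_iff_AE[OF fi nonneg] by linarith
  then show ?thesis
    by eventually_elim (auto simp: f_def)
qed

text \<open>The exceptional null set depends on the time, so conservation holds simultaneously only
  at countably many times. Rational ones suffice for \<open>band_confinement\<close>, which acts on
  each remaining path separately.\<close>

lemma AE_stay: "AE \<omega> in M. \<omega> \<in> stay T"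
proof -
  have "AE \<omega> in M. \<forall>t\<in>\<rat> \<inter> {t0..T}. \<omega> \<in> stay t \<longrightarrow> norm (v t \<omega>) = r"
    by (subst AE_ball_countable)
      (auto intro!: norm_conserved_while_staying countable_Int1 countable_rat)
  then show ?thesis
  proof (rule AE_mp, intro AE_I2 impI)
    fix \<omega> assume \<omega>: "\<omega> \<in> space M"
      and *: "\<forall>t\<in>\<rat> \<inter> {t0..T}. \<omega> \<in> stay t \<longrightarrow> norm (v t \<omega>) = r"
    have "\<forall>s\<in>{t0..T}. norm (v s \<omega>) \<in> {r/2..2*r}"
    proof (rule band_confinement)
      show "continuous_on {t0..T} (\<lambda>s. norm (v s \<omega>))"
        by (intro continuous_on_norm v_continuous \<omega>)
      show "norm (v c \<omega>) = r" if "c \<in> \<rat>" "c \<in> {t0..T}" "\<forall>s\<in>{t0..c}. norm (v s \<omega>) \<in> {r/2..2*r}" for c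
        using * that \<omega> by (auto simp: stay_def annulus_def)
    qed (use t0_less_T r_pos \<omega> in \<open>auto simp: v_t0 norm_v0\<close>)
    then show "\<omega> \<in> stay T" using \<omega> by (auto simp: stay_def annulus_def)
  qed
qed

text \<open>Almost every path stays in the annulus up to \<open>T\<close>, so the indicator in
  \<open>err\<close> equals 1 almost surely and the localized error is the full one.\<close>

lemma strong_error:
  assumes N: "0 < N" "k \<le> N"
  defines "h \<equiv> (T - t0) / real N"
  shows "sqrt (\<integral>\<omega>. (norm (v (t0 + real k * h) \<omega> - esec B W t0 h v0 k \<omega>))\<^sup>2 \<partial>M) \<le> sqrt c_total * sqrt h"
proof -
  have h: "h > 0" using t0_less_T N by (simp add: h_def)
  have "h \<le> (T - t0) / 1" unfolding h_def using t0_less_T N by (intro divide_left_mono) auto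
  then have hT: "h \<le> T - t0" by simp
  have "real k * h \<le> real N * h" using N h by (intro mult_right_mono) auto
  also have "\<dots> = T - t0" using N by (simp add: h_def)
  finally have gk: "grid h k \<le> T" by (simp add: grid_def)
  have gin: "grid h k \<in> {t0..T}" using grid_in[OF less_imp_le[OF h] gk] by simp
  note [measurable] = v_measurable[OF gin] stay_events[OF gin]
    measurable_F_M[OF esec_measurable_F[OF less_imp_le[OF h] gk order_refl]]
  have "(\<integral>\<omega>. (norm (v (grid h k) \<omega> - esec B W t0 h v0 k \<omega>))\<^sup>2 \<partial>M) = err h k"
    unfolding err_def
  proof (rule integral_cong_AE)
    show "AE \<omega> in M. (norm (v (grid h k) \<omega> - esec B W t0 h v0 k \<omega>))\<^sup>2
      = indicator (stay (grid h k)) \<omega> * (norm (v (grid h k) \<omega> - esec B W t0 h v0 k \<omega>))\<^sup>2"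
      using AE_stay by eventually_elim (use stay_mono[OF gk] in \<open>auto simp: indicator_def\<close>)
  qed measurable
  also have "\<dots> \<le> c_total * h" by (rule err_le[OF h hT gk])
  finally show ?thesis
    by (simp add: grid_def real_sqrt_mult[symmetric])
qed

end

theorem theorem1:
  fixes M :: "'a measure" and F :: "real \<Rightarrow> 'a measure"
    and W v :: "real \<Rightarrow> 'a \<Rightarrow> real^3" and B :: "real \<Rightarrow> real^3"
    and t0 T :: real and v0 :: "real^3"
  assumes "t0 < T"
    and "\<exists>B'. (\<forall>t\<in>{t0..T}. (B has_vector_derivative B' t) (at t within {t0..T}))
              \<and> continuous_on {t0..T} B'"
    and "wiener3 M F t0 T W"
    and "v0 \<noteq> 0"
    and "sde_solution M F t0 T B W v0 v"
  shows "\<exists>K. \<forall>N::nat. \<forall>k\<le>N. 0 < N \<longrightarrow>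
           sqrt (\<integral>\<omega>. (norm (v (t0 + real k * ((T - t0) / real N)) \<omega>
                                - esec B W t0 ((T - t0) / real N) v0 k \<omega>))\<^sup>2 \<partial>M)
           \<le> K * sqrt (1 + (norm v0)\<^sup>2) * sqrt ((T - t0) / real N)"
proof -
  obtain B' where B': "\<And>t. t \<in> {t0..T} \<Longrightarrow> (B has_vector_derivative B' t) (at t within {t0..T})"
    "continuous_on {t0..T} B'"
    using assms(2) by blast
  define r where "r = norm v0"
  have r: "r > 0" using assms(4) by (simp add: r_def)
  have "bounded (B' ` {t0..T})"
    by (intro compact_imp_bounded compact_continuous_image B') simp
  then obtain b1 where b1: "b1 > 0" "\<And>t. t \<in> {t0..T} \<Longrightarrow> norm (B' t) \<le> b1"
    unfolding bounded_pos by auto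
  have Lip: "norm (B s - B t) \<le> b1 * \<bar>s - t\<bar>" if "s \<in> {t0..T}" "t \<in> {t0..T}" for s t
  proof -
    have "norm (B s - B t) \<le> b1 * norm (s - t)"
    proof (rule differentiable_bound[of "{t0..T}" B "\<lambda>t x. x *\<^sub>R B' t"])
      show "(B has_derivative (\<lambda>x. x *\<^sub>R B' u)) (at u within {t0..T})" if "u \<in> {t0..T}" for u
        using B'(1)[OF that] by (simp add: has_vector_derivative_def)
      show "onorm (\<lambda>x. x *\<^sub>R B' u) \<le> b1" if "u \<in> {t0..T}" for u
        by (rule onorm_le) (use b1(2)[OF that] in \<open>simp add: mult.commute[of b1] mult_left_mono\<close>)
    qed (use that in auto)
    then show ?thesis by simp
  qed
  define b where "b = norm (B t0) + b1 * (T - t0)"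
  have b0: "b \<ge> 0" using b1 assms(1) by (simp add: b_def)
  have bB: "norm (B t) \<le> b" if "t \<in> {t0..T}" for t
  proof -
    have "norm (B t) \<le> norm (B t0) + norm (B t - B t0)"
      by (rule norm_triangle_sub)
    also have "norm (B t - B t0) \<le> b1 * \<bar>t - t0\<bar>" using that assms(1) by (intro Lip) auto
    also have "\<dots> \<le> b1 * (T - t0)" using that b1 by (intro mult_left_mono) auto
    finally show ?thesis by (simp add: b_def)
  qed
  obtain L1 where L1: "L1 \<ge> 0" "\<And>x y w. x \<in> annulus r \<Longrightarrow> y \<in> annulus r \<Longrightarrow>
      norm (dif x w - dif y w) \<le> L1 * norm (x - y) * norm w"
    using dif_Lipschitz[OF r] by blast
  obtain L2 where L2: "L2 \<ge> 0" "\<And>x y t. x \<in> annulus r \<Longrightarrow> y \<in> annulus r \<Longrightarrow> norm (B t) \<le> b \<Longrightarrow>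
      norm (drift B t x - drift B t y) \<le> L2 * norm (x - y)"
    using drift_Lipschitz[OF r b0] by blast
  obtain L3 where L3: "L3 \<ge> 0" "\<And>t h w x. h \<ge> 0 \<Longrightarrow> norm x = r \<Longrightarrow> norm (B t) \<le> b \<Longrightarrow>
     norm (esec_rem B t h w x) \<le> L3 * ((norm w + h) * h + (norm w + h) ^ 3)"
    using norm_esec_rem_le[OF r b0] by blast
  define L4 where "L4 = 2 * r * b + (2 / r) ^ 3 * (2 * r)"
  \<comment> \<open>A sum of nonnegative constants dominates each of them. All dependence on the
    initial value, the interval and the field enters through \<open>r\<close>, \<open>T - t0\<close>
    and this \<open>L\<close>.\<close>
  define L where "L = b1 + L1 + L2 + L3 + L4 + sqrt (2 / r)"
  have "L4 \<ge> 0" "sqrt (2 / r) \<ge> 0" using r b0 by (auto simp: L4_def)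
  then have L: "b1 \<le> L" "L1 \<le> L" "L2 \<le> L" "L3 \<le> L" "L4 \<le> L" "sqrt (2 / r) \<le> L" "0 \<le> L"
    using b1(1) L1(1) L2(1) L3(1) by (auto simp: L_def)
  interpret prob_space M using assms(3) by (simp add: wiener3_def)
  interpret sde M F t0 T W B v0 v r L
  proof
    show "wiener3 M F t0 T W" "t0 < T" "sde_solution M F t0 T B W v0 v" by fact+
    show "0 < r" "norm v0 = r" "0 \<le> L" using r L by (auto simp: r_def)
    show "norm (B s - B t) \<le> L * \<bar>s - t\<bar>" if "s \<in> {t0..T}" "t \<in> {t0..T}" for s t
      using Lip[OF that] mult_right_mono[OF L(1), of "\<bar>s - t\<bar>"] by simp
    show "norm (drift B t x - drift B t y) \<le> L * norm (x - y)"
      if "t \<in> {t0..T}" "x \<in> annulus r" "y \<in> annulus r" for t x y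
      using L2(2)[OF that(2,3) bB[OF that(1)]] mult_right_mono[OF L(3), of "norm (x - y)"] by simp
    show "norm (drift B t x) \<le> L" if "t \<in> {t0..T}" "x \<in> annulus r" for t x
      using norm_drift_le[OF r that(2), of B t b] bB[OF that(1)] L(5) by (simp add: L4_def)
    show "norm (dif x w - dif y w) \<le> L * norm (x - y) * norm w"
      if "x \<in> annulus r" "y \<in> annulus r" for x y w
      using L1(2)[OF that, of w] mult_right_mono[OF L(2), of "norm (x - y) * norm w"]
      by (simp add: mult.assoc)
    show "norm (dif x w) \<le> L * norm w" if "x \<in> annulus r" for x w
      using norm_dif_le[OF r that, of w] mult_right_mono[OF L(6), of "norm w"] by simp
    show "norm (esec_rem B t h w x) \<le> L * ((norm w + h) * h + (norm w + h) ^ 3)"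
      if "t \<in> {t0..T}" "0 \<le> h" "norm x = r" for t h w x
      using L3(2)[OF that(2,3) bB[OF that(1)], of w] that(2)
        mult_right_mono[OF L(4), of "(norm w + h) * h + (norm w + h) ^ 3"] by simp
  qed
  show ?thesis
  proof (intro exI allI impI)
    fix N k :: nat assume "k \<le> N" "0 < N"
    define h where "h = (T - t0) / real N"
    have "sqrt (\<integral>\<omega>. (norm (v (t0 + real k * h) \<omega> - esec B W t0 h v0 k \<omega>))\<^sup>2 \<partial>M) \<le> sqrt c_total * sqrt h"
      unfolding h_def by (rule strong_error) fact+
    also have "\<dots> = sqrt c_total * 1 * sqrt h" by simp
    \<comment> \<open>The factor \<open>sqrt (1 + |v0|^2)\<close> is at least 1, so
      \<open>sqrt c_total\<close> already serves as \<open>K\<close>.\<close>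
    also have "\<dots> \<le> sqrt c_total * sqrt (1 + (norm v0)\<^sup>2) * sqrt h"
      using c_total_nonneg t0_less_T by (intro mult_right_mono mult_left_mono) (auto simp: h_def)
    finally show "sqrt (\<integral>\<omega>. (norm (v (t0 + real k * ((T - t0) / real N)) \<omega>
                                - esec B W t0 ((T - t0) / real N) v0 k \<omega>))\<^sup>2 \<partial>M)
           \<le> sqrt c_total * sqrt (1 + (norm v0)\<^sup>2) * sqrt ((T - t0) / real N)"
      by (simp only: h_def)
  qed
qed

end
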